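(* Let $K$ be a field, let $G$ be a connected decomposable graph with vertex set $[n]$, and let $G=G_1\cup G_2$ be a decomposition of $G$, i.e. $G_1$ and $G_2$ are subgraphs of $G$ whose union is $G$, with $V(G_1)\cap V(G_2)=\{v\}$, where $v$ is a free vertex of $G_1$ and of $G_2$. Let $S=K[x_1,\ldots,x_n,y_1,\ldots,y_n]$ and let $J_G,J_{G_1},J_{G_2}\subset S$ be the binomial edge ideals of $G,G_1,G_2$. Then \[ B_{S/J_G}(s,t)=B_{S/J_{G_1}}(s,t)\,B_{S/J_{G_2}}(s,t). \]
   Context: All graphs are finite and simple. $G=G_1\cup G_2$ means $V(G)=V(G_1)\cup V(G_2)$ and $E(G)=E(G_1)\cup E(G_2)$. A clique of a graph is a set of pairwise adjacent vertices; the clique degree of a vertex is the number of maximal cliques of the graph containing it; a vertex is free if its clique degree is 1. The polynomial ring $S$ is standard graded. For a graph $H$ with $V(H)\subseteq[n]$, its binomial edge ideal in $S$ is $J_H=(x_iy_j-x_jy_i : \{i,j\}\in E(H),\ i<j)\subset S$. For a finitely generated graded $S$-module $M$, $\beta_{i,j}(M)=\dim_K\operatorname{Tor}^S_i(M,K)_j$, and $B_M(s,t)=\sum_{i,j}\beta_{i,j}(M)s^it^j$ is the Betti polynomial of $M$. *)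

theory Defs
  imports
    "HOL-Library.Poly_Mapping"
    "HOL-Library.Function_Algebras"
    "HOL-Computational_Algebra.Polynomial"
begin

section \<open>Finite simple graphs\<close>

record 'v sgraph =
  verts :: "'v set"
  edges :: "'v set set"

definition simple_graph :: "'v sgraph \<Rightarrow> bool" where
  "simple_graph G \<longleftrightarrow> finite (verts G) \<and>
     (\<forall>e\<in>edges G. \<exists>u\<in>verts G. \<exists>w\<in>verts G. u \<noteq> w \<and> e = {u, w})"

definition subgraph :: "'v sgraph \<Rightarrow> 'v sgraph \<Rightarrow> bool" where
  "subgraph H G \<longleftrightarrow> simple_graph H \<and> verts H \<subseteq> verts G \<and> edges H \<subseteq> edges G"

definition graph_union :: "'v sgraph \<Rightarrow> 'v sgraph \<Rightarrow> 'v sgraph" where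
  "graph_union G H = \<lparr>verts = verts G \<union> verts H, edges = edges G \<union> edges H\<rparr>"

definition connected_graph :: "'v sgraph \<Rightarrow> bool" where
  "connected_graph G \<longleftrightarrow> verts G \<noteq> {} \<and>
     (\<forall>u\<in>verts G. \<forall>w\<in>verts G. (u, w) \<in> {(a, b). {a, b} \<in> edges G}\<^sup>*)"

definition clique :: "'v sgraph \<Rightarrow> 'v set \<Rightarrow> bool" where
  "clique G C \<longleftrightarrow> C \<subseteq> verts G \<and> (\<forall>u\<in>C. \<forall>w\<in>C. u \<noteq> w \<longrightarrow> {u, w} \<in> edges G)"

definition maximal_clique :: "'v sgraph \<Rightarrow> 'v set \<Rightarrow> bool" where
  "maximal_clique G C \<longleftrightarrow> clique G C \<and> (\<forall>D. clique G D \<longrightarrow> C \<subseteq> D \<longrightarrow> D = C)"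

definition clique_degree :: "'v sgraph \<Rightarrow> 'v \<Rightarrow> nat" where
  "clique_degree G v = card {C. maximal_clique G C \<and> v \<in> C}"

definition free_vertex :: "'v sgraph \<Rightarrow> 'v \<Rightarrow> bool" where
  "free_vertex G v \<longleftrightarrow> v \<in> verts G \<and> clique_degree G v = 1"

definition decomposition :: "'v sgraph \<Rightarrow> 'v sgraph \<Rightarrow> 'v sgraph \<Rightarrow> 'v \<Rightarrow> bool" where
  "decomposition G G1 G2 v \<longleftrightarrow>
     subgraph G1 G \<and> subgraph G2 G \<and> G = graph_union G1 G2 \<and>
     verts G1 \<inter> verts G2 = {v} \<and> free_vertex G1 v \<and> free_vertex G2 v"

definition decomposable :: "'v sgraph \<Rightarrow> bool" where
  "decomposable G \<longleftrightarrow> (\<exists>G1 G2 v. decomposition G G1 G2 v)"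

section \<open>Polynomial rings and binomial edge ideals\<close>

text \<open>The polynomial ring over \<open>'k\<close> in the variables indexed by \<open>'w\<close>: finitely supported
  functions from monomials (exponent vectors) to coefficients, with the convolution product.\<close>

type_synonym ('w, 'k) mpoly = "('w \<Rightarrow>\<^sub>0 nat) \<Rightarrow>\<^sub>0 'k"

definition Var :: "'w \<Rightarrow> ('w, 'k::comm_ring_1) mpoly" where
  "Var w = Poly_Mapping.single (Poly_Mapping.single w 1) 1"

definition mdeg :: "('w \<Rightarrow>\<^sub>0 nat) \<Rightarrow> nat" where
  "mdeg m = (\<Sum>w\<in>Poly_Mapping.keys m. Poly_Mapping.lookup m w)"

definition const_coeff :: "('w, 'k::zero) mpoly \<Rightarrow> 'k" where
  "const_coeff p = Poly_Mapping.lookup p 0"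

lemma module_times: "module ((*) :: 'a::comm_ring_1 \<Rightarrow> 'a \<Rightarrow> 'a)"
  by standard (simp_all add: algebra_simps)

definition ideal_gen :: "'a::comm_ring_1 set \<Rightarrow> 'a set" where
  "ideal_gen B = module.span (*) B"

text \<open>The ring \<open>S\<close>: the variable \<open>x\<^sub>i\<close> is indexed by \<open>Inl i\<close>, the variable \<open>y\<^sub>i\<close> by \<open>Inr i\<close>.
  When \<open>'v\<close> is a finite linearly ordered type with \<open>n\<close> elements, it plays the role of \<open>[n]\<close>.\<close>

type_synonym ('v, 'k) xy_poly = "('v + 'v, 'k) mpoly"

definition binomial_edge_ideal :: "'v::linorder sgraph \<Rightarrow> ('v, 'k::comm_ring_1) xy_poly set" where
  "binomial_edge_ideal H = ideal_gen
     {Var (Inl i) * Var (Inr j) - Var (Inl j) * Var (Inr i) | i j. {i, j} \<in> edges H \<and> i < j}"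

section \<open>Graded Betti numbers of \<open>S/I\<close>\<close>

text \<open>A sequence of graded free modules of finite rank and matrices between them. The module
  \<open>F\<^sub>i\<close> is the direct sum of the \<open>S(-d)\<close>, \<open>d = shift F i k\<close>, over \<open>k < rnk F i\<close>; its elements
  are the functions \<open>nat \<Rightarrow> S\<close> vanishing outside \<open>{..<rnk F i}\<close>. The map from \<open>F\<^sub>i\<^sub>+\<^sub>1\<close> to \<open>F\<^sub>i\<close>
  has matrix \<open>diff F i\<close>, with the row index first.\<close>

record 's graded_free_seq =
  rnk :: "nat \<Rightarrow> nat"
  shift :: "nat \<Rightarrow> nat \<Rightarrow> nat"
  diff :: "nat \<Rightarrow> nat \<Rightarrow> nat \<Rightarrow> 's"

definition free_mod :: "nat \<Rightarrow> (nat \<Rightarrow> 'a::zero) set" where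
  "free_mod r = {f. \<forall>k. r \<le> k \<longrightarrow> f k = 0}"

definition mat_app ::
  "nat \<Rightarrow> nat \<Rightarrow> (nat \<Rightarrow> nat \<Rightarrow> 'a::comm_ring_1) \<Rightarrow> (nat \<Rightarrow> 'a) \<Rightarrow> nat \<Rightarrow> 'a" where
  "mat_app r c A f = (\<lambda>l. if l < r then \<Sum>k<c. A l k * f k else 0)"

text \<open>\<open>F\<close> is a graded free resolution of \<open>S/I\<close>, for a homogeneous ideal \<open>I\<close>. The augmentation
  from \<open>F\<^sub>0\<close> to \<open>S/I\<close> sends the \<open>k\<close>-th basis element to the class of the homogeneous
  polynomial \<open>g k\<close> of degree \<open>shift F 0 k\<close>. The conditions say, in this order: the augmentation
  and the matrices are homogeneous of degree 0, the augmentation is surjective, and the augmented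
  sequence is exact at \<open>F\<^sub>0\<close> and at \<open>F\<^sub>i\<^sub>+\<^sub>1\<close> for all \<open>i\<close>.\<close>

definition graded_free_resolution ::
  "('w, 'k::field) mpoly graded_free_seq \<Rightarrow> ('w, 'k) mpoly set \<Rightarrow> bool" where
  "graded_free_resolution F I \<longleftrightarrow> (\<exists>g.
     (\<forall>k<rnk F 0. \<forall>m\<in>Poly_Mapping.keys (g k). mdeg m = shift F 0 k) \<and>
     (\<forall>i. \<forall>l<rnk F i. \<forall>k<rnk F (Suc i). \<forall>m\<in>Poly_Mapping.keys (diff F i l k).
        mdeg m + shift F i l = shift F (Suc i) k) \<and>
     (\<forall>p. \<exists>f\<in>free_mod (rnk F 0). p - (\<Sum>k<rnk F 0. f k * g k) \<in> I) \<and>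
     {f \<in> free_mod (rnk F 0). (\<Sum>k<rnk F 0. f k * g k) \<in> I} =
       mat_app (rnk F 0) (rnk F 1) (diff F 0) ` free_mod (rnk F 1) \<and>
     (\<forall>i. {f \<in> free_mod (rnk F (Suc i)). mat_app (rnk F i) (rnk F (Suc i)) (diff F i) f = 0} =
       mat_app (rnk F (Suc i)) (rnk F (Suc (Suc i))) (diff F (Suc i)) `
         free_mod (rnk F (Suc (Suc i)))))"

text \<open>The degree \<open>j\<close> part of the complex obtained by tensoring \<open>F\<close> over \<open>S\<close> with \<open>K\<close>, the
  quotient of \<open>S\<close> by the ideal of all variables: each \<open>S(-d)\<close> becomes a copy of \<open>K\<close> in degree \<open>d\<close>,
  and each matrix entry is replaced by its residue class, that is, by its constant coefficient.\<close>

definition strand :: "('w, 'k::field) mpoly graded_free_seq \<Rightarrow> nat \<Rightarrow> nat \<Rightarrow> (nat \<Rightarrow> 'k) set" where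
  "strand F i j = {f \<in> free_mod (rnk F i). \<forall>k<rnk F i. shift F i k \<noteq> j \<longrightarrow> f k = 0}"

definition strand_map ::
  "('w, 'k::field) mpoly graded_free_seq \<Rightarrow> nat \<Rightarrow> (nat \<Rightarrow> 'k) \<Rightarrow> nat \<Rightarrow> 'k" where
  "strand_map F i = mat_app (rnk F i) (rnk F (Suc i)) (\<lambda>l k. const_coeff (diff F i l k))"

definition tor_cycles :: "('w, 'k::field) mpoly graded_free_seq \<Rightarrow> nat \<Rightarrow> nat \<Rightarrow> (nat \<Rightarrow> 'k) set" where
  "tor_cycles F i j =
     (case i of 0 \<Rightarrow> strand F 0 j | Suc i' \<Rightarrow> {f \<in> strand F (Suc i') j. strand_map F i' f = 0})"

definition tor_boundaries ::
  "('w, 'k::field) mpoly graded_free_seq \<Rightarrow> nat \<Rightarrow> nat \<Rightarrow> (nat \<Rightarrow> 'k) set" where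
  "tor_boundaries F i j = strand_map F i ` strand F (Suc i) j"

lemma vector_space_fun: "vector_space (\<lambda>(c::'k::field) (f::nat \<Rightarrow> 'k) k. c * f k)"
  by standard (simp_all add: fun_eq_iff algebra_simps)

definition kdim :: "(nat \<Rightarrow> 'k::field) set \<Rightarrow> nat" where
  "kdim V = vector_space.dim (\<lambda>c f k. c * f k) V"

text \<open>\<open>tor_dim F i j\<close> is the dimension of the quotient of cycles by boundaries (both are
  finite-dimensional, and the boundaries are contained in the cycles). \<open>betti I i j\<close> is
  \<open>dim\<^sub>K Tor\<^sub>i(S/I, K)\<^sub>j\<close>, computed from an arbitrary graded free resolution of \<open>S/I\<close>.\<close>

definition tor_dim :: "('w, 'k::field) mpoly graded_free_seq \<Rightarrow> nat \<Rightarrow> nat \<Rightarrow> nat" where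
  "tor_dim F i j = kdim (tor_cycles F i j) - kdim (tor_boundaries F i j)"

definition betti :: "('w::finite, 'k::field) mpoly set \<Rightarrow> nat \<Rightarrow> nat \<Rightarrow> nat" where
  "betti I = tor_dim (SOME F. graded_free_resolution F I)"

text \<open>The Betti polynomial of \<open>S/I\<close>, as a polynomial in \<open>s\<close> whose coefficients are polynomials
  in \<open>t\<close>. The sum is finite by Hilbert's syzygy theorem.\<close>

definition betti_poly :: "('w::finite, 'k::field) mpoly set \<Rightarrow> int poly poly" where
  "betti_poly I = (\<Sum>(i, j) | betti I i j \<noteq> 0. monom (monom (int (betti I i j)) j) i)"

end

theory Submission
  imports Defs "HOL-Computational_Algebra.Primes"
begin

text \<open>A monomial of \<open>S\<close> modulo \<open>J\<^sub>H\<close> is determined by its multidegree and by its \<open>x\<close>-degrees on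
  the connected components of the subgraph induced by its support. Deleting a free vertex \<open>v\<close> of
  \<open>H\<close> does not disconnect an induced subgraph. Hence \<open>y\<^sub>v\<close> is a nonzerodivisor on \<open>S/J\<^sub>H\<close>, and over
  the polynomial ring in \<open>x\<^sub>v, y\<^sub>v\<close> and the variables outside \<open>H\<close>, the module \<open>S/J\<^sub>H\<close> is a direct
  sum of powers of the ideal \<open>(x\<^sub>v, y\<^sub>v)\<close>. Let \<open>F\<close> be a minimal resolution of \<open>S/J\<^bsub>G\<^sub>1\<^esub>\<close> with
  matrices over this subring, where \<open>H = G\<^sub>2\<close>. Since \<open>y\<^sub>v\<close> is regular on \<open>S/J\<^bsub>G\<^sub>1\<^esub>\<close>, the
  subcomplexes \<open>(x\<^sub>v, y\<^sub>v)\<^sup>c F\<close> are acyclic in positive degrees, so that the modules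
  \<open>Tor\<^sub>i(S/J\<^bsub>G\<^sub>1\<^esub>, S/J\<^bsub>G\<^sub>2\<^esub>)\<close> vanish for \<open>i > 0\<close>. The tensor product of minimal resolutions is
  therefore a minimal resolution of \<open>S/J\<^sub>G\<close>, and its ranks are the convolution of the given ranks.
  If one of the Betti polynomials had infinitely many terms, both sides of the claim would be the
  junk value \<open>0\<close>, so Hilbert's syzygy theorem plays no role.\<close>

abbreviation "lookup \<equiv> Poly_Mapping.lookup"
abbreviation "keys \<equiv> Poly_Mapping.keys"
abbreviation "single \<equiv> Poly_Mapping.single"

section \<open>Linear combinations of monomials\<close>

lemma lookup_single_mult_add:
  fixes p :: "('w, 'k::comm_ring_1) mpoly"
  shows "lookup (single n c * p) (n + m) = c * lookup p m"
proof -
  have "lookup (single n c * p) (n + m) =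
      (\<Sum>l. lookup (single n c) l * (\<Sum>q. lookup p q when n + m = l + q))"
    by (rule lookup_mult)
  also have "\<dots> = (\<Sum>l. (c * (\<Sum>q. lookup p q when n + m = n + q)) when n = l)"
    by (rule arg_cong[where f = Sum_any]) (auto simp: lookup_single when_def)
  also have "\<dots> = c * lookup p m"
    by simp
  finally show ?thesis .
qed

lemma single_one_mult_cancel:
  fixes p q :: "('w, 'k::comm_ring_1) mpoly"
  assumes "single n 1 * p = single n 1 * q"
  shows "p = q"
  by (rule poly_mapping_eqI) (metis assms lookup_single_mult_add mult_1)

lemma Var_mult_cancel: "Var w * p = Var w * q \<Longrightarrow> p = q"
  for p q :: "('w, 'k::comm_ring_1) mpoly"
  unfolding Var_def by (rule single_one_mult_cancel)

lemma Var_power: "Var w ^ n = single (single w n) 1"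
  by (induction n) (simp_all add: Var_def mult_single single_add[symmetric])

lemma sum_single_superset:
  fixes p :: "'a \<Rightarrow>\<^sub>0 'b::comm_monoid_add"
  assumes "finite A" "keys p \<subseteq> A"
  shows "(\<Sum>m\<in>A. single m (lookup p m)) = p"
proof (rule poly_mapping_eqI)
  fix k
  have "(\<Sum>m\<in>A. lookup (single m (lookup p m)) k) = (\<Sum>m\<in>A. if m = k then lookup p k else 0)"
    by (rule sum.cong) (auto simp: lookup_single)
  then show "lookup (\<Sum>m\<in>A. single m (lookup p m)) k = lookup p k"
    using assms by (auto simp: lookup_sum in_keys_iff)
qed

lemma sum_single_keys: "(\<Sum>m\<in>keys p. single m (lookup p m)) = p"
  by (simp add: sum_single_superset)

lemma poly_mapping_add_induct [case_names single add]:
  fixes p :: "'a \<Rightarrow>\<^sub>0 'b::comm_monoid_add"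
  assumes single: "\<And>m c. P (single m c)"
    and add: "\<And>p q. P p \<Longrightarrow> P q \<Longrightarrow> P (p + q)"
  shows "P p"
proof -
  have "P (\<Sum>m\<in>A. single m (lookup p m))" if "finite A" for A
    using that
  proof (induction A)
    case empty
    then show ?case using single[of undefined 0] by simp
  qed (use assms in auto)
  then show ?thesis by (metis sum_single_keys finite_keys)
qed

definition pushforward ::
  "('a \<Rightarrow> bool) \<Rightarrow> ('a \<Rightarrow> 'b) \<Rightarrow> ('a \<Rightarrow>\<^sub>0 'k::comm_ring_1) \<Rightarrow> 'b \<Rightarrow>\<^sub>0 'k" where
  "pushforward Q \<tau> p = (\<Sum>m | m \<in> keys p \<and> Q m. single (\<tau> m) (lookup p m))"

lemma pushforward_superset:
  assumes "finite A" "keys p \<subseteq> A"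
  shows "pushforward Q \<tau> p = (\<Sum>m\<in>A. single (\<tau> m) (lookup p m) when Q m)"
  unfolding pushforward_def
  by (rule sum.mono_neutral_cong_left) (use assms in \<open>auto simp: in_keys_iff when_def\<close>)

interpretation pushforward: additive "pushforward Q \<tau>" for Q \<tau>
proof
  fix p q :: "'a \<Rightarrow>\<^sub>0 'c"
  let ?A = "keys p \<union> keys q"
  have "pushforward Q \<tau> (p + q) = (\<Sum>m\<in>?A. single (\<tau> m) (lookup (p + q) m) when Q m)"
    by (rule pushforward_superset) (simp_all add: keys_add)
  also have "\<dots> = (\<Sum>m\<in>?A. single (\<tau> m) (lookup p m) when Q m) +
      (\<Sum>m\<in>?A. single (\<tau> m) (lookup q m) when Q m)"
    by (simp add: lookup_add single_add when_add_distrib sum.distrib)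
  also have "\<dots> = pushforward Q \<tau> p + pushforward Q \<tau> q"
    by (simp add: pushforward_superset[of ?A])
  finally show "pushforward Q \<tau> (p + q) = pushforward Q \<tau> p + pushforward Q \<tau> q" .
qed

lemma pushforward_single: "pushforward Q \<tau> (single m c) = (single (\<tau> m) c when Q m)"
  by (subst pushforward_superset[of "{m}"]) auto

lemma lookup_pushforward:
  "lookup (pushforward Q \<tau> p) n = (\<Sum>m | m \<in> keys p \<and> Q m \<and> \<tau> m = n. lookup p m)"
proof -
  have "lookup (pushforward Q \<tau> p) n =
      (\<Sum>m | m \<in> keys p \<and> Q m. lookup p m when \<tau> m = n)"
    by (simp add: pushforward_def lookup_sum lookup_single)
  also have "\<dots> = (\<Sum>m | m \<in> keys p \<and> Q m \<and> \<tau> m = n. lookup p m)"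
    by (rule sum.mono_neutral_cong_right) (auto simp: when_def)
  finally show ?thesis .
qed

lemma keys_pushforward: "keys (pushforward Q \<tau> p) \<subseteq> \<tau> ` {m \<in> keys p. Q m}"
proof
  fix n assume "n \<in> keys (pushforward Q \<tau> p)"
  then have "(\<Sum>m | m \<in> keys p \<and> Q m \<and> \<tau> m = n. lookup p m) \<noteq> 0"
    by (simp add: in_keys_iff lookup_pushforward)
  then have "{m. m \<in> keys p \<and> Q m \<and> \<tau> m = n} \<noteq> {}"
    by (metis sum.empty)
  then show "n \<in> \<tau> ` {m \<in> keys p. Q m}" by blast
qed

lemma pushforward_id:
  assumes "\<And>m. m \<in> keys p \<Longrightarrow> Q m"
  shows "pushforward Q (\<lambda>m. m) p = p"
proof -
  have "{m. m \<in> keys p \<and> Q m} = keys p" using assms by blast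
  then show ?thesis by (simp add: pushforward_def sum_single_keys)
qed

lemma pushforward_mult:
  fixes a p :: "('w, 'k::comm_ring_1) mpoly"
  assumes "\<And>n m. n \<in> keys a \<Longrightarrow> Q (n + m) \<longleftrightarrow> Q' m"
    and "\<And>n m. n \<in> keys a \<Longrightarrow> Q' m \<Longrightarrow> \<tau> (n + m) = n + \<tau>' m"
  shows "pushforward Q \<tau> (a * p) = a * pushforward Q' \<tau>' p"
proof (induction p rule: poly_mapping_add_induct)
  case (single m c)
  have a: "a * q = (\<Sum>n\<in>keys a. single n (lookup a n) * q)" for q
    by (simp add: sum_single_keys flip: sum_distrib_right)
  have "pushforward Q \<tau> (single n b * single m c) = single n b * pushforward Q' \<tau>' (single m c)"
    if "n \<in> keys a" for n b
    using assms(1,2)[OF that, of m] by (cases "Q' m") (simp_all add: mult_single pushforward_single)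
  then show ?case
    unfolding a pushforward.sum by simp
qed (simp add: pushforward.add distrib_left)

lemma eq_sum_pushforward:
  fixes p :: "('w, 'k::comm_ring_1) mpoly"
  assumes "finite E" "\<And>m. m \<in> keys p \<Longrightarrow> lab m \<in> E"
    and "\<And>m. m \<in> keys p \<Longrightarrow> \<sigma> (lab m) + \<tau> m = m"
  shows "p = (\<Sum>x\<in>E. single (\<sigma> x) 1 * pushforward (\<lambda>m. lab m = x) \<tau> p)"
proof -
  have "(\<Sum>x\<in>E. single (\<sigma> x) 1 * pushforward (\<lambda>m. lab m = x) \<tau> p) =
      (\<Sum>x\<in>E. \<Sum>m\<in>keys p. (single (\<sigma> x + \<tau> m) (lookup p m) when lab m = x))"
    by (simp add: pushforward_superset[OF finite_keys order_refl] sum_distrib_left mult_when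
        mult_single)
  also have "\<dots> = (\<Sum>m\<in>keys p. \<Sum>x\<in>E. (single (\<sigma> x + \<tau> m) (lookup p m) when lab m = x))"
    by (rule sum.swap)
  also have "\<dots> = (\<Sum>m\<in>keys p. single m (lookup p m))"
    using assms by (intro sum.cong refl) (simp add: when_def)
  finally show ?thesis by (simp add: sum_single_keys)
qed

section \<open>Monomials and homogeneous polynomials\<close>

lemma keys_add_monomial: "keys (m + n) = keys m \<union> keys n" for m n :: "'w \<Rightarrow>\<^sub>0 nat"
  by (auto simp: in_keys_iff lookup_add)

lemma monomial_add_eq_0_iff: "m + n = 0 \<longleftrightarrow> m = 0 \<and> n = 0" for m n :: "'w \<Rightarrow>\<^sub>0 nat"
  by (auto simp: poly_mapping_eq_iff fun_eq_iff lookup_add)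

lemma mdeg_superset: "finite A \<Longrightarrow> keys m \<subseteq> A \<Longrightarrow> mdeg m = (\<Sum>w\<in>A. lookup m w)"
  unfolding mdeg_def by (rule sum.mono_neutral_left) (auto simp: in_keys_iff)

lemma mdeg_add: "mdeg (m + n) = mdeg m + mdeg n"
  by (simp add: mdeg_superset[of "keys m \<union> keys n"] keys_add_monomial lookup_add sum.distrib)

lemma mdeg_eq_0_iff: "mdeg m = 0 \<longleftrightarrow> m = 0"
  by (auto simp: mdeg_def in_keys_iff poly_mapping_eqI)

lemma mdeg_single [simp]: "mdeg (single w n) = n"
  by (simp add: mdeg_def)

text \<open>A polynomial is \<open>homog s e\<close> if multiplication by it is a map \<open>S(-e) \<rightarrow> S(-s)\<close> of degree zero,
  that is, if it is homogeneous of degree \<open>e - s\<close>; for \<open>e < s\<close> it must be zero.\<close>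

definition homog :: "nat \<Rightarrow> nat \<Rightarrow> ('w, 'k::zero) mpoly \<Rightarrow> bool" where
  "homog s e p \<longleftrightarrow> (\<forall>m\<in>keys p. mdeg m + s = e)"

definition hpart :: "nat \<Rightarrow> nat \<Rightarrow> ('w, 'k::comm_ring_1) mpoly \<Rightarrow> ('w, 'k) mpoly" where
  "hpart s e = pushforward (\<lambda>m. mdeg m + s = e) (\<lambda>m. m)"

interpretation hpart: additive "hpart s e" for s e
  by standard (simp add: hpart_def pushforward.add)

lemma homog_zero [simp]: "homog s e 0"
  by (simp add: homog_def)

lemma homog_add: "homog s e p \<Longrightarrow> homog s e q \<Longrightarrow> homog s e (p + q)"
  using keys_add[of p q] unfolding homog_def by blast

lemma homog_sum: "(\<And>x. x \<in> A \<Longrightarrow> homog s e (f x)) \<Longrightarrow> homog s e (sum f A)"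
  by (induction A rule: infinite_finite_induct) (simp_all add: homog_add)

lemma homog_mult: "homog s t a \<Longrightarrow> homog t e p \<Longrightarrow> homog s e (a * p)"
  using keys_mult[of a p] unfolding homog_def by (fastforce simp: mdeg_add)

lemma homog_one [simp]: "homog s s (1 :: ('w, 'k::comm_ring_1) mpoly)"
  by (simp add: homog_def mdeg_eq_0_iff)

lemma homog_hpart: "homog s e (hpart s e p)"
  using keys_pushforward by (fastforce simp: homog_def hpart_def)

lemma hpart_homog: "homog s e p \<Longrightarrow> hpart s e p = p"
  unfolding homog_def hpart_def by (rule pushforward_id) blast

lemma homog_diff: "homog s e p \<Longrightarrow> homog s e q \<Longrightarrow> homog s e (p - q)"
  for p q :: "('w, 'k::comm_ring_1) mpoly"
  using homog_hpart[of s e "p - q"] by (simp add: hpart.diff hpart_homog)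

lemma homog_minus_one_power_mult: "homog s e p \<Longrightarrow> homog s e ((-1) ^ n * p)"
  for p :: "('w, 'k::comm_ring_1) mpoly"
  using homog_diff[OF homog_zero] by (cases "even n") auto

lemma homog_add_shift: "homog s e p \<Longrightarrow> homog (s + c) (e + c) p"
  by (simp add: homog_def)

lemma hpart_mult: "homog s t a \<Longrightarrow> hpart s e (a * p) = a * hpart t e p"
  unfolding homog_def hpart_def by (rule pushforward_mult) (auto simp: mdeg_add algebra_simps)

interpretation const_coeff: additive "const_coeff :: ('w, 'k::comm_ring_1) mpoly \<Rightarrow> 'k"
  by standard (simp add: const_coeff_def lookup_add)

lemma const_coeff_one [simp]: "const_coeff (1 :: ('w, 'k::comm_ring_1) mpoly) = 1"
  by (simp add: const_coeff_def)

lemma const_coeff_mult: "const_coeff (p * q) = const_coeff p * const_coeff q"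
  for p q :: "('w, 'k::comm_ring_1) mpoly"
proof (induction p rule: poly_mapping_add_induct)
  case (single m c)
  show ?case
  proof (induction q rule: poly_mapping_add_induct)
    case (single n d)
    then show ?case
      using monomial_add_eq_0_iff[of m n]
      by (auto simp: const_coeff_def mult_single lookup_single when_def)
  qed (simp add: algebra_simps const_coeff.add)
qed (simp add: algebra_simps const_coeff.add)

lemma const_coeff_homog: "homog s e p \<Longrightarrow> s \<noteq> e \<Longrightarrow> const_coeff p = 0"
  by (force simp: homog_def const_coeff_def in_keys_iff mdeg_def)

lemma homog_self_eq_single:
  fixes p :: "('w, 'k::comm_monoid_add) mpoly"
  assumes "homog s s p"
  shows "p = single 0 (const_coeff p)"
proof -
  have "keys p \<subseteq> {0}" using assms by (auto simp: homog_def mdeg_eq_0_iff)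
  then show ?thesis using sum_single_superset[of "{0}" p] by (simp add: const_coeff_def)
qed

definition polys_in :: "'w set \<Rightarrow> ('w, 'k::zero) mpoly set" where
  "polys_in W = {p. \<forall>m\<in>keys p. keys m \<subseteq> W}"

definition retract :: "'w set \<Rightarrow> ('w, 'k::comm_ring_1) mpoly \<Rightarrow> ('w, 'k) mpoly" where
  "retract W = pushforward (\<lambda>m. keys m \<subseteq> W) (\<lambda>m. m)"

interpretation retract: additive "retract W" for W
  by standard (simp add: retract_def pushforward.add)

lemma retract_in_polys_in: "retract W p \<in> polys_in W"
  using keys_pushforward by (fastforce simp: retract_def polys_in_def)

lemma retract_id: "p \<in> polys_in W \<Longrightarrow> retract W p = p"
  unfolding retract_def polys_in_def by (rule pushforward_id) blast

lemma retract_mult: "a \<in> polys_in W \<Longrightarrow> retract W (a * p) = a * retract W p"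
  unfolding retract_def polys_in_def by (rule pushforward_mult) (auto simp: keys_add_monomial)

lemma polys_in_diff: "p \<in> polys_in W \<Longrightarrow> q \<in> polys_in W \<Longrightarrow> p - q \<in> polys_in W"
  for p q :: "('w, 'k::comm_ring_1) mpoly"
  using retract_in_polys_in[of W "p - q"] by (simp add: retract.diff retract_id)

lemma polys_in_mult: "p \<in> polys_in W \<Longrightarrow> q \<in> polys_in W \<Longrightarrow> p * q \<in> polys_in W"
  for p q :: "('w, 'k::comm_ring_1) mpoly"
  using retract_in_polys_in[of W "p * q"] by (simp add: retract_mult retract_id)

lemma Var_in_polys_in: "w \<in> W \<Longrightarrow> Var w \<in> polys_in W"
  by (simp add: Var_def polys_in_def)

lemma Var_power_in_polys_in: "w \<in> W \<Longrightarrow> Var w ^ n \<in> polys_in W"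
  by (simp add: Var_power polys_in_def)

definition restr :: "'w set \<Rightarrow> ('w \<Rightarrow>\<^sub>0 nat) \<Rightarrow> 'w \<Rightarrow>\<^sub>0 nat" where
  "restr W m = Abs_poly_mapping (\<lambda>w. lookup m w when w \<in> W)"

lemma lookup_restr: "lookup (restr W m) w = (lookup m w when w \<in> W)"
proof -
  have "finite {w. (lookup m w when w \<in> W) \<noteq> 0}"
    by (rule finite_subset[OF _ finite_lookup[of m]]) (auto simp: when_def)
  then show ?thesis by (simp add: restr_def)
qed

lemma restr_add: "restr W (m + n) = restr W m + restr W n"
  by (rule poly_mapping_eqI) (simp add: lookup_restr lookup_add when_def)

lemma restr_id: "keys m \<subseteq> W \<Longrightarrow> restr W m = m"
  by (rule poly_mapping_eqI) (auto simp: lookup_restr in_keys_iff when_def)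

lemma restr_Compl_id: "keys m \<subseteq> W \<Longrightarrow> restr (- W) m = 0"
  by (rule poly_mapping_eqI) (auto simp: lookup_restr in_keys_iff when_def)

lemma restr_Compl_add_restr: "restr (- W) m + restr W m = m"
  by (rule poly_mapping_eqI) (simp add: lookup_restr lookup_add when_def)

lemma keys_restr: "keys (restr W m) \<subseteq> W"
  by (auto simp: in_keys_iff lookup_restr when_def split: if_splits)

section \<open>Vectors and matrices\<close>

text \<open>Vectors and matrices are arbitrary functions; sums run over explicit finite index sets.\<close>

definition fscale :: "'a::comm_ring_1 \<Rightarrow> ('b \<Rightarrow> 'a) \<Rightarrow> 'b \<Rightarrow> 'a" where
  "fscale a f = (\<lambda>k. a * f k)"

interpretation fmod: module fscale
  by standard (simp_all add: fscale_def fun_eq_iff algebra_simps)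

lemma fscale_apply: "fscale a f k = a * f k"
  by (simp add: fscale_def)

definition mat_vec :: "'b set \<Rightarrow> ('a \<Rightarrow> 'b \<Rightarrow> 'r::comm_ring_1) \<Rightarrow> ('b \<Rightarrow> 'r) \<Rightarrow> 'a \<Rightarrow> 'r" where
  "mat_vec X A u l = (\<Sum>k\<in>X. A l k * u k)"

definition mat_mult ::
  "'b set \<Rightarrow> ('a \<Rightarrow> 'b \<Rightarrow> 'r::comm_ring_1) \<Rightarrow> ('b \<Rightarrow> 'c \<Rightarrow> 'r) \<Rightarrow> 'a \<Rightarrow> 'c \<Rightarrow> 'r" where
  "mat_mult X A C l k = mat_vec X A (\<lambda>j. C j k) l"

interpretation mat_vec: module_hom fscale fscale "mat_vec X A" for X A
  by standard (simp_all add: fun_eq_iff fscale_apply mat_vec_def distrib_left sum.distrib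
      sum_distrib_left mult_ac)

lemma sum_fun_apply: "(\<Sum>x\<in>X. f x) l = (\<Sum>x\<in>X. f x l)" for f :: "'a \<Rightarrow> 'b \<Rightarrow> 'c::comm_monoid_add"
  by (induction X rule: infinite_finite_induct) auto

lemma mat_vec_eq_sum_fscale: "mat_vec X A u = (\<Sum>k\<in>X. fscale (u k) (\<lambda>l. A l k))"
  by (simp add: fun_eq_iff fscale_apply mat_vec_def sum_fun_apply mult.commute)

lemma mat_vec_cong:
  "(\<And>k. k \<in> X \<Longrightarrow> A l k = A' l' k) \<Longrightarrow> (\<And>k. k \<in> X \<Longrightarrow> u k = u' k) \<Longrightarrow> mat_vec X A u l = mat_vec X A' u' l'"
  by (simp add: mat_vec_def)

lemma mat_vec_mult: "mat_vec X A (\<lambda>k. c * u k) l = c * mat_vec X A u l"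
  using mat_vec.scale[of X A c u] by (simp add: fscale_def fun_eq_iff)

lemma mat_vec_swap:
  "mat_vec X A (\<lambda>k. mat_vec Y C (u k) l) j = mat_vec Y C (\<lambda>m. mat_vec X A (\<lambda>k. u k m) j) l"
  unfolding mat_vec_def sum_distrib_left by (subst sum.swap) (simp add: mult.left_commute)

lemma mat_vec_mat_vec: "mat_vec X A (mat_vec Y C u) l = mat_vec Y (mat_mult X A C) u l"
  unfolding mat_vec_def mat_mult_def sum_distrib_left sum_distrib_right
  by (subst sum.swap) (simp add: mult.assoc)

lemma mat_mult_assoc: "mat_mult Y (mat_mult X A C) E l k = mat_mult X A (mat_mult Y C E) l k"
  using mat_vec_mat_vec[of X A Y C "\<lambda>j. E j k" l] by (simp add: mat_mult_def[abs_def])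

lemma mat_mult_add_left:
  "mat_mult X (\<lambda>l j. A l j + C l j) E l k = mat_mult X A E l k + mat_mult X C E l k"
  unfolding mat_mult_def mat_vec_def by (simp only: distrib_right sum.distrib)

lemma mat_mult_cong:
  "(\<And>j. j \<in> X \<Longrightarrow> A l j = A' l' j) \<Longrightarrow> (\<And>j. j \<in> X \<Longrightarrow> C j k = C' j k') \<Longrightarrow>
    mat_mult X A C l k = mat_mult X A' C' l' k'"
  unfolding mat_mult_def by (rule mat_vec_cong)

definition unit_vec :: "'b \<Rightarrow> 'b \<Rightarrow> 'r::zero_neq_one" where
  "unit_vec k j = (if j = k then 1 else 0)"

lemma mat_vec_unit_vec: "finite X \<Longrightarrow> k \<in> X \<Longrightarrow> mat_vec X A (unit_vec k) l = A l k"
  by (simp add: mat_vec_def unit_vec_def if_distrib cong: if_cong)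

lemma mat_vec_unit_vec_left: "finite X \<Longrightarrow> l \<in> X \<Longrightarrow> mat_vec X (\<lambda>l k. unit_vec k l) u l = u l"
  by (simp add: mat_vec_def unit_vec_def if_distrib[where f = "\<lambda>x. x * _"] cong: if_cong)

lemma range_mat_vec:
  assumes "finite X"
  shows "range (mat_vec X A) = fmod.span ((\<lambda>k l. A l k) ` X)"
proof
  show "range (mat_vec X A) \<subseteq> fmod.span ((\<lambda>k l. A l k) ` X)"
    unfolding mat_vec_eq_sum_fscale
    by (intro image_subsetI fmod.span_sum fmod.span_scale) (intro fmod.span_base imageI)
  have "(\<lambda>l. A l k) \<in> range (mat_vec X A)" if "k \<in> X" for k
    using that assms by (intro range_eqI[of _ _ "unit_vec k"]) (simp add: fun_eq_iff mat_vec_unit_vec)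
  then show "fmod.span ((\<lambda>k l. A l k) ` X) \<subseteq> range (mat_vec X A)"
    by (intro fmod.span_minimal mat_vec.subspace_image fmod.subspace_UNIV) auto
qed

lemma finite_subset_of_span:
  assumes "finite A" "A \<subseteq> fmod.span G"
  obtains T where "T \<subseteq> G" "finite T" "A \<subseteq> fmod.span T"
proof -
  have "\<exists>t\<subseteq>G. finite t \<and> a \<in> fmod.span t" if a: "a \<in> A" for a
  proof -
    obtain t u where "finite t" "t \<subseteq> G" "a = (\<Sum>x\<in>t. fscale (u x) x)"
      using assms(2) a unfolding fmod.span_explicit by blast
    then show ?thesis by (auto simp: fmod.span_finite)
  qed
  then obtain t where t: "\<And>a. a \<in> A \<Longrightarrow> t a \<subseteq> G \<and> finite (t a) \<and> a \<in> fmod.span (t a)"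
    by metis
  show thesis
  proof
    show "(\<Union>a\<in>A. t a) \<subseteq> G" "finite (\<Union>a\<in>A. t a)" using t assms(1) by auto
    show "A \<subseteq> fmod.span (\<Union>a\<in>A. t a)"
    proof
      fix a assume "a \<in> A"
      then show "a \<in> fmod.span (\<Union>a\<in>A. t a)"
        using t subsetD[OF fmod.span_mono[of "t a"]] by (meson UN_upper)
    qed
  qed
qed

definition homog_mat ::
  "'a set \<Rightarrow> ('a \<Rightarrow> nat) \<Rightarrow> 'b set \<Rightarrow> ('b \<Rightarrow> nat) \<Rightarrow> ('a \<Rightarrow> 'b \<Rightarrow> ('w, 'k::zero) mpoly) \<Rightarrow> bool" where
  "homog_mat X s Y t A \<longleftrightarrow> (\<forall>l\<in>X. \<forall>k\<in>Y. homog (s l) (t k) (A l k))"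

lemma homog_matD: "homog_mat X s Y t A \<Longrightarrow> l \<in> X \<Longrightarrow> k \<in> Y \<Longrightarrow> homog (s l) (t k) (A l k)"
  by (simp add: homog_mat_def)

lemma homog_mat_mult:
  "homog_mat X s Y t A \<Longrightarrow> homog_mat Y t Z e C \<Longrightarrow> homog_mat X s Z e (mat_mult Y A C)"
  unfolding homog_mat_def mat_mult_def mat_vec_def by (auto intro!: homog_sum homog_mult)

lemma hpart_mat_vec:
  assumes "\<And>k. k \<in> Y \<Longrightarrow> homog s (t k) (A l k)"
  shows "hpart s e (mat_vec Y A u l) = mat_vec Y A (\<lambda>k. hpart (t k) e (u k)) l"
  unfolding mat_vec_def hpart.sum using assms by (intro sum.cong) (auto simp: hpart_mult)

definition residue :: "('a \<Rightarrow> 'b \<Rightarrow> ('w, 'k::comm_ring_1) mpoly) \<Rightarrow> 'a \<Rightarrow> 'b \<Rightarrow> 'k" where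
  "residue A l k = const_coeff (A l k)"

lemma residue_mat_mult: "residue (mat_mult X A C) = mat_mult X (residue A) (residue C)"
  by (simp add: fun_eq_iff residue_def mat_mult_def mat_vec_def const_coeff.sum const_coeff_mult)

lemma residue_homog_mat:
  "homog_mat X s Y t A \<Longrightarrow> l \<in> X \<Longrightarrow> k \<in> Y \<Longrightarrow> s l \<noteq> t k \<Longrightarrow> residue A l k = 0"
  using const_coeff_homog by (fastforce simp: homog_mat_def residue_def)

section \<open>Homogeneous ideals\<close>

lemmas ideal_gen_base = module.span_base[OF module_times, folded ideal_gen_def]
lemmas ideal_gen_zero = module.span_zero[OF module_times, folded ideal_gen_def]
lemmas ideal_gen_add = module.span_add[OF module_times, folded ideal_gen_def]
lemmas ideal_gen_diff = module.span_diff[OF module_times, folded ideal_gen_def]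
lemmas ideal_gen_mult = module.span_scale[OF module_times, folded ideal_gen_def]
lemmas ideal_gen_sum = module.span_sum[OF module_times, folded ideal_gen_def]
lemmas ideal_gen_Un = module.span_Un[OF module_times, folded ideal_gen_def]
lemmas ideal_gen_induct [consumes 1, case_names base step] =
  module.span_induct_alt[OF module_times, folded ideal_gen_def]

definition homog_ideal :: "('w, 'k::comm_ring_1) mpoly set \<Rightarrow> bool" where
  "homog_ideal I \<longleftrightarrow> module.subspace (*) I \<and> (\<forall>p\<in>I. \<forall>e. hpart 0 e p \<in> I)"

lemma homog_ideal_ideal_gen:
  fixes Gs :: "('w, 'k::comm_ring_1) mpoly set"
  assumes "\<And>p. p \<in> Gs \<Longrightarrow> \<exists>e. homog 0 e p"
  shows "homog_ideal (ideal_gen Gs)"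
proof -
  have "hpart 0 e p \<in> ideal_gen Gs" if "p \<in> ideal_gen Gs" for p e
    using that
  proof (induction rule: ideal_gen_induct)
    case base
    then show ?case by (simp add: hpart.zero ideal_gen_zero)
  next
    case (step c x y)
    obtain d where "homog 0 d x" using assms step(1) by blast
    then have "hpart 0 e (c * x + y) = hpart d e c * x + hpart 0 e y"
      using hpart_mult[of 0 d x e c] by (simp add: hpart.add mult.commute)
    then show ?case using step by (simp add: ideal_gen_add ideal_gen_mult ideal_gen_base)
  qed
  then show ?thesis
    unfolding homog_ideal_def ideal_gen_def using module.subspace_span[OF module_times] by blast
qed

lemma homog_ideal_sums:
  assumes "homog_ideal I" "homog_ideal J"
  shows "homog_ideal {a + b |a b. a \<in> I \<and> b \<in> J}"
proof -
  have "ideal_gen I = I" "ideal_gen J = J"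
    using assms module.span_eq_iff[OF module_times] by (auto simp: homog_ideal_def ideal_gen_def)
  then have eq: "{a + b |a b. a \<in> I \<and> b \<in> J} = ideal_gen (I \<union> J)"
    by (simp add: ideal_gen_Un)
  have "module.subspace (*) {a + b |a b. a \<in> I \<and> b \<in> J}"
    unfolding eq ideal_gen_def using module.subspace_span[OF module_times] by blast
  moreover have "hpart 0 e (a + b) \<in> {a + b |a b. a \<in> I \<and> b \<in> J}" if "a \<in> I" "b \<in> J" for a b e
  proof -
    have "hpart 0 e a \<in> I" "hpart 0 e b \<in> J" using assms that by (simp_all add: homog_ideal_def)
    then show ?thesis unfolding hpart.add by blast
  qed
  ultimately show ?thesis
    unfolding homog_ideal_def by blast
qed

section \<open>Submodules of free modules of finite rank are finitely generated\<close>

lemma exists_mono_subseq: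
  fixes s :: "nat \<Rightarrow> nat"
  shows "\<exists>\<phi>::nat \<Rightarrow> nat. strict_mono \<phi> \<and> mono (s \<circ> \<phi>)"
proof -
  have "\<exists>x>y. \<forall>n\<ge>x. s x \<le> s n" for y
  proof -
    define x where "x = arg_min s (\<lambda>n. n > y)"
    have "x > y" "\<forall>n>y. s x \<le> s n"
      using arg_min_nat_lemma[of "\<lambda>n. n > y" "Suc y" s] by (auto simp: x_def)
    then show ?thesis by (metis less_le_trans)
  qed
  then have "\<exists>\<phi>. \<forall>n. (\<forall>k\<ge>\<phi> n. s (\<phi> n) \<le> s k) \<and> \<phi> n < \<phi> (Suc n)"
    by (intro dependent_nat_choice) blast+
  then obtain \<phi> where \<phi>: "\<And>n. \<forall>k\<ge>\<phi> n. s (\<phi> n) \<le> s k" "\<And>n. \<phi> n < \<phi> (Suc n)"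
    by blast
  have "strict_mono \<phi>"
    using \<phi>(2) by (simp add: strict_mono_Suc_iff)
  moreover from this have "mono (s \<circ> \<phi>)"
    using \<phi>(1) by (auto simp: mono_def strict_mono_less_eq)
  ultimately show ?thesis by blast
qed

lemma exists_pointwise_mono_subseq:
  fixes s :: "nat \<Rightarrow> 'a \<Rightarrow> nat"
  assumes "finite A"
  shows "\<exists>\<phi>::nat \<Rightarrow> nat. strict_mono \<phi> \<and> (\<forall>a\<in>A. mono (\<lambda>n. s (\<phi> n) a))"
  using assms
proof (induction A)
  case empty
  show ?case by (auto intro!: exI[of _ id] simp: strict_mono_def)
next
  case (insert x A)
  then obtain \<phi> :: "nat \<Rightarrow> nat" where \<phi>: "strict_mono \<phi>" "\<forall>a\<in>A. mono (\<lambda>n. s (\<phi> n) a)" by blast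
  obtain \<psi> :: "nat \<Rightarrow> nat" where \<psi>: "strict_mono \<psi>" "mono ((\<lambda>n. s (\<phi> n) x) \<circ> \<psi>)"
    using exists_mono_subseq by blast
  have "strict_mono (\<phi> \<circ> \<psi>)"
    using \<phi>(1) \<psi>(1) by (simp add: strict_mono_o)
  moreover have "mono (\<lambda>n. s ((\<phi> \<circ> \<psi>) n) a)" if "a \<in> insert x A" for a
    using that \<phi>(2) \<psi> by (auto simp: mono_def strict_mono_less_eq)
  ultimately show ?case by blast
qed

lemma finite_monomial_antichain:
  fixes A :: "('w::finite \<Rightarrow>\<^sub>0 nat) set"
  assumes "\<And>a q. a \<in> A \<Longrightarrow> a + q \<in> A \<Longrightarrow> q = 0"
  shows "finite A"
proof (rule ccontr)
  assume "infinite A"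
  then obtain f :: "nat \<Rightarrow> 'w \<Rightarrow>\<^sub>0 nat" where f: "inj f" "range f \<subseteq> A"
    using infinite_countable_subset by blast
  obtain \<phi> :: "nat \<Rightarrow> nat" where \<phi>: "strict_mono \<phi>" "\<And>w. mono (\<lambda>n. lookup (f (\<phi> n)) w)"
    using exists_pointwise_mono_subseq[of UNIV "\<lambda>n. lookup (f n)"] by auto
  define q where "q = f (\<phi> 1) - f (\<phi> 0)"
  have "f (\<phi> 1) = f (\<phi> 0) + q"
    using monoD[OF \<phi>(2), of 0 1] by (intro poly_mapping_eqI) (simp add: q_def lookup_add lookup_minus)
  moreover from this have "q = 0" using assms f(2) by (metis rangeI subsetD)
  ultimately have "\<phi> 1 = \<phi> 0" using f(1) by (simp add: inj_eq)
  then show False using strict_monoD[OF \<phi>(1), of 0 1] by simp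
qed

lemma dickson:
  fixes L :: "('w::finite \<Rightarrow>\<^sub>0 nat) set"
  shows "\<exists>A\<subseteq>L. finite A \<and> (\<forall>m\<in>L. \<exists>a\<in>A. \<exists>q. m = a + q)"
proof (intro exI conjI ballI)
  let ?A = "{a \<in> L. \<forall>b\<in>L. \<forall>q. a = b + q \<longrightarrow> q = 0}"
  show "?A \<subseteq> L" by blast
  show "finite ?A" by (rule finite_monomial_antichain) blast
  show "\<exists>a\<in>?A. \<exists>q. m = a + q" if "m \<in> L" for m
    using that
  proof (induction "mdeg m" arbitrary: m rule: less_induct)
    case less
    show ?case
    proof (cases "m \<in> ?A")
      case True
      then show ?thesis by (intro bexI[of _ m] exI[of _ 0]) simp_all
    next
      case False
      then obtain b q where b: "b \<in> L" "m = b + q" "q \<noteq> 0" using less.prems by blast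
      then have "mdeg b < mdeg m" using mdeg_eq_0_iff[of q] by (simp add: mdeg_add)
      then obtain a q' where a: "a \<in> ?A" "b = a + q'" using less.hyps b(1) by blast
      then have "m = a + (q' + q)" using b(2) by (simp add: add.assoc)
      then show ?thesis using a(1) by blast
    qed
  qed
qed

text \<open>A multiplicative well-order on monomials, as an embedding into the natural numbers: send
  the variables to distinct primes.\<close>

lemma exists_multiplicative_embedding:
  "\<exists>\<omega> :: ('w::finite \<Rightarrow>\<^sub>0 nat) \<Rightarrow> nat. inj \<omega> \<and> (\<forall>m. \<omega> m > 0) \<and> (\<forall>m n. \<omega> (m + n) = \<omega> m * \<omega> n)"
proof -
  obtain g :: "nat \<Rightarrow> nat" where g: "inj g" "range g \<subseteq> {p. prime p}"
    using infinite_countable_subset[OF primes_infinite] by blast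
  obtain e :: "'w \<Rightarrow> nat" where "inj e"
    using finite_imp_inj_to_nat_seg[of "UNIV :: 'w set"] by auto
  define pr where "pr = g \<circ> e"
  have pr: "inj pr" "prime (pr w)" for w
    using g \<open>inj e\<close> by (auto simp: pr_def inj_compose)
  define \<omega> where "\<omega> m = (\<Prod>w\<in>UNIV. pr w ^ lookup m w)" for m :: "'w \<Rightarrow>\<^sub>0 nat"
  have \<omega>_eq: "\<omega> m = (\<Prod>p\<in>range pr. p ^ lookup m (inv pr p))" for m
    unfolding \<omega>_def by (subst prod.reindex) (use pr(1) in auto)
  have "multiplicity (pr w) (\<omega> m) = lookup m w" for m w
    unfolding \<omega>_eq by (subst multiplicity_prod_prime_powers) (use pr in auto)
  then have "inj \<omega>"
    by (metis injI poly_mapping_eqI)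
  moreover have "\<omega> m > 0" for m
    unfolding \<omega>_def using pr(2) by (intro prod_pos ballI zero_less_power prime_gt_0_nat)
  moreover have "\<omega> (m + n) = \<omega> m * \<omega> n" for m n
    by (simp add: \<omega>_def lookup_add power_add prod.distrib)
  ultimately show ?thesis by blast
qed

locale term_order =
  fixes r :: nat and \<rho> :: "nat \<Rightarrow> ('w::finite \<Rightarrow>\<^sub>0 nat) \<Rightarrow> nat"
  assumes weight_inj: "\<rho> l m = \<rho> l' m' \<Longrightarrow> l < r \<Longrightarrow> l' < r \<Longrightarrow> l = l' \<and> m = m'"
    and weight_add_mono: "\<rho> l m < \<rho> l' m' \<Longrightarrow> l < r \<Longrightarrow> l' < r \<Longrightarrow> \<rho> l (m + q) < \<rho> l' (m' + q)"

lemma exists_term_order: "\<exists>\<rho> :: nat \<Rightarrow> ('w::finite \<Rightarrow>\<^sub>0 nat) \<Rightarrow> nat. term_order r \<rho>"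
proof -
  obtain \<omega> :: "('w \<Rightarrow>\<^sub>0 nat) \<Rightarrow> nat"
    where \<omega>: "inj \<omega>" "\<And>m. \<omega> m > 0" "\<And>m n. \<omega> (m + n) = \<omega> m * \<omega> n"
    using exists_multiplicative_embedding by blast
  define \<rho> where "\<rho> l m = \<omega> m * r + l" for l m
  have div: "\<rho> l m div r = \<omega> m" if "l < r" for l m
    using that by (simp add: \<rho>_def)
  have "term_order r \<rho>"
  proof
    fix l m l' m' assume eq: "\<rho> l m = \<rho> l' m'" and l: "l < r" "l' < r"
    then have "\<omega> m = \<omega> m'" using div by metis
    then show "l = l' \<and> m = m'" using eq \<omega>(1) by (simp add: \<rho>_def inj_eq)
  next
    fix l m l' m' q assume less: "\<rho> l m < \<rho> l' m'" and l: "l < r" "l' < r"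
    show "\<rho> l (m + q) < \<rho> l' (m' + q)"
    proof (cases "\<omega> m = \<omega> m'")
      case True
      then show ?thesis using less by (simp add: \<rho>_def \<omega>(3))
    next
      case False
      moreover have "\<omega> m \<le> \<omega> m'"
        using div_le_mono[of "\<rho> l m" "\<rho> l' m'" r] less l by (simp add: div)
      ultimately have "\<omega> m * \<omega> q < \<omega> m' * \<omega> q" using \<omega>(2)[of q] by simp
      then have "Suc (\<omega> m * \<omega> q) * r \<le> \<omega> m' * \<omega> q * r" by (intro mult_le_mono1 Suc_leI)
      then show ?thesis using l(1) by (simp add: \<rho>_def \<omega>(3) algebra_simps)
    qed
  qed
  then show ?thesis by blast
qed

context term_order
begin

definition is_lead_term :: "(nat \<Rightarrow> ('w, 'k::field) mpoly) \<Rightarrow> nat \<Rightarrow> ('w \<Rightarrow>\<^sub>0 nat) \<Rightarrow> bool" where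
  "is_lead_term f l m \<longleftrightarrow> l < r \<and> m \<in> keys (f l) \<and> (\<forall>l'<r. \<forall>m'\<in>keys (f l'). \<rho> l' m' \<le> \<rho> l m)"

lemma lead_term_exists:
  assumes "f \<in> free_mod r" "f \<noteq> 0"
  shows "\<exists>l m. is_lead_term f l m"
proof -
  define T where "T = (SIGMA l:{..<r}. keys (f l))"
  obtain l where "f l \<noteq> 0" using \<open>f \<noteq> 0\<close> by (auto simp: fun_eq_iff)
  moreover from this have "l < r" using assms(1) by (force simp: free_mod_def not_le[symmetric])
  moreover from calculation obtain m where "m \<in> keys (f l)" by fastforce
  ultimately have "T \<noteq> {}" by (auto simp: T_def)
  moreover have "finite T" by (simp add: T_def)
  ultimately have "Max (case_prod \<rho> ` T) \<in> case_prod \<rho> ` T" and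
      max: "\<And>x. x \<in> T \<Longrightarrow> case_prod \<rho> x \<le> Max (case_prod \<rho> ` T)"
    by auto
  then show ?thesis unfolding is_lead_term_def by (force simp: T_def)
qed

lemma lead_term_cancel:
  fixes f g :: "nat \<Rightarrow> ('w, 'k::field) mpoly"
  assumes f: "is_lead_term f l (a + q)" and g: "is_lead_term g l a"
  shows "\<exists>c. \<forall>l'<r. \<forall>m\<in>keys ((f - fscale (single q c) g) l'). \<rho> l' m < \<rho> l (a + q)"
proof (intro exI allI impI ballI)
  define c where "c = lookup (f l) (a + q) / lookup (g l) a"
  fix l' m assume l': "l' < r" and m: "m \<in> keys ((f - fscale (single q c) g) l')"
  have l: "l < r" "lookup (g l) a \<noteq> 0" using g by (simp_all add: is_lead_term_def in_keys_iff)
  have "lookup (single q c * g l) (a + q) = c * lookup (g l) a"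
    by (metis add.commute lookup_single_mult_add)
  then have "lookup ((f - fscale (single q c) g) l) (a + q) = 0"
    using l(2) by (simp add: c_def lookup_minus fscale_apply)
  then have "(l', m) \<noteq> (l, a + q)" using m by (auto simp: in_keys_iff)
  moreover have "\<rho> l' m \<le> \<rho> l (a + q)"
  proof (cases "m \<in> keys (f l')")
    case True
    then show ?thesis using f l' by (simp add: is_lead_term_def)
  next
    case False
    then have "m \<in> keys (single q c * g l')" using m
      by (simp add: in_keys_iff lookup_minus fscale_apply)
    then obtain b where b: "m = b + q" "b \<in> keys (g l')"
      using keys_mult[of "single q c" "g l'"] by (auto simp: add.commute split: if_splits)
    then have "\<rho> l' b \<le> \<rho> l a" using g l' by (simp add: is_lead_term_def)
    then show ?thesis
      using weight_add_mono[of l' b l a q] weight_inj[of l' b l a] l(1) l' b(1)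
      by (cases "\<rho> l' b = \<rho> l a") auto
  qed
  ultimately show "\<rho> l' m < \<rho> l (a + q)"
    using weight_inj[of l' m l "a + q"] l(1) l' by (cases "\<rho> l' m = \<rho> l (a + q)") auto
qed

lemma mem_span_if_lead_terms_divisible:
  fixes M :: "(nat \<Rightarrow> ('w, 'k::field) mpoly) set"
  assumes sub: "fmod.subspace M" "M \<subseteq> free_mod r" and A: "A \<subseteq> M"
    and div: "\<And>f l m. f \<in> M \<Longrightarrow> is_lead_term f l m \<Longrightarrow> \<exists>g\<in>A. \<exists>a q. is_lead_term g l a \<and> m = a + q"
    and f: "f \<in> M" "\<And>l m. l < r \<Longrightarrow> m \<in> keys (f l) \<Longrightarrow> \<rho> l m < n"
  shows "f \<in> fmod.span A"
  using f
proof (induction n arbitrary: f rule: less_induct)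
  case (less n)
  show ?case
  proof (cases "f = 0")
    case True
    show ?thesis unfolding True by (rule fmod.span_zero)
  next
    case False
    then obtain l m where lm: "is_lead_term f l m" using lead_term_exists sub(2) less.prems(1)
      by blast
    then obtain g a q where g: "g \<in> A" "is_lead_term g l a" "m = a + q" using div less.prems(1)
      by blast
    obtain c where c: "\<forall>l'<r. \<forall>m'\<in>keys ((f - fscale (single q c) g) l'). \<rho> l' m' < \<rho> l m"
      using lead_term_cancel lm g(2) unfolding g(3) by blast
    have "f - fscale (single q c) g \<in> fmod.span A"
    proof (rule less.IH)
      show "\<rho> l m < n" using lm less.prems(2) by (simp add: is_lead_term_def)
      show "f - fscale (single q c) g \<in> M"
        using sub(1) less.prems(1) g(1) A by (intro fmod.subspace_diff fmod.subspace_scale) auto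
    qed (use c in blast)
    moreover have "fscale (single q c) g \<in> fmod.span A" using g(1)
      by (intro fmod.span_scale fmod.span_base)
    ultimately have "(f - fscale (single q c) g) + fscale (single q c) g \<in> fmod.span A"
      by (rule fmod.span_add)
    then show ?thesis by simp
  qed
qed

end

theorem free_mod_submodule_finitely_generated:
  fixes M :: "(nat \<Rightarrow> ('w::finite, 'k::field) mpoly) set"
  assumes sub: "fmod.subspace M" "M \<subseteq> free_mod r"
  shows "\<exists>A\<subseteq>M. finite A \<and> fmod.span A = M"
proof -
  obtain \<rho> :: "nat \<Rightarrow> ('w \<Rightarrow>\<^sub>0 nat) \<Rightarrow> nat" where "term_order r \<rho>"
    using exists_term_order by blast
  then interpret term_order r \<rho> .
  define L where "L l = {m. \<exists>f\<in>M. is_lead_term f l m}" for l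
  obtain E where E: "\<And>l. E l \<subseteq> L l" "\<And>l. finite (E l)" "\<And>l m. m \<in> L l \<Longrightarrow> \<exists>a\<in>E l. \<exists>q. m = a + q"
    using dickson[of "L _"] by metis
  have "\<forall>l a. \<exists>g. a \<in> E l \<longrightarrow> g \<in> M \<and> is_lead_term g l a" using E(1) by (force simp: L_def)
  then obtain g where g: "\<And>l a. a \<in> E l \<Longrightarrow> g l a \<in> M \<and> is_lead_term (g l a) l a" by metis
  define A where "A = (\<Union>l<r. g l ` E l)"
  have "finite A" "A \<subseteq> M" using E(2) g by (auto simp: A_def)
  moreover have "M \<subseteq> fmod.span A"
  proof
    fix f assume f: "f \<in> M"
    have "finite (\<Union>l<r. \<rho> l ` keys (f l))" by simp
    then obtain n where n: "\<And>l m. l < r \<Longrightarrow> m \<in> keys (f l) \<Longrightarrow> \<rho> l m < n"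
      by (auto simp: finite_nat_set_iff_bounded)
    show "f \<in> fmod.span A"
    proof (rule mem_span_if_lead_terms_divisible[OF sub \<open>A \<subseteq> M\<close> _ f, rotated])
      fix f' l m assume "f' \<in> M" and lm: "is_lead_term f' l m"
      then obtain a q where a: "a \<in> E l" "m = a + q" using E(3)[of m l] \<open>f' \<in> M\<close> by (auto simp: L_def)
      moreover have "l < r" using lm by (simp add: is_lead_term_def)
      ultimately show "\<exists>g\<in>A. \<exists>a q. is_lead_term g l a \<and> m = a + q"
        using g by (intro bexI[of _ "g l a"]) (auto simp: A_def)
    qed (rule n)
  qed
  ultimately show ?thesis
    using fmod.span_minimal[OF _ sub(1)] by (intro exI[of _ A]) blast
qed

section \<open>Graded free resolutions\<close>

text \<open>Complexes of graded free modules with bases indexed by arbitrary finite sets. Only the values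
  of a vector on the basis in question matter.\<close>

record ('b, 's) based_complex =
  basis :: "nat \<Rightarrow> 'b set"
  bdeg :: "nat \<Rightarrow> 'b \<Rightarrow> nat"
  bdry :: "nat \<Rightarrow> 'b \<Rightarrow> 'b \<Rightarrow> 's"
  aug :: "'b \<Rightarrow> 's"

abbreviation bd :: "('b, 's::comm_ring_1) based_complex \<Rightarrow> nat \<Rightarrow> ('b \<Rightarrow> 's) \<Rightarrow> 'b \<Rightarrow> 's" where
  "bd F i \<equiv> mat_vec (basis F (Suc i)) (bdry F i)"

definition augment :: "('b, 's::comm_ring_1) based_complex \<Rightarrow> ('b \<Rightarrow> 's) \<Rightarrow> 's" where
  "augment F u = mat_vec (basis F 0) (\<lambda>_. aug F) u ()"

definition cycles :: "('b, 's::comm_ring_1) based_complex \<Rightarrow> 's set \<Rightarrow> nat \<Rightarrow> ('b \<Rightarrow> 's) set" where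
  "cycles F I i =
    (case i of 0 \<Rightarrow> {u. augment F u \<in> I} | Suc j \<Rightarrow> {u. \<forall>l\<in>basis F j. bd F j u l = 0})"

definition boundaries :: "('b, 's::comm_ring_1) based_complex \<Rightarrow> nat \<Rightarrow> ('b \<Rightarrow> 's) set" where
  "boundaries F i = {u. \<exists>w. \<forall>l\<in>basis F i. u l = bd F i w l}"

lemma cycles_0: "u \<in> cycles F I 0 \<longleftrightarrow> augment F u \<in> I"
  and cycles_Suc: "u \<in> cycles F I (Suc j) \<longleftrightarrow> (\<forall>l\<in>basis F j. bd F j u l = 0)"
  by (simp_all add: cycles_def)

lemma boundariesI: "(\<And>l. l \<in> basis F i \<Longrightarrow> u l = bd F i w l) \<Longrightarrow> u \<in> boundaries F i"
  by (auto simp: boundaries_def)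

locale resolution =
  fixes F :: "('b, ('w, 'k::comm_ring_1) mpoly) based_complex" and I :: "('w, 'k) mpoly set"
  assumes homog_ideal: "homog_ideal I"
    and finite_basis: "finite (basis F i)"
    and homog_aug: "k \<in> basis F 0 \<Longrightarrow> homog 0 (bdeg F 0 k) (aug F k)"
    and homog_bdry: "homog_mat (basis F i) (bdeg F i) (basis F (Suc i)) (bdeg F (Suc i)) (bdry F i)"
    and augment_surj: "\<exists>u. p - augment F u \<in> I"
    and cycles_eq_boundaries: "cycles F I i = boundaries F i"
begin

lemma subspace_ideal: "module.subspace (*) I"
  using homog_ideal by (simp add: homog_ideal_def)

lemmas ideal_zero = module.subspace_0[OF module_times subspace_ideal]
lemmas ideal_add = module.subspace_add[OF module_times subspace_ideal]
lemmas ideal_diff = module.subspace_diff[OF module_times subspace_ideal]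
lemmas ideal_mult = module.subspace_scale[OF module_times subspace_ideal]
lemmas ideal_sum = module.subspace_sum[OF module_times subspace_ideal]

lemma bd_cycle: "bd F i w \<in> cycles F I i"
  by (simp add: cycles_eq_boundaries boundariesI)

lemma bd_bd: "l \<in> basis F i \<Longrightarrow> bd F i (bd F (Suc i) w) l = 0"
  using bd_cycle[of "Suc i" w] by (simp add: cycles_Suc)

lemma bdry_column_cycle: "k \<in> basis F (Suc i) \<Longrightarrow> (\<lambda>l. bdry F i l k) \<in> cycles F I i"
  unfolding cycles_eq_boundaries
  by (rule boundariesI[of _ _ _ "unit_vec k"]) (simp add: mat_vec_unit_vec finite_basis)

lemma mat_mult_bdry_bdry:
  "l \<in> basis F i \<Longrightarrow> k \<in> basis F (Suc (Suc i)) \<Longrightarrow>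
    mat_mult (basis F (Suc i)) (bdry F i) (bdry F (Suc i)) l k = 0"
  using bdry_column_cycle[of k "Suc i"] by (simp add: cycles_Suc mat_mult_def)

lemma homog_lift:
  assumes A: "homog_mat (basis F i) (bdeg F i) Y t A"
    and cyc: "\<And>k. k \<in> Y \<Longrightarrow> (\<lambda>l. A l k) \<in> cycles F I i"
  shows "\<exists>h. homog_mat (basis F (Suc i)) (bdeg F (Suc i)) Y t h \<and>
    (\<forall>l\<in>basis F i. \<forall>k\<in>Y. A l k = mat_mult (basis F (Suc i)) (bdry F i) h l k)"
proof -
  have "\<exists>w. \<forall>l\<in>basis F i. A l k = bd F i w l" if "k \<in> Y" for k
    using cyc[OF that] unfolding cycles_eq_boundaries boundaries_def by simp
  then obtain w where w: "\<And>k l. k \<in> Y \<Longrightarrow> l \<in> basis F i \<Longrightarrow> A l k = bd F i (w k) l"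
    by metis
  define h where "h j k = hpart (bdeg F (Suc i) j) (t k) (w k j)" for j k
  have "A l k = mat_mult (basis F (Suc i)) (bdry F i) h l k" if lk: "l \<in> basis F i" "k \<in> Y" for l k
  proof -
    have "A l k = hpart (bdeg F i l) (t k) (bd F i (w k) l)"
      using w[OF lk(2,1)] homog_matD[OF A lk] by (simp add: hpart_homog)
    also have "\<dots> = bd F i (\<lambda>j. hpart (bdeg F (Suc i) j) (t k) (w k j)) l"
      using homog_matD[OF homog_bdry lk(1)] by (rule hpart_mat_vec)
    finally show ?thesis by (simp add: mat_mult_def h_def)
  qed
  moreover have "homog_mat (basis F (Suc i)) (bdeg F (Suc i)) Y t h"
    by (simp add: homog_mat_def h_def homog_hpart)
  ultimately show ?thesis by blast
qed

end

locale minimal_resolution = resolution F I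
  for F :: "('b, ('w, 'k::comm_ring_1) mpoly) based_complex" and I +
  assumes minimal: "l \<in> basis F i \<Longrightarrow> k \<in> basis F (Suc i) \<Longrightarrow> const_coeff (bdry F i l k) = 0"

locale cyclic_minimal_resolution = minimal_resolution F I
  for F :: "('b, ('w, 'k::comm_ring_1) mpoly) based_complex" and I +
  fixes z :: 'b
  assumes basis_0: "basis F 0 = {z}" and aug_base: "aug F z = 1"
begin

lemma augment_eq: "augment F u = u z"
  by (simp add: augment_def mat_vec_def basis_0 aug_base)

lemma mem_ideal_iff: "p \<in> I \<longleftrightarrow> (\<exists>w. p = bd F 0 w z)"
proof -
  have "p \<in> I \<longleftrightarrow> (\<lambda>_. p) \<in> cycles F I 0"
    by (simp add: cycles_0 augment_eq)
  then show ?thesis by (simp add: cycles_eq_boundaries boundaries_def basis_0)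
qed

lemma bdeg_base: "bdeg F 0 z = 0"
proof -
  have "0 \<in> keys (1 :: ('w, 'k) mpoly)" by simp
  then show ?thesis using homog_aug[of z] unfolding homog_def basis_0 aug_base
    by (force simp: mdeg_def)
qed

end

definition seq_complex :: "'s graded_free_seq \<Rightarrow> (nat \<Rightarrow> 's) \<Rightarrow> (nat, 's) based_complex" where
  "seq_complex E g =
    \<lparr>basis = \<lambda>i. {..<rnk E i}, bdeg = shift E, bdry = diff E, aug = g\<rparr>"

lemma seq_complex_simps [simp]:
  "basis (seq_complex E g) i = {..<rnk E i}" "bdeg (seq_complex E g) = shift E"
  "bdry (seq_complex E g) = diff E" "aug (seq_complex E g) = g"
  by (simp_all add: seq_complex_def)

definition trunc :: "nat \<Rightarrow> (nat \<Rightarrow> 'a::zero) \<Rightarrow> nat \<Rightarrow> 'a" where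
  "trunc n u k = (if k < n then u k else 0)"

lemma trunc_in_free_mod [simp]: "trunc n u \<in> free_mod n"
  by (simp add: trunc_def free_mod_def)

lemma trunc_free_mod: "u \<in> free_mod n \<Longrightarrow> trunc n u = u"
  by (auto simp: trunc_def free_mod_def fun_eq_iff not_less)

lemma mat_vec_trunc: "mat_vec {..<n} A (trunc n u) = mat_vec {..<n} A u"
  by (simp add: fun_eq_iff mat_vec_def trunc_def)

lemma mat_app_eq_trunc: "mat_app r c A u = trunc r (mat_vec {..<c} A u)"
  by (simp add: fun_eq_iff mat_app_def trunc_def mat_vec_def)

lemma boundaries_seq_complex_iff:
  "u \<in> boundaries (seq_complex E g) i \<longleftrightarrow>
    trunc (rnk E i) u \<in> mat_app (rnk E i) (rnk E (Suc i)) (diff E i) ` free_mod (rnk E (Suc i))"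
proof -
  have "u \<in> boundaries (seq_complex E g) i \<longleftrightarrow>
      (\<exists>w. trunc (rnk E i) u = trunc (rnk E i) (bd (seq_complex E g) i w))"
    by (auto simp: boundaries_def trunc_def fun_eq_iff)
  also have "\<dots> \<longleftrightarrow> (\<exists>w\<in>free_mod (rnk E (Suc i)).
      trunc (rnk E i) u = trunc (rnk E i) (bd (seq_complex E g) i w))"
    by (metis mat_vec_trunc seq_complex_simps(1) trunc_in_free_mod)
  finally show ?thesis by (auto simp: mat_app_eq_trunc)
qed

lemma cycles_seq_complex_trunc:
  "trunc (rnk E i) u \<in> cycles (seq_complex E g) I i \<longleftrightarrow> u \<in> cycles (seq_complex E g) I i"
  by (cases i) (simp_all add: cycles_def augment_def mat_vec_trunc)

lemma cycles_seq_complex_eq_boundaries_iff: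
  "cycles (seq_complex E g) I i = boundaries (seq_complex E g) i \<longleftrightarrow>
    {f \<in> free_mod (rnk E i). f \<in> cycles (seq_complex E g) I i} =
      mat_app (rnk E i) (rnk E (Suc i)) (diff E i) ` free_mod (rnk E (Suc i))"
  (is "?C = ?B \<longleftrightarrow> ?Z = ?R")
proof
  assume eq: "?C = ?B"
  show "?Z = ?R"
  proof (rule set_eqI)
    fix f
    show "f \<in> ?Z \<longleftrightarrow> f \<in> ?R"
    proof (cases "f \<in> free_mod (rnk E i)")
      case True
      then show ?thesis using eq boundaries_seq_complex_iff[of f E g i] by (simp add: trunc_free_mod)
    next
      case False
      then show ?thesis by (auto simp: mat_app_eq_trunc)
    qed
  qed
next
  assume "?Z = ?R"
  then have "u \<in> ?B \<longleftrightarrow> trunc (rnk E i) u \<in> ?C" for u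
    unfolding boundaries_seq_complex_iff by auto
  then show "?C = ?B" by (auto simp: cycles_seq_complex_trunc)
qed

lemma cycles_seq_complex_Suc:
  "u \<in> cycles (seq_complex E g) I (Suc i) \<longleftrightarrow> mat_app (rnk E i) (rnk E (Suc i)) (diff E i) u = 0"
  by (auto simp: cycles_Suc mat_app_eq_trunc trunc_def fun_eq_iff)

lemma graded_free_resolution_iff:
  fixes E :: "('w, 'k::field) mpoly graded_free_seq"
  assumes I: "homog_ideal I"
  shows "graded_free_resolution E I \<longleftrightarrow> (\<exists>g. resolution (seq_complex E g) I)"
proof -
  have aug: "augment (seq_complex E g) u = (\<Sum>k<rnk E 0. u k * g k)" for g u
    by (simp add: augment_def mat_vec_def mult.commute)
  have surj: "(\<exists>u\<in>free_mod (rnk E 0). p - (\<Sum>k<rnk E 0. u k * g k) \<in> I) \<longleftrightarrow>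
      (\<exists>u. p - augment (seq_complex E g) u \<in> I)" for p g
    unfolding aug[symmetric] augment_def
    by (metis mat_vec_trunc seq_complex_simps(1) trunc_in_free_mod)
  have exact: "(\<forall>i. cycles (seq_complex E g) I i = boundaries (seq_complex E g) i) \<longleftrightarrow>
      {f \<in> free_mod (rnk E 0). (\<Sum>k<rnk E 0. f k * g k) \<in> I} =
         mat_app (rnk E 0) (rnk E 1) (diff E 0) ` free_mod (rnk E 1) \<and>
       (\<forall>i. {f \<in> free_mod (rnk E (Suc i)). mat_app (rnk E i) (rnk E (Suc i)) (diff E i) f = 0} =
         mat_app (rnk E (Suc i)) (rnk E (Suc (Suc i))) (diff E (Suc i)) `
           free_mod (rnk E (Suc (Suc i))))"
    for g
  proof -
    have split: "(\<forall>i. P i) \<longleftrightarrow> P 0 \<and> (\<forall>i. P (Suc i))" for P :: "nat \<Rightarrow> bool"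
      by (metis nat.exhaust)
    show ?thesis
      unfolding cycles_seq_complex_eq_boundaries_iff
      by (subst split) (simp add: cycles_0 cycles_seq_complex_Suc aug)
  qed
  show ?thesis
    unfolding graded_free_resolution_def resolution_def surj exact[symmetric]
    using I by (simp add: homog_mat_def homog_def Ball_def)
qed

section \<open>Existence of minimal resolutions\<close>

definition homog_over ::
  "'w set \<Rightarrow> nat \<Rightarrow> (nat \<Rightarrow> nat) \<Rightarrow> nat \<Rightarrow> (nat \<Rightarrow> ('w, 'k::comm_ring_1) mpoly) \<Rightarrow> bool" where
  "homog_over W r s e f \<longleftrightarrow> f \<in> free_mod r \<and> (\<forall>l<r. f l \<in> polys_in W \<and> homog (s l) e (f l))"

definition homog_generated ::
  "'w set \<Rightarrow> nat \<Rightarrow> (nat \<Rightarrow> nat) \<Rightarrow> (nat \<Rightarrow> ('w, 'k::comm_ring_1) mpoly) set \<Rightarrow> bool" where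
  "homog_generated W r s M \<longleftrightarrow> (\<exists>G. (\<forall>f\<in>G. \<exists>e. homog_over W r s e f) \<and> M = fmod.span G)"

definition syzygies :: "nat \<Rightarrow> (nat \<Rightarrow> nat \<Rightarrow> 'a::comm_ring_1) \<Rightarrow> (nat \<Rightarrow> 'a) set" where
  "syzygies n A = {w \<in> free_mod n. mat_vec {..<n} A w = 0}"

definition minimal_presentation ::
  "'w set \<Rightarrow> nat \<Rightarrow> (nat \<Rightarrow> nat) \<Rightarrow> (nat \<Rightarrow> ('w, 'k::comm_ring_1) mpoly) set \<Rightarrow>
    nat \<Rightarrow> (nat \<Rightarrow> nat) \<Rightarrow> (nat \<Rightarrow> nat \<Rightarrow> ('w, 'k) mpoly) \<Rightarrow> bool" where
  "minimal_presentation W r s M n t A \<longleftrightarrow> (\<forall>k<n. homog_over W r s (t k) (\<lambda>l. A l k)) \<and>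
     M = range (mat_vec {..<n} A) \<and> (\<forall>w\<in>syzygies n A. \<forall>k. const_coeff (w k) = 0)"

lemma subspace_free_mod: "fmod.subspace (free_mod r)"
  by (rule fmod.subspaceI) (auto simp: free_mod_def fscale_apply)

lemma subspace_syzygies: "fmod.subspace (syzygies n A)"
  by (rule fmod.subspaceI)
    (auto simp: syzygies_def mat_vec.zero mat_vec.add mat_vec.scale
      intro: fmod.subspace_0[OF subspace_free_mod] fmod.subspace_add[OF subspace_free_mod]
        fmod.subspace_scale[OF subspace_free_mod])

lemma subspace_const_coeff_0:
  "fmod.subspace {w :: 'b \<Rightarrow> ('w, 'k::comm_ring_1) mpoly. \<forall>k. const_coeff (w k) = 0}"
  by (rule fmod.subspaceI)
    (simp_all add: fscale_apply const_coeff.zero const_coeff.add const_coeff_mult)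

lemma homog_generated_subset_free_mod: "homog_generated W r s M \<Longrightarrow> M \<subseteq> free_mod r"
  unfolding homog_generated_def homog_over_def
  by (metis fmod.span_minimal subsetI subspace_free_mod)

lemma exists_irredundant_subset:
  assumes "finite T"
  shows "\<exists>T'\<subseteq>T. fmod.span T' = fmod.span T \<and> (\<forall>x\<in>T'. x \<notin> fmod.span (T' - {x}))"
  using assms
proof (induction T rule: finite_psubset_induct)
  case (psubset T)
  show ?case
  proof (cases "\<exists>x\<in>T. x \<in> fmod.span (T - {x})")
    case True
    then obtain x where x: "x \<in> T" "x \<in> fmod.span (T - {x})" by blast
    have "T \<subseteq> fmod.span (T - {x})"
    proof
      fix y assume "y \<in> T"
      then show "y \<in> fmod.span (T - {x})" using x(2) fmod.span_base[of y "T - {x}"]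
        by (cases "y = x") auto
    qed
    then have "fmod.span (T - {x}) = fmod.span T"
      using fmod.span_superset[of T] unfolding fmod.span_eq by blast
    moreover have "T - {x} \<subset> T" using x(1) by blast
    ultimately show ?thesis using psubset.IH[of "T - {x}"] by auto
  qed blast
qed

lemma homog_generated_irredundant:
  fixes M :: "(nat \<Rightarrow> ('w::finite, 'k::field) mpoly) set"
  assumes "homog_generated W r s M"
  shows "\<exists>(n::nat) t A. (\<forall>k<n. homog_over W r s (t k) (\<lambda>l. A l k)) \<and> M = range (mat_vec {..<n} A) \<and>
    (\<forall>k<n. (\<lambda>l. A l k) \<notin> fmod.span ((\<lambda>k l. A l k) ` ({..<n} - {k})))"
proof -
  obtain G where G: "\<And>f. f \<in> G \<Longrightarrow> \<exists>e. homog_over W r s e f" "M = fmod.span G"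
    using assms by (auto simp: homog_generated_def)
  obtain A0 where A0: "A0 \<subseteq> M" "finite A0" "fmod.span A0 = M"
    using free_mod_submodule_finitely_generated[OF _ homog_generated_subset_free_mod[OF assms]]
    by (auto simp: G(2))
  obtain T0 where T0: "T0 \<subseteq> G" "finite T0" "A0 \<subseteq> fmod.span T0"
    using finite_subset_of_span A0(1,2) unfolding G(2) by metis
  have "fmod.span T0 = M"
    using T0 A0(3) G(2) by (metis fmod.span_mono fmod.span_minimal fmod.subspace_span subset_antisym)
  then obtain T where T: "T \<subseteq> T0" "fmod.span T = M" "\<And>x. x \<in> T \<Longrightarrow> x \<notin> fmod.span (T - {x})"
    using exists_irredundant_subset[OF T0(2)] by blast
  obtain g where "bij_betw g {0..<card T} T"
    using ex_bij_betw_nat_finite finite_subset[OF T(1) T0(2)] by blast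
  then have g: "inj_on g {..<card T}" "g ` {..<card T} = T"
    by (simp_all add: bij_betw_def atLeast0LessThan)
  obtain t where t: "\<And>k. k < card T \<Longrightarrow> homog_over W r s (t k) (g k)"
  proof -
    have "\<exists>e. homog_over W r s e (g k)" if "k < card T" for k
      using G(1) g(2) T(1) T0(1) that by blast
    then show thesis using that by metis
  qed
  show ?thesis
  proof (intro exI[of _ "card T"] exI[of _ t] exI[of _ "\<lambda>l k. g k l"] conjI allI impI)
    show "M = range (mat_vec {..<card T} (\<lambda>l k. g k l))"
      using T(2) g(2) by (simp add: range_mat_vec)
    show "(\<lambda>l. g k l) \<notin> fmod.span ((\<lambda>k l. g k l) ` ({..<card T} - {k}))" if "k < card T" for k
    proof -
      have "g ` ({..<card T} - {k}) = T - {g k}"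
        using inj_on_image_set_diff[OF g(1), of "{..<card T}" "{k}"] that g(2) by simp
      then show ?thesis using T(3)[of "g k"] g(2) that by auto
    qed
  qed (use t in simp)
qed

text \<open>A syzygy over the whole polynomial ring is decomposed by degree and by the monomials in the
  variables outside \<open>W\<close>. A part is labelled by such a monomial and by the degree of the cofactor.\<close>

definition part_label :: "'w set \<Rightarrow> nat \<Rightarrow> ('w \<Rightarrow>\<^sub>0 nat) \<Rightarrow> ('w \<Rightarrow>\<^sub>0 nat) \<times> nat" where
  "part_label W d m = (restr (- W) m, mdeg (restr W m) + d)"

definition vec_part ::
  "'w set \<Rightarrow> (nat \<Rightarrow> nat) \<Rightarrow> ('w \<Rightarrow>\<^sub>0 nat) \<times> nat \<Rightarrow> (nat \<Rightarrow> ('w, 'k::comm_ring_1) mpoly) \<Rightarrow>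
    nat \<Rightarrow> ('w, 'k) mpoly" where
  "vec_part W t x w k = pushforward (\<lambda>m. part_label W (t k) m = x) (restr W) (w k)"

lemma eq_sum_vec_part:
  assumes w: "w \<in> free_mod n"
  shows "\<exists>E. w = (\<Sum>x\<in>E. fscale (single (fst x) 1) (vec_part W t x w))"
proof -
  define E where "E = (\<Union>k<n. part_label W (t k) ` keys (w k))"
  have "w k = (\<Sum>x\<in>E. single (fst x) 1 * vec_part W t x w k)" for k
  proof (cases "k < n")
    case True
    then show ?thesis
      unfolding vec_part_def
      by (intro eq_sum_pushforward) (auto simp: E_def part_label_def restr_Compl_add_restr)
  next
    case False
    then show ?thesis using w by (simp add: vec_part_def free_mod_def pushforward.zero)
  qed
  then have "w = (\<Sum>x\<in>E. fscale (single (fst x) 1) (vec_part W t x w))"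
    by (simp add: fun_eq_iff sum_fun_apply fscale_apply)
  then show ?thesis ..
qed

lemma homog_over_vec_part:
  assumes w: "w \<in> free_mod n"
  shows "homog_over W n t (snd x) (vec_part W t x w)"
proof -
  have "vec_part W t x w \<in> free_mod n"
    using w by (simp add: vec_part_def free_mod_def pushforward.zero)
  moreover have "vec_part W t x w k \<in> polys_in W \<and> homog (t k) (snd x) (vec_part W t x w k)" for k
    using keys_pushforward[of "\<lambda>m. part_label W (t k) m = x" "restr W" "w k"]
    by (fastforce simp: vec_part_def part_label_def polys_in_def homog_def
        dest: subsetD[OF keys_restr])
  ultimately show ?thesis by (simp add: homog_over_def)
qed

lemma mat_vec_vec_part:
  assumes A: "\<And>k. k < n \<Longrightarrow> homog_over W r s (t k) (\<lambda>l. A l k)"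
  shows "mat_vec {..<n} A (vec_part W t x w) = vec_part W s x (mat_vec {..<n} A w)"
proof
  fix l
  have "A l k * vec_part W t x w k =
      pushforward (\<lambda>m. part_label W (s l) m = x) (restr W) (A l k * w k)"
    if "k < n" for k
  proof (cases "l < r")
    case True
    then have "mdeg m + s l = t k \<and> keys m \<subseteq> W" if "m \<in> keys (A l k)" for m
      using A[OF \<open>k < n\<close>] that by (auto simp: homog_over_def homog_def polys_in_def)
    then show ?thesis
      unfolding vec_part_def
      by (intro pushforward_mult[symmetric])
        (auto simp: part_label_def restr_add restr_id restr_Compl_id mdeg_add algebra_simps)
  next
    case False
    then show ?thesis using A[OF that] by (simp add: homog_over_def free_mod_def pushforward.zero)
  qed
  then show "mat_vec {..<n} A (vec_part W t x w) l = vec_part W s x (mat_vec {..<n} A w) l"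
    by (simp add: mat_vec_def vec_part_def pushforward.sum)
qed

lemma homog_generated_syzygies:
  fixes A :: "nat \<Rightarrow> nat \<Rightarrow> ('w::finite, 'k::comm_ring_1) mpoly"
  assumes A: "\<And>k. k < n \<Longrightarrow> homog_over W r s (t k) (\<lambda>l. A l k)"
  shows "homog_generated W n t (syzygies n A)"
proof -
  define G where "G = {w \<in> syzygies n A. \<exists>e. homog_over W n t e w}"
  have "w \<in> fmod.span G" if w: "w \<in> syzygies n A" for w
  proof -
    have free: "w \<in> free_mod n" and "mat_vec {..<n} A w = 0" using w by (simp_all add: syzygies_def)
    then have "mat_vec {..<n} A (vec_part W t x w) = 0" for x
      by (simp add: mat_vec_vec_part[OF A] vec_part_def fun_eq_iff pushforward.zero)
    then have "vec_part W t x w \<in> G" for x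
      using homog_over_vec_part[OF free, of W t x] by (auto simp: G_def syzygies_def homog_over_def)
    moreover obtain E where "w = (\<Sum>x\<in>E. fscale (single (fst x) 1) (vec_part W t x w))"
      using eq_sum_vec_part[OF free] by blast
    ultimately show ?thesis
      by (metis (no_types, lifting) fmod.span_sum fmod.span_scale fmod.span_base)
  qed
  moreover have "fmod.span G \<subseteq> syzygies n A"
    by (rule fmod.span_minimal) (auto simp: G_def subspace_syzygies)
  ultimately have "syzygies n A = fmod.span G" by blast
  moreover have "\<forall>w\<in>G. \<exists>e. homog_over W n t e w" by (simp add: G_def)
  ultimately show ?thesis unfolding homog_generated_def by blast
qed

text \<open>A syzygy with a unit entry would express one of the generators by the others.\<close>

lemma const_coeff_syzygy:
  fixes A :: "nat \<Rightarrow> nat \<Rightarrow> ('w::finite, 'k::field) mpoly"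
  assumes irr: "\<And>k. k < n \<Longrightarrow> (\<lambda>l. A l k) \<notin> fmod.span ((\<lambda>k l. A l k) ` ({..<n} - {k}))"
    and w: "w \<in> syzygies n A" "homog_over W n t e w"
  shows "const_coeff (w k) = 0"
proof (rule ccontr)
  define c where "c = const_coeff (w k)"
  assume "const_coeff (w k) \<noteq> 0"
  then have c: "c \<noteq> 0" by (simp add: c_def)
  have k: "k < n"
    using c w(1) by (force simp: c_def syzygies_def free_mod_def const_coeff.zero not_le[symmetric])
  have "homog (t k) e (w k)" using w(2) k by (simp add: homog_over_def)
  moreover from this have "e = t k" using const_coeff_homog c unfolding c_def by blast
  ultimately have "w k = single 0 c" using homog_self_eq_single unfolding c_def by blast
  define b :: "('w, 'k) mpoly" where "b = single 0 (inverse c)"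
  have b: "b * w k = 1" using c \<open>w k = single 0 c\<close> by (simp add: b_def mult_single)
  let ?rest = "\<Sum>j\<in>{..<n} - {k}. fscale (w j) (\<lambda>l. A l j)"
  have "0 = (\<Sum>j<n. fscale (w j) (\<lambda>l. A l j))"
    using w(1) by (simp add: syzygies_def mat_vec_eq_sum_fscale)
  also have "\<dots> = fscale (w k) (\<lambda>l. A l k) + ?rest"
    using k by (intro sum.remove) auto
  finally have "0 = fscale b (fscale (w k) (\<lambda>l. A l k) + ?rest)"
    by (metis fmod.scale_zero_right)
  then have "(\<lambda>l. A l k) = - fscale b ?rest"
    by (simp only: fmod.scale_right_distrib fmod.scale_scale b fmod.scale_one eq_neg_iff_add_eq_0)
  also have "\<dots> \<in> fmod.span ((\<lambda>k l. A l k) ` ({..<n} - {k}))"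
    by (intro fmod.span_neg fmod.span_scale fmod.span_sum) (intro fmod.span_base imageI)
  finally show False using irr[OF k] by contradiction
qed

lemma minimal_presentation_exists:
  fixes M :: "(nat \<Rightarrow> ('w::finite, 'k::field) mpoly) set"
  assumes "homog_generated W r s M"
  shows "\<exists>n t A. minimal_presentation W r s M n t A \<and> homog_generated W n t (syzygies n A)"
proof -
  obtain n :: nat and t A where A: "\<And>k. k < n \<Longrightarrow> homog_over W r s (t k) (\<lambda>l. A l k)"
      "M = range (mat_vec {..<n} A)"
    and irr: "\<And>k. k < n \<Longrightarrow> (\<lambda>l. A l k) \<notin> fmod.span ((\<lambda>k l. A l k) ` ({..<n} - {k}))"
    using homog_generated_irredundant[OF assms] by (elim exE conjE) blast
  have gen: "homog_generated W n t (syzygies n A)"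
    by (rule homog_generated_syzygies) (rule A(1))
  then obtain G where G: "\<And>w. w \<in> G \<Longrightarrow> \<exists>e. homog_over W n t e w" "syzygies n A = fmod.span G"
    by (auto simp: homog_generated_def)
  have "const_coeff (w k) = 0" if "w \<in> G" for w k
    using const_coeff_syzygy[OF irr] G that fmod.span_base by metis
  then have "G \<subseteq> {w. \<forall>k. const_coeff (w k) = 0}" by blast
  then have "syzygies n A \<subseteq> {w. \<forall>k. const_coeff (w k) = 0}"
    unfolding G(2) by (rule fmod.span_minimal) (rule subspace_const_coeff_0)
  then show ?thesis using A gen unfolding minimal_presentation_def by blast
qed

locale iterated_presentation =
  fixes W :: "'w::finite set" and r :: "nat \<Rightarrow> nat" and s :: "nat \<Rightarrow> nat \<Rightarrow> nat"
    and M :: "nat \<Rightarrow> (nat \<Rightarrow> ('w, 'k::field) mpoly) set" and D :: "nat \<Rightarrow> nat \<Rightarrow> nat \<Rightarrow> ('w, 'k) mpoly"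
  assumes M_0: "M 0 \<subseteq> free_mod (r 0)"
    and presentation: "minimal_presentation W (r i) (s i) (M i) (r (Suc i)) (s (Suc i)) (D i)"
    and M_Suc: "M (Suc i) = syzygies (r (Suc i)) (D i)"
begin

lemma column_homog_over: "k < r (Suc i) \<Longrightarrow> homog_over W (r i) (s i) (s (Suc i) k) (\<lambda>l. D i l k)"
  and M_eq_range: "M i = range (mat_vec {..<r (Suc i)} (D i))"
  and const_coeff_M_Suc: "w \<in> M (Suc i) \<Longrightarrow> const_coeff (w k) = 0"
  using presentation[of i] by (simp_all add: minimal_presentation_def M_Suc)

lemma M_subset_free_mod: "M i \<subseteq> free_mod (r i)"
  by (cases i) (use M_0 in \<open>auto simp: M_Suc syzygies_def\<close>)

lemma trunc_mat_vec: "trunc (r i) (mat_vec {..<r (Suc i)} (D i) w) = mat_vec {..<r (Suc i)} (D i) w"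
  using M_subset_free_mod[of i] unfolding M_eq_range by (blast intro: trunc_free_mod)

lemma column_in_M: "k < r (Suc i) \<Longrightarrow> (\<lambda>l. D i l k) \<in> M i"
  unfolding M_eq_range
  by (rule range_eqI[of _ _ "unit_vec k"]) (simp add: fun_eq_iff mat_vec_unit_vec)

lemma trunc_in_M_iff:
  "trunc (r i) u \<in> M i \<longleftrightarrow> (\<exists>w. \<forall>l<r i. u l = mat_vec {..<r (Suc i)} (D i) w l)"
proof -
  have "trunc (r i) u = mat_vec {..<r (Suc i)} (D i) w \<longleftrightarrow>
      (\<forall>l<r i. u l = mat_vec {..<r (Suc i)} (D i) w l)" for w
    by (subst trunc_mat_vec[symmetric]) (auto simp: trunc_def fun_eq_iff)
  then show ?thesis unfolding M_eq_range by auto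
qed

lemma trunc_in_M_Suc_iff:
  "trunc (r (Suc i)) u \<in> M (Suc i) \<longleftrightarrow> (\<forall>l<r i. mat_vec {..<r (Suc i)} (D i) u l = 0)"
proof -
  have "mat_vec {..<r (Suc i)} (D i) u = 0 \<longleftrightarrow> (\<forall>l<r i. mat_vec {..<r (Suc i)} (D i) u l = 0)"
    by (subst trunc_mat_vec[symmetric]) (auto simp: trunc_def fun_eq_iff)
  then show ?thesis by (simp add: M_Suc syzygies_def mat_vec_trunc)
qed

end

lemma iterated_presentation_exists:
  fixes M0 :: "(nat \<Rightarrow> ('w::finite, 'k::field) mpoly) set"
  assumes M0: "homog_generated W r0 s0 M0"
  obtains r s M D where "r 0 = r0" "s 0 = s0" "M 0 = M0" "iterated_presentation W r s M D"
proof -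
  define P where "P n = (\<lambda>(r, s, M). homog_generated W r s M \<and> (n = 0 \<longrightarrow> (r, s, M) = (r0, s0, M0)))"
    for n :: nat
  define Q where "Q = (\<lambda>(r, s, M :: (nat \<Rightarrow> ('w, 'k) mpoly) set) (r', s', M').
    \<exists>A. minimal_presentation W r s M r' s' A \<and> M' = syzygies r' A)"
  have "\<exists>X. \<forall>n. P n (X n) \<and> Q (X n) (X (Suc n))"
  proof (rule dependent_nat_choice)
    show "\<exists>x. P 0 x" using M0 by (auto simp: P_def)
  next
    fix x n assume "P n x"
    moreover obtain r s M where x: "x = (r, s, M)" by (cases x)
    ultimately have "homog_generated W r s M" by (simp add: P_def)
    then obtain r' t A where "minimal_presentation W r s M r' t A"
      "homog_generated W r' t (syzygies r' A)"
      using minimal_presentation_exists by blast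
    then show "\<exists>y. P (Suc n) y \<and> Q x y"
      by (intro exI[of _ "(r', t, syzygies r' A)"]) (auto simp: P_def Q_def x)
  qed
  then obtain X where X: "\<And>n. P n (X n)" "\<And>n. Q (X n) (X (Suc n))" by blast
  define r s M where "r n = fst (X n)" and "s n = fst (snd (X n))" and "M n = snd (snd (X n))" for n
  have X_eq: "X n = (r n, s n, M n)" for n by (simp add: r_def s_def M_def)
  have start: "r 0 = r0" "s 0 = s0" "M 0 = M0" using X(1)[of 0] by (simp_all add: X_eq P_def)
  have "\<exists>A. minimal_presentation W (r n) (s n) (M n) (r (Suc n)) (s (Suc n)) A \<and>
      M (Suc n) = syzygies (r (Suc n)) A" for n
    using X(2)[of n] by (simp add: X_eq Q_def)
  then obtain D where "\<And>n. minimal_presentation W (r n) (s n) (M n) (r (Suc n)) (s (Suc n)) (D n)"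
      "\<And>n. M (Suc n) = syzygies (r (Suc n)) (D n)" by metis
  then have "iterated_presentation W r s M D"
    using homog_generated_subset_free_mod[OF M0] by unfold_locales (simp_all add: start)
  with start show thesis by (rule that)
qed

definition ideal_vectors :: "'a::comm_ring_1 set \<Rightarrow> (nat \<Rightarrow> 'a) set" where
  "ideal_vectors I = {f \<in> free_mod 1. f 0 \<in> I}"

lemma ideal_vectors_ideal_gen:
  "ideal_vectors (ideal_gen Gs) = fmod.span ((\<lambda>p. fscale p (unit_vec 0)) ` Gs)"
proof -
  have "module_hom (*) fscale (\<lambda>p. fscale p (unit_vec 0 :: nat \<Rightarrow> 'a))"
    using module_times fmod.module_axioms
    by (simp add: module_hom_def module_hom_axioms_def fmod.scale_left_distrib fmod.scale_scale)
  then have "fmod.span ((\<lambda>p. fscale p (unit_vec 0 :: nat \<Rightarrow> 'a)) ` Gs) =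
      (\<lambda>p. fscale p (unit_vec 0)) ` ideal_gen Gs"
    unfolding ideal_gen_def by (rule module_hom.span_image)
  also have "\<dots> = ideal_vectors (ideal_gen Gs)"
  proof
    show "(\<lambda>p. fscale p (unit_vec 0)) ` ideal_gen Gs \<subseteq> ideal_vectors (ideal_gen Gs)"
      by (auto simp: ideal_vectors_def free_mod_def unit_vec_def fscale_apply)
    have "f = fscale (f 0) (unit_vec 0)" if "f \<in> free_mod 1" for f :: "nat \<Rightarrow> 'a"
      using that by (auto simp: free_mod_def unit_vec_def fscale_apply fun_eq_iff)
    then show "ideal_vectors (ideal_gen Gs) \<subseteq> (\<lambda>p. fscale p (unit_vec 0)) ` ideal_gen Gs"
      unfolding ideal_vectors_def by blast
  qed
  finally show ?thesis ..
qed

lemma const_coeff_ideal_gen: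
  assumes "\<And>p. p \<in> Gs \<Longrightarrow> const_coeff p = 0" and "p \<in> ideal_gen Gs"
  shows "const_coeff p = 0"
  using assms(2)
  by (induction rule: ideal_gen_induct)
    (simp_all add: assms(1) const_coeff.zero const_coeff.add const_coeff_mult)

lemma (in iterated_presentation) cyclic_minimal_resolution:
  assumes start: "r 0 = 1" "s 0 = (\<lambda>_. 0)" "M 0 = ideal_vectors I"
    and I: "homog_ideal I" "\<And>p. p \<in> I \<Longrightarrow> const_coeff p = 0"
  shows "cyclic_minimal_resolution (seq_complex \<lparr>rnk = r, shift = s, diff = D\<rparr> (\<lambda>_. 1)) I 0"
proof
  let ?F = "seq_complex \<lparr>rnk = r, shift = s, diff = D\<rparr> (\<lambda>_. 1)"
  have aug: "augment ?F u = u 0" for u by (simp add: augment_def mat_vec_def start)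
  have "0 \<in> I"
    using I(1) by (simp add: homog_ideal_def module.subspace_0[OF module_times])
  then show "\<exists>u. p - augment ?F u \<in> I" for p
    unfolding aug by (intro exI[of _ "\<lambda>_. p"]) simp
  show "cycles ?F I i = boundaries ?F i" for i
  proof -
    have "u \<in> boundaries ?F i \<longleftrightarrow> trunc (r i) u \<in> M i" for u
      by (simp add: boundaries_def trunc_in_M_iff Ball_def)
    moreover have "u \<in> cycles ?F I i \<longleftrightarrow> trunc (r i) u \<in> M i" for u
      by (cases i)
        (auto simp: cycles_0 cycles_Suc aug trunc_in_M_Suc_iff start ideal_vectors_def trunc_def)
    ultimately show ?thesis by blast
  qed
  show "homog_mat (basis ?F i) (bdeg ?F i) (basis ?F (Suc i)) (bdeg ?F (Suc i)) (bdry ?F i)" for i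
    using column_homog_over by (simp add: homog_mat_def homog_over_def)
  have "const_coeff (w k) = 0" if "w \<in> ideal_vectors I" for w :: "nat \<Rightarrow> ('w, 'k) mpoly" and k
    using that I(2) by (cases k) (simp_all add: ideal_vectors_def free_mod_def const_coeff.zero)
  then have "const_coeff (w k) = 0" if "w \<in> M i" for w i k
    using that const_coeff_M_Suc by (cases i) (auto simp: start(3))
  from this[OF column_in_M] show "const_coeff (bdry ?F i l k) = 0" if "k \<in> basis ?F (Suc i)" for i l k
    using that by simp
qed (use start I(1) in auto)

theorem exists_minimal_resolution:
  fixes Gs :: "('w::finite, 'k::field) mpoly set"
  assumes Gs: "\<And>p. p \<in> Gs \<Longrightarrow> p \<in> polys_in W" "\<And>p. p \<in> Gs \<Longrightarrow> \<exists>e>0. homog 0 e p"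
  obtains E where "cyclic_minimal_resolution (seq_complex E (\<lambda>_. 1)) (ideal_gen Gs) 0"
    and "\<And>i l k. l < rnk E i \<Longrightarrow> k < rnk E (Suc i) \<Longrightarrow> diff E i l k \<in> polys_in W"
proof -
  have "\<exists>e. homog_over W 1 (\<lambda>_. 0) e (fscale p (unit_vec 0))" if "p \<in> Gs" for p
    using Gs[OF that] by (auto simp: homog_over_def free_mod_def fscale_apply unit_vec_def)
  then have "homog_generated W 1 (\<lambda>_. 0) (ideal_vectors (ideal_gen Gs))"
    unfolding homog_generated_def ideal_vectors_ideal_gen
    by (intro exI[of _ "(\<lambda>p. fscale p (unit_vec 0)) ` Gs"] conjI refl) blast
  then obtain r s M D where start: "r 0 = 1" "s 0 = (\<lambda>_. 0)" "M 0 = ideal_vectors (ideal_gen Gs)"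
    and "iterated_presentation W r s M D"
    by (rule iterated_presentation_exists)
  from this(4) interpret iterated_presentation W r s M D .
  have "const_coeff p = 0" if "p \<in> Gs" for p
    using Gs(2)[OF that] const_coeff_homog by blast
  then have "cyclic_minimal_resolution
      (seq_complex \<lparr>rnk = r, shift = s, diff = D\<rparr> (\<lambda>_. 1)) (ideal_gen Gs) 0"
    using Gs(2)
    by (intro cyclic_minimal_resolution start homog_ideal_ideal_gen)
      (blast, blast intro: const_coeff_ideal_gen)
  then show thesis
    by (rule that) (use column_homog_over in \<open>simp add: homog_over_def\<close>)
qed

section \<open>Comparison of resolutions\<close>

lemma (in resolution) homog_lift_augment:
  assumes p: "\<And>k. k \<in> Y \<Longrightarrow> homog 0 (t k) (p k)"
  shows "\<exists>\<phi>. homog_mat (basis F 0) (bdeg F 0) Y t \<phi> \<and> (\<forall>k\<in>Y. p k - augment F (\<lambda>l. \<phi> l k) \<in> I)"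
proof -
  have "\<forall>k. \<exists>u. p k - augment F u \<in> I" using augment_surj by blast
  then obtain u where u: "\<And>k. p k - augment F (u k) \<in> I" by metis
  define \<phi> where "\<phi> l k = hpart (bdeg F 0 l) (t k) (u k l)" for l k
  have "p k - augment F (\<lambda>l. \<phi> l k) \<in> I" if "k \<in> Y" for k
  proof -
    have "hpart 0 (t k) (augment F (u k)) = augment F (\<lambda>l. hpart (bdeg F 0 l) (t k) (u k l))"
      unfolding augment_def by (rule hpart_mat_vec) (rule homog_aug)
    moreover have "hpart 0 (t k) (p k) = p k" using p[OF that] by (rule hpart_homog)
    moreover have "hpart 0 (t k) (p k - augment F (u k)) \<in> I"
      using homog_ideal u by (simp add: homog_ideal_def)
    ultimately show ?thesis by (simp add: hpart.diff \<phi>_def)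
  qed
  moreover have "homog_mat (basis F 0) (bdeg F 0) Y t \<phi>"
    by (simp add: homog_mat_def \<phi>_def homog_hpart)
  ultimately show ?thesis by blast
qed

locale chain_map = R: resolution F I + R': resolution F' I
  for F :: "('b, ('w, 'k::comm_ring_1) mpoly) based_complex"
    and F' :: "('c, ('w, 'k) mpoly) based_complex" and I +
  fixes \<phi> :: "nat \<Rightarrow> 'c \<Rightarrow> 'b \<Rightarrow> ('w, 'k) mpoly"
  assumes homog: "homog_mat (basis F' i) (bdeg F' i) (basis F i) (bdeg F i) (\<phi> i)"
    and augment: "k \<in> basis F 0 \<Longrightarrow> aug F k - augment F' (\<lambda>l. \<phi> 0 l k) \<in> I"
    and bdry: "l \<in> basis F' i \<Longrightarrow> k \<in> basis F (Suc i) \<Longrightarrow>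
      mat_mult (basis F' (Suc i)) (bdry F' i) (\<phi> (Suc i)) l k =
      mat_mult (basis F i) (\<phi> i) (bdry F i) l k"

lemma augment_mat_vec:
  "augment F' (mat_vec X \<phi> u) = (\<Sum>k\<in>X. augment F' (\<lambda>l. \<phi> l k) * u k)"
  unfolding augment_def mat_vec_mat_vec by (simp add: mat_vec_def mat_mult_def)

lemma augment_eq_sum: "augment F u = (\<Sum>k\<in>basis F 0. aug F k * u k)"
  by (simp add: augment_def mat_vec_def)

lemma (in resolution) augment_comparison:
  assumes "\<And>k. k \<in> basis F 0 \<Longrightarrow> aug F k - augment F' (\<lambda>l. \<phi> l k) \<in> I"
  shows "augment F u - augment F' (mat_vec (basis F 0) \<phi> u) \<in> I"
proof -
  have "augment F u - augment F' (mat_vec (basis F 0) \<phi> u) =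
      (\<Sum>k\<in>basis F 0. u k * (aug F k - augment F' (\<lambda>l. \<phi> l k)))"
    unfolding augment_mat_vec augment_eq_sum[of F] by (simp add: algebra_simps sum_subtractf)
  also have "\<dots> \<in> I" using assms by (intro ideal_sum ideal_mult)
  finally show ?thesis .
qed

definition chain_map_at ::
  "('b, ('w, 'k::comm_ring_1) mpoly) based_complex \<Rightarrow> ('c, ('w, 'k) mpoly) based_complex \<Rightarrow>
    ('w, 'k) mpoly set \<Rightarrow> nat \<Rightarrow> ('c \<Rightarrow> 'b \<Rightarrow> ('w, 'k) mpoly) \<Rightarrow> bool" where
  "chain_map_at F F' I i \<phi> \<longleftrightarrow> homog_mat (basis F' i) (bdeg F' i) (basis F i) (bdeg F i) \<phi> \<and>
    (\<forall>k\<in>basis F (Suc i). (\<lambda>l. mat_mult (basis F i) \<phi> (bdry F i) l k) \<in> cycles F' I i)"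

context
  fixes F :: "('b, ('w, 'k::comm_ring_1) mpoly) based_complex"
    and F' :: "('c, ('w, 'k) mpoly) based_complex" and I
  assumes resolutions: "resolution F I" "resolution F' I"
begin

interpretation R: resolution F I by (rule resolutions)
interpretation R': resolution F' I by (rule resolutions)

lemma chain_map_at_0_exists:
  "\<exists>\<phi>. chain_map_at F F' I 0 \<phi> \<and> (\<forall>k\<in>basis F 0. aug F k - augment F' (\<lambda>l. \<phi> l k) \<in> I)"
proof -
  obtain \<phi> where \<phi>: "homog_mat (basis F' 0) (bdeg F' 0) (basis F 0) (bdeg F 0) \<phi>"
      "\<And>k. k \<in> basis F 0 \<Longrightarrow> aug F k - augment F' (\<lambda>l. \<phi> l k) \<in> I"
    using R'.homog_lift_augment R.homog_aug by metis
  have "(\<lambda>l. mat_mult (basis F 0) \<phi> (bdry F 0) l k) \<in> cycles F' I 0" if "k \<in> basis F (Suc 0)" for k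
  proof -
    let ?u = "\<lambda>j. bdry F 0 j k"
    have "augment F ?u \<in> I"
      using R.bdry_column_cycle[OF that] by (simp add: cycles_0)
    then have "augment F ?u - (augment F ?u - augment F' (mat_vec (basis F 0) \<phi> ?u)) \<in> I"
      using R.augment_comparison[OF \<phi>(2)] by (rule R.ideal_diff)
    then show ?thesis by (simp add: cycles_0 mat_mult_def[abs_def])
  qed
  then show ?thesis using \<phi> unfolding chain_map_at_def by blast
qed

lemma chain_map_at_Suc_exists:
  assumes \<phi>: "chain_map_at F F' I i \<phi>"
  shows "\<exists>\<psi>. chain_map_at F F' I (Suc i) \<psi> \<and> (\<forall>l\<in>basis F' i. \<forall>k\<in>basis F (Suc i).
    mat_mult (basis F' (Suc i)) (bdry F' i) \<psi> l k = mat_mult (basis F i) \<phi> (bdry F i) l k)"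
proof -
  let ?B = "basis F (Suc i)" and ?B' = "basis F' (Suc i)"
  have "homog_mat (basis F' i) (bdeg F' i) ?B (bdeg F (Suc i)) (mat_mult (basis F i) \<phi> (bdry F i))"
    using \<phi> R.homog_bdry unfolding chain_map_at_def by (blast intro: homog_mat_mult)
  then obtain \<psi> where \<psi>: "homog_mat ?B' (bdeg F' (Suc i)) ?B (bdeg F (Suc i)) \<psi>"
      "\<And>l k. l \<in> basis F' i \<Longrightarrow> k \<in> ?B \<Longrightarrow>
        mat_mult ?B' (bdry F' i) \<psi> l k = mat_mult (basis F i) \<phi> (bdry F i) l k"
    using R'.homog_lift[of i ?B] \<phi> unfolding chain_map_at_def by metis
  have "mat_mult ?B' (bdry F' i) (mat_mult ?B \<psi> (bdry F (Suc i))) l k = 0"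
    if "k \<in> basis F (Suc (Suc i))" "l \<in> basis F' i" for k l
  proof -
    have "mat_mult ?B' (bdry F' i) (mat_mult ?B \<psi> (bdry F (Suc i))) l k =
        mat_mult ?B (mat_mult (basis F i) \<phi> (bdry F i)) (bdry F (Suc i)) l k"
      unfolding mat_mult_assoc[symmetric] using \<psi>(2) that by (intro mat_mult_cong) auto
    also have "\<dots> = mat_mult (basis F i) \<phi> (\<lambda>_ _. 0) l k"
      unfolding mat_mult_assoc using that by (intro mat_mult_cong) (auto simp: R.mat_mult_bdry_bdry)
    finally show ?thesis by (simp add: mat_mult_def mat_vec_def)
  qed
  then have "chain_map_at F F' I (Suc i) \<psi>"
    using \<psi>(1) by (simp add: chain_map_at_def cycles_Suc mat_mult_def)
  then show ?thesis using \<psi>(2) by blast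
qed

lemma chain_map_exists: "\<exists>\<phi>. chain_map F F' I \<phi>"
proof -
  define P where "P i \<phi> \<longleftrightarrow> chain_map_at F F' I i \<phi> \<and>
      (i = 0 \<longrightarrow> (\<forall>k\<in>basis F 0. aug F k - augment F' (\<lambda>l. \<phi> l k) \<in> I))" for i \<phi>
  define Q where "Q i \<phi> \<psi> \<longleftrightarrow> (\<forall>l\<in>basis F' i. \<forall>k\<in>basis F (Suc i).
      mat_mult (basis F' (Suc i)) (bdry F' i) \<psi> l k =
      mat_mult (basis F i) \<phi> (bdry F i) l k)" for i \<phi> \<psi>
  have "\<exists>\<phi>. \<forall>i. P i (\<phi> i) \<and> Q i (\<phi> i) (\<phi> (Suc i))"
  proof (rule dependent_nat_choice)
    show "\<exists>\<phi>. P 0 \<phi>" using chain_map_at_0_exists by (simp add: P_def)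
    show "\<exists>\<psi>. P (Suc i) \<psi> \<and> Q i \<phi> \<psi>" if "P i \<phi>" for \<phi> i
      using chain_map_at_Suc_exists[of i \<phi>] that by (simp add: P_def Q_def)
  qed
  then obtain \<phi> where "\<And>i. P i (\<phi> i)" "\<And>i. Q i (\<phi> i) (\<phi> (Suc i))" by blast
  then have "chain_map F F' I \<phi>"
    by unfold_locales (auto simp: P_def Q_def chain_map_at_def)
  then show ?thesis by blast
qed

end

lemma chain_map_comp:
  assumes "chain_map F F' I \<phi>" and "chain_map F' F'' I \<psi>"
  shows "chain_map F F'' I (\<lambda>i. mat_mult (basis F' i) (\<psi> i) (\<phi> i))"
proof -
  interpret \<phi>: chain_map F F' I \<phi> by fact
  interpret \<psi>: chain_map F' F'' I \<psi> by fact
  show ?thesis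
  proof
    show "homog_mat (basis F'' i) (bdeg F'' i) (basis F i) (bdeg F i)
        (mat_mult (basis F' i) (\<psi> i) (\<phi> i))" for i
      using \<psi>.homog \<phi>.homog by (rule homog_mat_mult)
    show "aug F k - augment F'' (\<lambda>l. mat_mult (basis F' 0) (\<psi> 0) (\<phi> 0) l k) \<in> I"
      if "k \<in> basis F 0" for k
    proof -
      let ?u = "\<lambda>l. \<phi> 0 l k"
      have "(aug F k - augment F' ?u) +
          (augment F' ?u - augment F'' (mat_vec (basis F' 0) (\<psi> 0) ?u)) \<in> I"
        using \<phi>.augment[OF that] \<phi>.R'.augment_comparison[OF \<psi>.augment] by (rule \<phi>.R.ideal_add)
      then show ?thesis by (simp add: mat_mult_def[abs_def])
    qed
    show "mat_mult (basis F'' (Suc i)) (bdry F'' i)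
             (mat_mult (basis F' (Suc i)) (\<psi> (Suc i)) (\<phi> (Suc i))) l k =
        mat_mult (basis F i) (mat_mult (basis F' i) (\<psi> i) (\<phi> i)) (bdry F i) l k"
      if lk: "l \<in> basis F'' i" "k \<in> basis F (Suc i)" for i l k
    proof -
      have "mat_mult (basis F'' (Suc i)) (bdry F'' i)
               (mat_mult (basis F' (Suc i)) (\<psi> (Suc i)) (\<phi> (Suc i))) l k =
          mat_mult (basis F' (Suc i)) (mat_mult (basis F' i) (\<psi> i) (bdry F' i)) (\<phi> (Suc i)) l k"
        unfolding mat_mult_assoc[symmetric] using \<psi>.bdry lk by (intro mat_mult_cong) auto
      also have "\<dots> = mat_mult (basis F' i) (\<psi> i) (mat_mult (basis F i) (\<phi> i) (bdry F i)) l k"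
        unfolding mat_mult_assoc using \<phi>.bdry lk by (intro mat_mult_cong) auto
      finally show ?thesis by (simp add: mat_mult_assoc)
    qed
  qed
qed

definition pre_homotopy ::
  "('b, 's::comm_ring_1) based_complex \<Rightarrow> (nat \<Rightarrow> 'b \<Rightarrow> 'b \<Rightarrow> 's) \<Rightarrow> nat \<Rightarrow> 'b \<Rightarrow> 'b \<Rightarrow> 's" where
  "pre_homotopy F h i = (case i of 0 \<Rightarrow> (\<lambda>_ _. 0) | Suc j \<Rightarrow> mat_mult (basis F j) (h j) (bdry F j))"

definition homotopy_at ::
  "('b, ('w, 'k::comm_ring_1) mpoly) based_complex \<Rightarrow> (nat \<Rightarrow> 'b \<Rightarrow> 'b \<Rightarrow> ('w, 'k) mpoly) \<Rightarrow> nat \<Rightarrow>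
    ('b \<Rightarrow> 'b \<Rightarrow> ('w, 'k) mpoly) \<Rightarrow> ('b \<Rightarrow> 'b \<Rightarrow> ('w, 'k) mpoly) \<Rightarrow> bool" where
  "homotopy_at F \<theta> i c h \<longleftrightarrow> homog_mat (basis F (Suc i)) (bdeg F (Suc i)) (basis F i) (bdeg F i) h \<and>
    (\<forall>l\<in>basis F i. \<forall>k\<in>basis F i.
      \<theta> i l k = unit_vec k l + c l k + mat_mult (basis F (Suc i)) (bdry F i) h l k)"

context
  fixes F :: "('b, ('w, 'k::comm_ring_1) mpoly) based_complex" and I \<theta>
  assumes chain_map: "chain_map F F I \<theta>"
begin

interpretation \<theta>: chain_map F F I \<theta> by (rule chain_map)

lemma homotopy_at_exists:
  assumes c: "homog_mat (basis F i) (bdeg F i) (basis F i) (bdeg F i) c"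
    and cyc: "\<And>k. k \<in> basis F i \<Longrightarrow> (\<lambda>l. \<theta> i l k) - unit_vec k - (\<lambda>l. c l k) \<in> cycles F I i"
  shows "\<exists>h. homotopy_at F \<theta> i c h"
proof -
  have "homog_mat (basis F i) (bdeg F i) (basis F i) (bdeg F i) (\<lambda>l k. \<theta> i l k - unit_vec k l - c l k)"
    using \<theta>.homog[of i] c by (auto simp: homog_mat_def unit_vec_def intro!: homog_diff)
  from \<theta>.R.homog_lift[OF this] cyc obtain h where
    h: "homog_mat (basis F (Suc i)) (bdeg F (Suc i)) (basis F i) (bdeg F i) h"
      "\<forall>l\<in>basis F i. \<forall>k\<in>basis F i.
        \<theta> i l k - unit_vec k l - c l k = mat_mult (basis F (Suc i)) (bdry F i) h l k"
    by (auto simp: fun_diff_def)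
  have "\<theta> i l k = unit_vec k l + c l k + mat_mult (basis F (Suc i)) (bdry F i) h l k"
    if "l \<in> basis F i" "k \<in> basis F i" for l k
    using h(2) that by (simp add: algebra_simps)
  then show ?thesis using h(1) unfolding homotopy_at_def by blast
qed

lemma homotopy_at_0_exists: "\<exists>h. homotopy_at F \<theta> 0 (\<lambda>_ _. 0) h"
proof (rule homotopy_at_exists)
  fix k assume k: "k \<in> basis F 0"
  have "augment F (unit_vec k) = aug F k"
    using k \<theta>.R.finite_basis by (simp add: augment_def mat_vec_unit_vec)
  then have "augment F ((\<lambda>l. \<theta> 0 l k) - unit_vec k) = 0 - (aug F k - augment F (\<lambda>l. \<theta> 0 l k))"
    by (simp add: augment_def mat_vec.diff)
  also have "\<dots> \<in> I" by (rule \<theta>.R.ideal_diff[OF \<theta>.R.ideal_zero \<theta>.augment[OF k]])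
  finally show "(\<lambda>l. \<theta> 0 l k) - unit_vec k - (\<lambda>l. 0) \<in> cycles F I 0"
    by (simp add: cycles_0 fun_diff_def)
qed (simp add: homog_mat_def)

lemma homotopy_at_Suc_exists:
  assumes h: "homotopy_at F \<theta> i c h"
    and c: "\<And>l k. l \<in> basis F i \<Longrightarrow> k \<in> basis F (Suc i) \<Longrightarrow> mat_mult (basis F i) c (bdry F i) l k = 0"
  shows "\<exists>h'. homotopy_at F \<theta> (Suc i) (mat_mult (basis F i) h (bdry F i)) h'"
proof (rule homotopy_at_exists)
  let ?B = "basis F i" and ?B' = "basis F (Suc i)" and ?D = "bdry F i"
  show "homog_mat ?B' (bdeg F (Suc i)) ?B' (bdeg F (Suc i)) (mat_mult ?B h ?D)"
    using h \<theta>.R.homog_bdry unfolding homotopy_at_def by (blast intro: homog_mat_mult)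
  fix k assume k: "k \<in> ?B'"
  have "bd F i ((\<lambda>l. \<theta> (Suc i) l k) - unit_vec k - (\<lambda>l. mat_mult ?B h ?D l k)) l = 0"
    if l: "l \<in> ?B" for l
  proof -
    have "mat_mult ?B' ?D (\<theta> (Suc i)) l k = mat_mult ?B (\<theta> i) ?D l k"
      using \<theta>.bdry l k by blast
    also have "\<dots> = mat_mult ?B (\<lambda>l k. unit_vec k l + c l k + mat_mult ?B' ?D h l k) ?D l k"
      using h l by (intro mat_mult_cong) (auto simp: homotopy_at_def)
    also have "\<dots> = ?D l k + mat_mult ?B' ?D (mat_mult ?B h ?D) l k"
      using c l k by (simp add: mat_mult_add_left mat_mult_assoc)
        (simp add: mat_mult_def mat_vec_unit_vec_left \<theta>.R.finite_basis)
    finally show ?thesis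
      using k \<theta>.R.finite_basis by (simp add: mat_vec.diff mat_vec_unit_vec mat_mult_def)
  qed
  then show "(\<lambda>l. \<theta> (Suc i) l k) - unit_vec k - (\<lambda>l. mat_mult ?B h ?D l k) \<in> cycles F I (Suc i)"
    by (simp add: cycles_Suc)
qed

lemma homotopic_id:
  "\<exists>h. \<forall>i. homotopy_at F \<theta> i (pre_homotopy F h i) (h i)"
proof -
  define P where "P i h \<longleftrightarrow> (\<exists>c. homotopy_at F \<theta> i c h \<and> (i = 0 \<longrightarrow> c = (\<lambda>_ _. 0)) \<and>
      (\<forall>l\<in>basis F i. \<forall>k\<in>basis F (Suc i). mat_mult (basis F i) c (bdry F i) l k = 0))" for i h
  define Q where "Q i h h' \<longleftrightarrow> homotopy_at F \<theta> (Suc i) (mat_mult (basis F i) h (bdry F i)) h'"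
    for i h h'
  have "\<exists>h. \<forall>i. P i (h i) \<and> Q i (h i) (h (Suc i))"
  proof (rule dependent_nat_choice)
    show "\<exists>h. P 0 h" using homotopy_at_0_exists by (auto simp: P_def mat_mult_def mat_vec_def)
  next
    fix h i assume "P i h"
    then obtain h' where h': "homotopy_at F \<theta> (Suc i) (mat_mult (basis F i) h (bdry F i)) h'"
      using homotopy_at_Suc_exists unfolding P_def by blast
    have "mat_mult (basis F (Suc i)) (mat_mult (basis F i) h (bdry F i)) (bdry F (Suc i)) l k = 0"
      if "k \<in> basis F (Suc (Suc i))" for l k
    proof -
      have "mat_mult (basis F i) h (mat_mult (basis F (Suc i)) (bdry F i) (bdry F (Suc i))) l k =
          mat_mult (basis F i) h (\<lambda>_ _. 0) l k"
        using \<theta>.R.mat_mult_bdry_bdry that by (intro mat_mult_cong) auto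
      then show ?thesis by (simp add: mat_mult_assoc) (simp add: mat_mult_def mat_vec_def)
    qed
    then show "\<exists>h'. P (Suc i) h' \<and> Q i h h'"
      using h' unfolding P_def Q_def by blast
  qed
  then obtain h where PQ: "\<And>i. P i (h i)" "\<And>i. Q i (h i) (h (Suc i))" by blast
  have "homotopy_at F \<theta> i (pre_homotopy F h i) (h i)" for i
    using PQ(1)[of 0] PQ(2) by (cases i) (auto simp: P_def Q_def pre_homotopy_def)
  then show ?thesis by blast
qed

end

section \<open>Betti numbers of minimal resolutions\<close>

lemma (in vector_space) dim_eq_dim_add_card:
  assumes B: "B \<subseteq> Z" "B \<subseteq> span E" "finite E" "subspace B"
    and K: "finite K" "w ` K \<subseteq> Z" "Z \<subseteq> span (B \<union> w ` K)"
    and sep: "\<And>k. k \<in> K \<Longrightarrow> \<exists>N. subspace N \<and> B \<subseteq> N \<and> w ` (K - {k}) \<subseteq> N \<and> w k \<notin> N"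
  shows "dim Z = dim B + card K"
proof -
  obtain b where b: "b \<subseteq> B" "independent b" "B \<subseteq> span b" "card b = dim B"
    by (rule basis_exists)
  have "finite b" using independent_span_bound[OF B(3) b(2)] b(1) B(2) by blast
  have "independent (b \<union> w ` L) \<and> card (b \<union> w ` L) = card b + card L" if "finite L" "L \<subseteq> K" for L
    using that
  proof (induction L)
    case empty
    then show ?case using b(2) by simp
  next
    case (insert k L)
    obtain N where N: "subspace N" "B \<subseteq> N" "w ` (K - {k}) \<subseteq> N" "w k \<notin> N"
      using sep insert.prems by blast
    then have "span (b \<union> w ` L) \<subseteq> N"
      using b(1) insert by (intro span_minimal) blast+
    then have notin: "w k \<notin> span (b \<union> w ` L)" using N(4) by blast
    then have "w k \<notin> b \<union> w ` L" using span_base by meson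
    then show ?case
      using insert \<open>finite b\<close> independent_insertI[OF notin] by simp
  qed
  from this[OF K(1) order_refl] have "independent (b \<union> w ` K)" "card (b \<union> w ` K) = dim B + card K"
    using b(4) by simp_all
  moreover have "Z \<subseteq> span (b \<union> w ` K)"
  proof -
    have "B \<union> w ` K \<subseteq> span (b \<union> w ` K)"
      using b(3) span_mono[of b "b \<union> w ` K"] span_superset[of "b \<union> w ` K"] by blast
    then show ?thesis using K(3) span_minimal[OF _ subspace_span] by blast
  qed
  moreover have "b \<union> w ` K \<subseteq> Z" using b(1) B(1) K(2) by blast
  ultimately show ?thesis using dim_unique by metis
qed

interpretation kvec: vector_space "fscale :: 'k::field \<Rightarrow> ('b \<Rightarrow> 'k) \<Rightarrow> 'b \<Rightarrow> 'k"
  by standard (simp_all add: fscale_def fun_eq_iff algebra_simps)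

lemma kdim_eq_dim: "kdim V = kvec.dim V"
  by (simp add: kdim_def fscale_def[abs_def])

lemma free_mod_subset_span: "(free_mod n :: (nat \<Rightarrow> 'k::field) set) \<subseteq> fmod.span (unit_vec ` {..<n})"
proof
  fix f :: "nat \<Rightarrow> 'k" assume "f \<in> free_mod n"
  then have "f = (\<Sum>k<n. fscale (f k) (unit_vec k))"
    by (auto simp: fun_eq_iff sum_fun_apply fscale_apply unit_vec_def free_mod_def not_less
        if_distrib cong: if_cong)
  also have "\<dots> \<in> fmod.span (unit_vec ` {..<n})"
    by (intro fmod.span_sum fmod.span_scale) (intro fmod.span_base imageI)
  finally show "f \<in> fmod.span (unit_vec ` {..<n})" .
qed

lemma subspace_strand: "fmod.subspace (strand E i j)"
  by (rule fmod.subspaceI) (auto simp: strand_def free_mod_def fscale_apply)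

lemma residue_mat_vec_degree:
  assumes "homog_mat X s Y t A" "l \<in> X" "s l \<noteq> j" and "\<And>k. k \<in> Y \<Longrightarrow> t k \<noteq> j \<Longrightarrow> f k = 0"
  shows "mat_vec Y (residue A) f l = 0"
  unfolding mat_vec_def using assms residue_homog_mat by (intro sum.neutral) fastforce

lemma strand_map_eq:
  "strand_map E i f = trunc (rnk E i) (mat_vec {..<rnk E (Suc i)} (residue (diff E i)) f)"
  by (simp add: strand_map_def mat_app_eq_trunc residue_def[abs_def])

lemma strand_iff:
  "f \<in> strand E i j \<longleftrightarrow>
    f \<in> free_mod (rnk E i) \<and> (\<forall>k<rnk E i. shift E i k \<noteq> j \<longrightarrow> f k = 0)"
  by (simp add: strand_def)

lemma tor_cycles_iff:
  "f \<in> tor_cycles E i j \<longleftrightarrow> f \<in> strand E i j \<and>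
    (\<forall>i'. i = Suc i' \<longrightarrow> (\<forall>l<rnk E i'. mat_vec {..<rnk E i} (residue (diff E i')) f l = 0))"
  by (cases i) (auto simp: tor_cycles_def strand_map_eq trunc_def fun_eq_iff)

lemma residue_mat_mult_apply:
  "mat_vec X (residue A) (mat_vec Y (residue C) f) l = mat_vec Y (residue (mat_mult X A C)) f l"
  by (simp add: mat_vec_mat_vec residue_mat_mult)

lemma const_coeff_unit_vec:
  "const_coeff (unit_vec k l :: ('w, 'k::comm_ring_1) mpoly) = unit_vec k l"
  by (simp add: unit_vec_def const_coeff.zero)

locale minimal_comparison =
  F: minimal_resolution F I + to_min: chain_map "seq_complex E g" F I \<phi> +
  from_min: chain_map F "seq_complex E g" I \<psi>
  for F :: "('b, ('w, 'k::field) mpoly) based_complex" and I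
    and E :: "('w, 'k) mpoly graded_free_seq" and g \<phi> \<psi>
begin

definition tor_class :: "nat \<Rightarrow> 'b \<Rightarrow> nat \<Rightarrow> 'k" where
  "tor_class i b = trunc (rnk E i) (\<lambda>l. residue (\<psi> i) l b)"

definition tor_coord :: "nat \<Rightarrow> 'b \<Rightarrow> (nat \<Rightarrow> 'k) \<Rightarrow> 'k" where
  "tor_coord i b f = mat_vec {..<rnk E i} (residue (\<phi> i)) f b"

lemma residue_bdry: "l \<in> basis F i \<Longrightarrow> k \<in> basis F (Suc i) \<Longrightarrow> residue (bdry F i) l k = 0"
  by (simp add: residue_def F.minimal)

lemma tor_coord_tor_class:
  assumes "b \<in> basis F i" "b' \<in> basis F i"
  shows "tor_coord i b (tor_class i b') = unit_vec b' b"
proof -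
  define \<theta> where "\<theta> i = mat_mult {..<rnk E i} (\<phi> i) (\<psi> i)" for i
  have "chain_map F F I \<theta>"
    using chain_map_comp[OF from_min.chain_map_axioms to_min.chain_map_axioms]
    by (simp add: \<theta>_def[abs_def])
  then obtain h where h: "\<And>i. homotopy_at F \<theta> i (pre_homotopy F h i) (h i)"
    using homotopic_id by blast
  have "residue (mat_mult (basis F (Suc i)) (bdry F i) (h i)) b b' = 0"
    using assms residue_bdry by (simp add: residue_mat_mult mat_mult_def mat_vec_def)
  moreover have "residue (pre_homotopy F h i) b b' = 0"
    using assms residue_bdry
    by (cases i)
      (simp_all add: pre_homotopy_def residue_mat_mult,
        simp_all add: residue_def mat_mult_def mat_vec_def const_coeff.zero)
  ultimately have "residue (\<theta> i) b b' = unit_vec b' b"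
    using h[of i] assms by (simp add: homotopy_at_def residue_def const_coeff.add
        const_coeff_unit_vec)
  then show ?thesis
    by (simp add: tor_coord_def tor_class_def mat_vec_trunc \<theta>_def residue_mat_mult mat_mult_def)
qed

lemma tor_coord_strand_map:
  assumes "b \<in> basis F i"
  shows "tor_coord i b (strand_map E i f) = 0"
proof -
  have "residue (mat_mult {..<rnk E i} (\<phi> i) (diff E i)) b k = 0" if "k < rnk E (Suc i)" for k
  proof -
    have "mat_mult {..<rnk E i} (\<phi> i) (diff E i) b k =
        mat_mult (basis F (Suc i)) (bdry F i) (\<phi> (Suc i)) b k"
      using to_min.bdry[OF assms, of k] that by simp
    then have "residue (mat_mult {..<rnk E i} (\<phi> i) (diff E i)) b k =
        residue (mat_mult (basis F (Suc i)) (bdry F i) (\<phi> (Suc i))) b k"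
      by (simp add: residue_def)
    then show ?thesis
      using residue_bdry[OF assms] by (simp add: residue_mat_mult mat_mult_def mat_vec_def)
  qed
  then show ?thesis
    by (simp add: tor_coord_def strand_map_eq mat_vec_trunc residue_mat_mult_apply)
      (simp add: mat_vec_def)
qed

lemma tor_coord_degree:
  "f \<in> strand E i j \<Longrightarrow> b \<in> basis F i \<Longrightarrow> bdeg F i b \<noteq> j \<Longrightarrow> tor_coord i b f = 0"
  unfolding tor_coord_def
  by (rule residue_mat_vec_degree[of "basis F i" "bdeg F i" _ "shift E i"])
    (use to_min.homog[of i] in \<open>auto simp: strand_def\<close>)

lemma tor_class_in_tor_cycles:
  assumes b: "b \<in> basis F i"
  shows "tor_class i b \<in> tor_cycles E i (bdeg F i b)"
proof -
  have "residue (\<psi> i) l b = 0" if "l < rnk E i" "shift E i l \<noteq> bdeg F i b" for l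
    using residue_homog_mat[OF from_min.homog] b that by simp
  then have "tor_class i b \<in> strand E i (bdeg F i b)"
    by (simp add: tor_class_def strand_iff) (simp add: trunc_def)
  moreover have "mat_vec {..<rnk E (Suc i')} (residue (diff E i')) (tor_class (Suc i') b) l = 0"
    if "i = Suc i'" "l < rnk E i'" for i' l
  proof -
    have "mat_vec {..<rnk E (Suc i')} (residue (diff E i')) (tor_class (Suc i') b) l =
        residue (mat_mult {..<rnk E (Suc i')} (diff E i') (\<psi> (Suc i'))) l b"
      by (simp add: tor_class_def mat_vec_trunc residue_mat_mult mat_mult_def)
    also have "\<dots> = residue (mat_mult (basis F i') (\<psi> i') (bdry F i')) l b"
      using from_min.bdry[of l i' b] b that by (simp add: residue_def)
    also have "\<dots> = 0"
      using residue_bdry b that by (simp add: residue_mat_mult mat_mult_def mat_vec_def)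
    finally show ?thesis .
  qed
  ultimately show ?thesis by (auto simp: tor_cycles_iff)
qed

lemma residue_pre_homotopy_tor_cycle:
  assumes "z \<in> tor_cycles E i j"
  shows "mat_vec {..<rnk E i} (residue (pre_homotopy (seq_complex E g) h i)) z l = 0"
proof (cases i)
  case 0
  then show ?thesis by (simp add: pre_homotopy_def mat_vec_def residue_def const_coeff.zero)
next
  case (Suc i')
  then have "mat_vec {..<rnk E i} (residue (pre_homotopy (seq_complex E g) h i)) z l =
      mat_vec {..<rnk E i'} (residue (h i')) (mat_vec {..<rnk E i} (residue (diff E i')) z) l"
    by (simp add: pre_homotopy_def residue_mat_mult_apply)
  then show ?thesis using assms Suc by (simp add: tor_cycles_iff mat_vec_def)
qed

lemma residue_homotopy_tor_cycle:
  assumes "homotopy_at (seq_complex E g) \<theta> i (pre_homotopy (seq_complex E g) h i) (h i)"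
    and z: "z \<in> tor_cycles E i j"
  shows "\<exists>y\<in>strand E (Suc i) j.
    trunc (rnk E i) (mat_vec {..<rnk E i} (residue (\<theta> i)) z) = z + strand_map E i y"
proof
  let ?r = "rnk E i" and ?pre = "pre_homotopy (seq_complex E g) h i"
  note h = assms(1)[unfolded homotopy_at_def, simplified]
  define y where "y = trunc (rnk E (Suc i)) (mat_vec {..<?r} (residue (h i)) z)"
  have z_strand: "z \<in> strand E i j" using z by (simp add: tor_cycles_iff)
  then have "mat_vec {..<?r} (residue (h i)) z l = 0"
    if "l < rnk E (Suc i)" "shift E (Suc i) l \<noteq> j" for l
    using h that
    by (intro residue_mat_vec_degree[of "{..<rnk E (Suc i)}" "shift E (Suc i)" _ "shift E i"])
      (auto simp: strand_iff)
  then show "y \<in> strand E (Suc i) j"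
    unfolding strand_iff y_def by (simp add: trunc_def free_mod_def)
  have "mat_vec {..<?r} (residue (\<theta> i)) z l = mat_vec {..<?r} (\<lambda>l k. unit_vec k l) z l +
      mat_vec {..<?r} (residue ?pre) z l +
      mat_vec {..<?r} (residue (mat_mult {..<rnk E (Suc i)} (diff E i) (h i))) z l" if "l < ?r" for l
    using h that
    by (simp add: mat_vec_def residue_def const_coeff.add const_coeff_unit_vec distrib_right
        sum.distrib)
  then have "mat_vec {..<?r} (residue (\<theta> i)) z l = z l + strand_map E i y l" if "l < ?r" for l
    using that residue_pre_homotopy_tor_cycle[OF z]
    by (simp add: mat_vec_unit_vec_left strand_map_eq trunc_def[of ?r] y_def mat_vec_trunc
        residue_mat_mult_apply)
  then show "trunc ?r (mat_vec {..<?r} (residue (\<theta> i)) z) = z + strand_map E i y"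
    using z_strand by (auto simp: trunc_def fun_eq_iff strand_iff free_mod_def strand_map_eq)
qed

text \<open>The homotopy from \<open>\<psi>\<phi>\<close> to the identity writes every cycle as a combination of the classes.\<close>

lemma tor_cycle_expansion:
  assumes z: "z \<in> tor_cycles E i j"
  shows "\<exists>y\<in>strand E (Suc i) j.
    z = (\<Sum>b | b \<in> basis F i \<and> bdeg F i b = j. fscale (tor_coord i b z) (tor_class i b)) -
      strand_map E i y"
proof -
  let ?X = "seq_complex E g" and ?r = "rnk E i"
  define \<theta> where "\<theta> i = mat_mult (basis F i) (\<psi> i) (\<phi> i)" for i
  have "chain_map ?X ?X I \<theta>"
    using chain_map_comp[OF to_min.chain_map_axioms from_min.chain_map_axioms]
    by (simp add: \<theta>_def[abs_def])
  then obtain h where "homotopy_at ?X \<theta> i (pre_homotopy ?X h i) (h i)"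
    using homotopic_id by blast
  then obtain y where y: "y \<in> strand E (Suc i) j"
      "trunc ?r (mat_vec {..<?r} (residue (\<theta> i)) z) = z + strand_map E i y"
    using residue_homotopy_tor_cycle[OF _ z] by blast
  have "mat_vec {..<?r} (residue (\<theta> i)) z = mat_vec (basis F i) (residue (\<psi> i)) (\<lambda>b. tor_coord i b z)"
    by (simp add: fun_eq_iff \<theta>_def tor_coord_def residue_mat_mult_apply[symmetric])
  then have "trunc ?r (mat_vec {..<?r} (residue (\<theta> i)) z) =
      (\<Sum>b\<in>basis F i. fscale (tor_coord i b z) (tor_class i b))"
    by (simp add: fun_eq_iff trunc_def tor_class_def sum_fun_apply fscale_apply mat_vec_def
        mult.commute)
  also have "\<dots> = (\<Sum>b | b \<in> basis F i \<and> bdeg F i b = j. fscale (tor_coord i b z) (tor_class i b))"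
    using z
    by (intro sum.mono_neutral_right) (auto simp: F.finite_basis tor_cycles_iff tor_coord_degree)
  finally show ?thesis
    using y by (intro bexI[of _ y]) (simp_all add: eq_diff_eq)
qed

lemma subspace_tor_boundaries: "fmod.subspace (tor_boundaries E i j)"
proof -
  have "module_hom fscale fscale (strand_map E i)"
    by standard (simp_all add: strand_map_eq fun_eq_iff trunc_def mat_vec.add mat_vec.scale
        fscale_apply)
  then show ?thesis
    unfolding tor_boundaries_def by (rule module_hom.subspace_image) (rule subspace_strand)
qed

lemma tor_boundaries_subset_tor_cycles: "tor_boundaries E i j \<subseteq> tor_cycles E i j"
proof
  fix x assume "x \<in> tor_boundaries E i j"
  then obtain y where y: "y \<in> strand E (Suc i) j" "x = strand_map E i y"
    by (auto simp: tor_boundaries_def)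
  have "mat_vec {..<rnk E (Suc i)} (residue (diff E i)) y l = 0"
    if "l < rnk E i" "shift E i l \<noteq> j" for l
    using that y(1) to_min.R.homog_bdry[of i]
    by (intro residue_mat_vec_degree[of "{..<rnk E i}" "shift E i" _ "shift E (Suc i)"])
      (auto simp: strand_iff)
  then have "x \<in> strand E i j"
    by (auto simp: y(2) strand_map_eq strand_iff) (simp add: trunc_def)
  moreover have "mat_vec {..<rnk E (Suc i')} (residue (diff E i')) (strand_map E (Suc i') y) l = 0"
    if "l < rnk E i'" for i' l
    using to_min.R.mat_mult_bdry_bdry[of l i'] that
    by (simp add: strand_map_eq mat_vec_trunc residue_mat_mult_apply)
      (simp add: mat_vec_def residue_def const_coeff.zero)
  ultimately show "x \<in> tor_cycles E i j" using y(2) by (auto simp: tor_cycles_iff)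
qed

lemma tor_cycles_subset_span:
  "tor_cycles E i j \<subseteq>
    fmod.span (tor_boundaries E i j \<union> tor_class i ` {b \<in> basis F i. bdeg F i b = j})"
proof
  let ?K = "{b \<in> basis F i. bdeg F i b = j}"
  let ?span = "fmod.span (tor_boundaries E i j \<union> tor_class i ` ?K)"
  fix z assume "z \<in> tor_cycles E i j"
  then obtain y where y: "y \<in> strand E (Suc i) j"
    and z: "z = (\<Sum>b\<in>?K. fscale (tor_coord i b z) (tor_class i b)) - strand_map E i y"
    using tor_cycle_expansion by blast
  have "strand_map E i y \<in> ?span"
    using y by (intro fmod.span_base) (simp add: tor_boundaries_def)
  moreover have "(\<Sum>b\<in>?K. fscale (tor_coord i b z) (tor_class i b)) \<in> ?span"
    by (intro fmod.span_sum fmod.span_scale) (auto intro: fmod.span_base)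
  ultimately show "z \<in> ?span"
    by (subst z) (rule fmod.span_diff)
qed

lemma tor_dim_eq_card: "tor_dim E i j = card {b \<in> basis F i. bdeg F i b = j}"
proof -
  let ?K = "{b \<in> basis F i. bdeg F i b = j}"
  have "kvec.dim (tor_cycles E i j) = kvec.dim (tor_boundaries E i j) + card ?K"
  proof (rule kvec.dim_eq_dim_add_card)
    show "tor_boundaries E i j \<subseteq> fmod.span (unit_vec ` {..<rnk E i})"
      using free_mod_subset_span[of "rnk E i"] by (auto simp: tor_boundaries_def strand_map_eq)
    show "tor_class i ` ?K \<subseteq> tor_cycles E i j" using tor_class_in_tor_cycles by auto
    fix b assume b: "b \<in> ?K"
    show "\<exists>N. fmod.subspace N \<and> tor_boundaries E i j \<subseteq> N \<and>
        tor_class i ` (?K - {b}) \<subseteq> N \<and> tor_class i b \<notin> N"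
    proof (intro exI conjI)
      show "fmod.subspace {f. tor_coord i b f = 0}"
        by (rule fmod.subspaceI)
          (simp_all add: tor_coord_def mat_vec.zero mat_vec.add mat_vec.scale fscale_apply)
      show "tor_boundaries E i j \<subseteq> {f. tor_coord i b f = 0}"
        using b tor_coord_strand_map by (auto simp: tor_boundaries_def)
      show "tor_class i ` (?K - {b}) \<subseteq> {f. tor_coord i b f = 0}"
        "tor_class i b \<notin> {f. tor_coord i b f = 0}"
        using b by (auto simp: tor_coord_tor_class unit_vec_def)
    qed
  qed (simp_all add: F.finite_basis subspace_tor_boundaries tor_boundaries_subset_tor_cycles
      tor_cycles_subset_span)
  then show ?thesis by (simp add: tor_dim_def kdim_eq_dim)
qed

end

theorem betti_eq_card:
  fixes F :: "('b, ('w::finite, 'k::field) mpoly) based_complex"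
  assumes F: "minimal_resolution F I" and E: "graded_free_resolution E I"
  shows "betti I i j = card {b \<in> basis F i. bdeg F i b = j}"
proof -
  define E' where "E' = (SOME E. graded_free_resolution E I)"
  interpret F: minimal_resolution F I by (rule F)
  have "graded_free_resolution E' I" unfolding E'_def using E by (rule someI)
  then obtain g where X: "resolution (seq_complex E' g) I"
    using graded_free_resolution_iff[OF F.homog_ideal] by blast
  obtain \<phi> \<psi> where "chain_map (seq_complex E' g) F I \<phi>" "chain_map F (seq_complex E' g) I \<psi>"
    using chain_map_exists X F.resolution_axioms by metis
  then interpret minimal_comparison F I E' g \<phi> \<psi>
    by (intro minimal_comparison.intro F)
  show ?thesis by (simp add: betti_def E'_def[symmetric] tor_dim_eq_card)
qed

section \<open>The tensor product of two resolutions\<close>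

definition tensor_complex ::
  "('b, 's::comm_ring_1) based_complex \<Rightarrow> ('c, 's) based_complex \<Rightarrow>
    (nat \<times> 'b \<times> 'c, 's) based_complex" where
  "tensor_complex F F' =
    \<lparr>basis = \<lambda>n. SIGMA p:{..n}. basis F p \<times> basis F' (n - p),
     bdeg = \<lambda>n (p, k, l). bdeg F p k + bdeg F' (n - p) l,
     bdry = \<lambda>n (p, k, l) (p', k', l').
       (if p' = Suc p \<and> l' = l then bdry F p k k' else 0) +
       (if p' = p \<and> k' = k then (-1) ^ p * bdry F' (n - p) l l' else 0),
     aug = \<lambda>(p, k, l). aug F k * aug F' l\<rparr>"

definition total_bd ::
  "('b, 's::comm_ring_1) based_complex \<Rightarrow> ('c, 's) based_complex \<Rightarrow> nat \<Rightarrow>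
    (nat \<times> 'b \<times> 'c \<Rightarrow> 's) \<Rightarrow> nat \<times> 'b \<times> 'c \<Rightarrow> 's" where
  "total_bd F F' n u = (\<lambda>(p, k, l). bd F p (\<lambda>k'. u (Suc p, k', l)) k +
     (-1) ^ p * bd F' (n - p) (\<lambda>l'. u (p, k, l')) l)"

lemma in_basis_tensor_iff:
  "(p, k, l) \<in> basis (tensor_complex F F') n \<longleftrightarrow> p \<le> n \<and> k \<in> basis F p \<and> l \<in> basis F' (n - p)"
  by (auto simp: tensor_complex_def)

lemma bd_tensor_eq_total_bd:
  assumes fin: "finite (basis (tensor_complex F F') (Suc n))"
    and x: "x \<in> basis (tensor_complex F F') n"
  shows "bd (tensor_complex F F') n u x = total_bd F F' n u x"
proof -
  obtain p k l where x_eq: "x = (p, k, l)" by (cases x)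
  have pkl: "p \<le> n" "k \<in> basis F p" "l \<in> basis F' (n - p)" using x
    by (auto simp: x_eq in_basis_tensor_iff)
  let ?B = "basis (tensor_complex F F') (Suc n)"
  let ?left = "\<lambda>(p', k', l'). (if p' = Suc p \<and> l' = l then bdry F p k k' else 0) * u (p', k', l')"
  let ?right = "\<lambda>(p', k', l').
    (if p' = p \<and> k' = k then (-1) ^ p * bdry F' (n - p) l l' else 0) * u (p', k', l')"
  have "bd (tensor_complex F F') n u x = (\<Sum>y\<in>?B. ?left y) + (\<Sum>y\<in>?B. ?right y)"
    unfolding mat_vec_def sum.distrib[symmetric]
    by (rule sum.cong) (auto simp: tensor_complex_def x_eq distrib_right)
  also have "(\<Sum>y\<in>?B. ?left y) = (\<Sum>y\<in>(\<lambda>k'. (Suc p, k', l)) ` basis F (Suc p). ?left y)"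
    by (rule sum.mono_neutral_right) (use pkl fin in \<open>auto simp: in_basis_tensor_iff\<close>)
  also have "\<dots> = bd F p (\<lambda>k'. u (Suc p, k', l)) k"
    by (subst sum.reindex) (auto simp: inj_on_def mat_vec_def)
  also have "(\<Sum>y\<in>?B. ?right y) = (\<Sum>y\<in>(\<lambda>l'. (p, k, l')) ` basis F' (Suc (n - p)). ?right y)"
    by (rule sum.mono_neutral_right) (use pkl fin in \<open>auto simp: in_basis_tensor_iff Suc_diff_le\<close>)
  also have "\<dots> = (-1) ^ p * bd F' (n - p) (\<lambda>l'. u (p, k, l')) l"
    by (subst sum.reindex) (auto simp: inj_on_def mat_vec_def sum_distrib_left mult.assoc)
  finally show ?thesis by (simp add: total_bd_def x_eq)
qed

interpretation total_bd: additive "total_bd F F' n" for F F' n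
  by standard (auto simp: total_bd_def mat_vec_def fun_eq_iff distrib_left sum.distrib)

locale tensor_resolution =
  R: cyclic_minimal_resolution F I z + R': cyclic_minimal_resolution F' I' z'
  for F :: "('b, ('w, 'k::comm_ring_1) mpoly) based_complex" and I z
    and F' :: "('c, ('w, 'k) mpoly) based_complex" and I' z' +
  assumes tor_vanishes: "(\<And>l. l \<in> basis F i \<Longrightarrow> bd F i u l \<in> I') \<Longrightarrow>
    \<exists>w. \<forall>k\<in>basis F (Suc i). u k - bd F (Suc i) w k \<in> I'"
begin

abbreviation "T \<equiv> tensor_complex F F'"

lemma finite_basis_tensor: "finite (basis T n)"
  using R.finite_basis R'.finite_basis by (simp add: tensor_complex_def)

lemmas bd_tensor = bd_tensor_eq_total_bd[OF finite_basis_tensor]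

lemma total_bd_total_bd:
  assumes "x \<in> basis T n"
  shows "total_bd F F' n (total_bd F F' (Suc n) u) x = 0"
proof -
  obtain p k l where x: "x = (p, k, l)" by (cases x)
  have pkl: "p \<le> n" "k \<in> basis F p" "l \<in> basis F' (n - p)" using assms
    by (auto simp: x in_basis_tensor_iff)
  let ?q = "n - p"
  let ?cross = "bd F p (\<lambda>k'. bd F' ?q (\<lambda>l'. u (Suc p, k', l')) l) k"
  have "bd F p (\<lambda>k'. total_bd F F' (Suc n) u (Suc p, k', l)) k =
      bd F p (bd F (Suc p) (\<lambda>k'. u (Suc (Suc p), k', l))) k + (-1) ^ Suc p * ?cross"
    by (simp add: total_bd_def mat_vec_def distrib_left sum.distrib sum_distrib_left mult_ac)
  also have "\<dots> = - ((-1) ^ p * ?cross)" using R.bd_bd[OF pkl(2)] by simp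
  finally have left: "bd F p (\<lambda>k'. total_bd F F' (Suc n) u (Suc p, k', l)) k =
      - ((-1) ^ p * ?cross)" .
  have "bd F' ?q (\<lambda>l'. total_bd F F' (Suc n) u (p, k, l')) l =
      bd F' ?q (\<lambda>l'. bd F p (\<lambda>k'. u (Suc p, k', l')) k) l +
      (-1) ^ p * bd F' ?q (bd F' (Suc ?q) (\<lambda>l'. u (p, k, l'))) l"
    using pkl(1) by (simp add: total_bd_def mat_vec_def Suc_diff_le distrib_left sum.distrib
        sum_distrib_left mult_ac)
  also have "\<dots> = ?cross" using R'.bd_bd[OF pkl(3)] by (subst mat_vec_swap) simp
  finally show ?thesis using left by (simp add: total_bd_def x)
qed

lemma column_in_boundaries:
  assumes cycle: "\<And>x. x \<in> basis T n \<Longrightarrow> total_bd F F' n u x = 0" and "c \<le> n"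
    and beyond: "\<And>p k l. (p, k, l) \<in> basis T (Suc n) \<Longrightarrow> c < p \<Longrightarrow> u (p, k, l) = 0"
    and k: "k \<in> basis F c"
  shows "(\<lambda>l. u (c, k, l)) \<in> boundaries F' (Suc (n - c))"
proof -
  let ?q = "n - c"
  have "bd F' ?q (\<lambda>l. u (c, k, l)) l = 0" if l: "l \<in> basis F' ?q" for l
  proof -
    have "bd F c (\<lambda>k'. u (Suc c, k', l)) k = 0"
      unfolding mat_vec_def using beyond l \<open>c \<le> n\<close>
      by (intro sum.neutral) (simp add: in_basis_tensor_iff)
    then have "(-1) ^ c * bd F' ?q (\<lambda>l. u (c, k, l)) l = 0"
      using cycle[of "(c, k, l)"] k l \<open>c \<le> n\<close> by (simp add: in_basis_tensor_iff total_bd_def)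
    then have "(-1) ^ c * ((-1) ^ c * bd F' ?q (\<lambda>l. u (c, k, l)) l) = 0" by simp
    then show ?thesis by (simp add: mult.assoc[symmetric])
  qed
  then show ?thesis by (simp add: cycles_Suc flip: R'.cycles_eq_boundaries)
qed

text \<open>Modulo boundaries, a cycle that vanishes beyond column \<open>c\<close> can be made to vanish in column \<open>c\<close>
  too: for \<open>c \<le> n\<close> because \<open>F'\<close> is exact, and in the last column because of \<open>tor_vanishes\<close>.\<close>

lemma clear_column:
  assumes cycle: "\<And>x. x \<in> basis T n \<Longrightarrow> total_bd F F' n u x = 0" and "c \<le> n"
    and beyond: "\<And>p k l. (p, k, l) \<in> basis T (Suc n) \<Longrightarrow> c < p \<Longrightarrow> u (p, k, l) = 0"
  shows "\<exists>w. \<forall>p k l. (p, k, l) \<in> basis T (Suc n) \<longrightarrow> c \<le> p \<longrightarrow>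
    u (p, k, l) = total_bd F F' (Suc n) w (p, k, l)"
proof -
  obtain v where v: "\<And>k l. k \<in> basis F c \<Longrightarrow> l \<in> basis F' (Suc (n - c)) \<Longrightarrow>
      u (c, k, l) = bd F' (Suc (n - c)) (v k) l"
    using column_in_boundaries[OF assms] unfolding boundaries_def by simp metis
  define w where "w = (\<lambda>(p, k, l). if p = c then (-1) ^ c * v k l else 0)"
  have "u (p, k, l) = total_bd F F' (Suc n) w (p, k, l)"
    if "(p, k, l) \<in> basis T (Suc n)" "c \<le> p" for p k l
  proof (cases "p = c")
    case True
    then show ?thesis
      using v that \<open>c \<le> n\<close>
      by (simp add: in_basis_tensor_iff total_bd_def w_def Suc_diff_le mat_vec_mult
          mult.assoc[symmetric])
        (simp add: mat_vec_def)
  next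
    case False
    then show ?thesis using beyond that by (simp add: total_bd_def w_def mat_vec_def)
  qed
  then show ?thesis by blast
qed

lemma clear_last_column:
  assumes cycle: "\<And>x. x \<in> basis T n \<Longrightarrow> total_bd F F' n u x = 0"
  shows "\<exists>w. \<forall>p k l. (p, k, l) \<in> basis T (Suc n) \<longrightarrow> Suc n \<le> p \<longrightarrow>
      u (p, k, l) = total_bd F F' (Suc n) w (p, k, l)"
proof -
  have "bd F n (\<lambda>k. u (Suc n, k, z')) l \<in> I'" if l: "l \<in> basis F n" for l
  proof -
    have "bd F n (\<lambda>k. u (Suc n, k, z')) l + (-1) ^ n * bd F' 0 (\<lambda>l'. u (n, l, l')) z' = 0"
      using cycle[of "(n, l, z')"] l by (simp add: in_basis_tensor_iff R'.basis_0 total_bd_def)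
    then have "bd F n (\<lambda>k. u (Suc n, k, z')) l = bd F' 0 (\<lambda>l'. - ((-1) ^ n) * u (n, l, l')) z'"
      unfolding mat_vec_mult by (simp add: add_eq_0_iff2)
    then show ?thesis using R'.mem_ideal_iff by blast
  qed
  then obtain w where "\<forall>k\<in>basis F (Suc n). u (Suc n, k, z') - bd F (Suc n) w k \<in> I'"
    using tor_vanishes by blast
  then obtain v where v: "\<And>k. k \<in> basis F (Suc n) \<Longrightarrow>
      u (Suc n, k, z') - bd F (Suc n) w k = bd F' 0 (v k) z'"
    unfolding R'.mem_ideal_iff by metis
  define w' where "w' = (\<lambda>(p, k, l). if p = Suc (Suc n) then w k else (-1) ^ Suc n * v k l)"
  have "u (p, k, l) = total_bd F F' (Suc n) w' (p, k, l)"
    if "(p, k, l) \<in> basis T (Suc n)" "Suc n \<le> p" for p k l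
  proof -
    have p: "p = Suc n" "k \<in> basis F (Suc n)" "l = z'"
      using that R'.basis_0 by (auto simp: in_basis_tensor_iff)
    have "total_bd F F' (Suc n) w' (p, k, l) =
        bd F (Suc n) w k + (-1) ^ Suc n * bd F' 0 (\<lambda>l'. (-1) ^ Suc n * v k l') z'"
      by (simp add: total_bd_def w'_def p)
    also have "\<dots> = bd F (Suc n) w k + bd F' 0 (v k) z'"
      unfolding mat_vec_mult by (simp add: mult.assoc[symmetric])
    finally show ?thesis using v[OF p(2)] p by (simp add: diff_eq_eq add.commute)
  qed
  then show ?thesis by blast
qed

lemma total_cycle_vanishing_beyond_is_boundary:
  assumes "\<And>x. x \<in> basis T n \<Longrightarrow> total_bd F F' n u x = 0" and "c \<le> Suc (Suc n)"
    and "\<And>p k l. (p, k, l) \<in> basis T (Suc n) \<Longrightarrow> c \<le> p \<Longrightarrow> u (p, k, l) = 0"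
  shows "\<exists>w. \<forall>x\<in>basis T (Suc n). u x = total_bd F F' (Suc n) w x"
  using assms
proof (induction c arbitrary: u)
  case 0
  have "u x = total_bd F F' (Suc n) 0 x" if "x \<in> basis T (Suc n)" for x
    using that 0(3) by (cases x) (simp add: total_bd.zero)
  then show ?case by blast
next
  case (Suc c)
  have "\<exists>w. \<forall>p k l. (p, k, l) \<in> basis T (Suc n) \<longrightarrow> c \<le> p \<longrightarrow>
      u (p, k, l) = total_bd F F' (Suc n) w (p, k, l)"
    using clear_column[of n u c] clear_last_column[of n u] Suc.prems
    by (cases "c \<le> n") (auto simp: le_Suc_eq)
  then obtain v where v: "\<And>p k l. (p, k, l) \<in> basis T (Suc n) \<Longrightarrow> c \<le> p \<Longrightarrow>
      u (p, k, l) = total_bd F F' (Suc n) v (p, k, l)"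
    by blast
  have "\<exists>w. \<forall>x\<in>basis T (Suc n). (u - total_bd F F' (Suc n) v) x = total_bd F F' (Suc n) w x"
  proof (rule Suc.IH)
    show "total_bd F F' n (u - total_bd F F' (Suc n) v) x = 0" if "x \<in> basis T n" for x
      using that Suc.prems(1) by (simp add: total_bd.diff total_bd_total_bd)
  qed (use Suc.prems(2) v in auto)
  then obtain w where "\<And>x. x \<in> basis T (Suc n) \<Longrightarrow>
      (u - total_bd F F' (Suc n) v) x = total_bd F F' (Suc n) w x" by blast
  then have "\<forall>x\<in>basis T (Suc n). u x = total_bd F F' (Suc n) (v + w) x"
    by (simp add: total_bd.add diff_eq_eq add.commute)
  then show ?case by blast
qed

lemma cycles_tensor_eq_boundaries: "cycles T J (Suc n) = boundaries T (Suc n)"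
proof
  show "cycles T J (Suc n) \<subseteq> boundaries T (Suc n)"
  proof
    fix u assume "u \<in> cycles T J (Suc n)"
    then have "total_bd F F' n u x = 0" if "x \<in> basis T n" for x
      using that by (simp add: cycles_Suc bd_tensor)
    then obtain w where "\<And>x. x \<in> basis T (Suc n) \<Longrightarrow> u x = total_bd F F' (Suc n) w x"
      using total_cycle_vanishing_beyond_is_boundary[of n u "Suc (Suc n)"]
      by (auto simp: in_basis_tensor_iff)
    then show "u \<in> boundaries T (Suc n)" by (intro boundariesI[of _ _ _ w]) (simp add: bd_tensor)
  qed
  show "boundaries T (Suc n) \<subseteq> cycles T J (Suc n)"
  proof
    fix u assume "u \<in> boundaries T (Suc n)"
    then obtain w where w: "\<And>x. x \<in> basis T (Suc n) \<Longrightarrow> u x = total_bd F F' (Suc n) w x"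
      unfolding boundaries_def using bd_tensor by force
    have "bd T n u x = 0" if "x \<in> basis T n" for x
    proof -
      have "bd T n u x = bd T n (total_bd F F' (Suc n) w) x"
        using w by (intro mat_vec_cong) auto
      then show ?thesis using that by (simp add: bd_tensor total_bd_total_bd)
    qed
    then show "u \<in> cycles T J (Suc n)" by (simp add: cycles_Suc)
  qed
qed

lemma basis_tensor_0: "basis T 0 = {(0, z, z')}"
  by (auto simp: tensor_complex_def R.basis_0 R'.basis_0)

lemma aug_tensor: "aug T (0, z, z') = 1"
  by (simp add: tensor_complex_def R.aug_base R'.aug_base)

lemma augment_tensor: "augment T u = u (0, z, z')"
  by (simp add: augment_eq_sum basis_tensor_0 aug_tensor)

lemma cycles_tensor_0: "cycles T {a + b |a b. a \<in> I \<and> b \<in> I'} 0 = boundaries T 0"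
proof -
  have bd_0: "bd T 0 w (0, z, z') =
      bd F 0 (\<lambda>k. w (Suc 0, k, z')) z + bd F' 0 (\<lambda>l. w (0, z, l)) z'" for w
    by (simp add: bd_tensor basis_tensor_0 total_bd_def)
  have sum_iff: "u (0, z, z') \<in> {a + b |a b. a \<in> I \<and> b \<in> I'} \<longleftrightarrow>
      (\<exists>w. u (0, z, z') = bd T 0 w (0, z, z'))" for u
  proof
    assume "u (0, z, z') \<in> {a + b |a b. a \<in> I \<and> b \<in> I'}"
    then obtain w w' where "u (0, z, z') = bd F 0 w z + bd F' 0 w' z'"
      using R.mem_ideal_iff R'.mem_ideal_iff by auto
    then show "\<exists>w. u (0, z, z') = bd T 0 w (0, z, z')"
      unfolding bd_0 by (intro exI[of _ "\<lambda>(p, k, l). if p = 0 then w' l else w k"]) simp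
  next
    assume "\<exists>w. u (0, z, z') = bd T 0 w (0, z, z')"
    then show "u (0, z, z') \<in> {a + b |a b. a \<in> I \<and> b \<in> I'}"
      unfolding bd_0 using R.mem_ideal_iff R'.mem_ideal_iff by blast
  qed
  show ?thesis
  proof (rule set_eqI)
    show "u \<in> cycles T {a + b |a b. a \<in> I \<and> b \<in> I'} 0 \<longleftrightarrow> u \<in> boundaries T 0" for u
      using sum_iff[of u] by (simp add: cycles_0 augment_tensor boundaries_def basis_tensor_0)
  qed
qed

lemma homog_mat_bdry_tensor:
  "homog_mat (basis T n) (bdeg T n) (basis T (Suc n)) (bdeg T (Suc n)) (bdry T n)"
proof -
  have "homog (bdeg T n (p, k, l)) (bdeg T (Suc n) (p', k', l')) (bdry T n (p, k, l) (p', k', l'))"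
    if x: "(p, k, l) \<in> basis T n" and y: "(p', k', l') \<in> basis T (Suc n)" for p k l p' k' l'
  proof -
    have left: "homog (bdeg F p k + c) (bdeg F (Suc p) k' + c) (bdry F p k k')" if "p' = Suc p" for c
      using homog_matD[OF R.homog_bdry] x y that by (simp add: homog_add_shift in_basis_tensor_iff)
    have right: "homog (c + bdeg F' (n - p) l) (c + bdeg F' (Suc n - p) l')
        ((-1) ^ p * bdry F' (n - p) l l')"
      if "p' = p" for c
      using homog_add_shift[OF homog_matD[OF R'.homog_bdry], of l "n - p" l' c] x y that
      by (simp add: homog_minus_one_power_mult in_basis_tensor_iff Suc_diff_le add.commute[of c])
    show ?thesis
      using left right by (auto simp: tensor_complex_def)
  qed
  then show ?thesis by (auto simp: homog_mat_def)
qed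

lemma minimal_tensor:
  assumes "x \<in> basis T n" "y \<in> basis T (Suc n)"
  shows "const_coeff (bdry T n x y) = 0"
proof -
  obtain p k l p' k' l' where xy: "x = (p, k, l)" "y = (p', k', l')" by (cases x, cases y)
  have "const_coeff (bdry F p k k') = 0" if "p' = Suc p"
    using assms that by (intro R.minimal) (auto simp: xy in_basis_tensor_iff)
  moreover have "const_coeff (bdry F' (n - p) l l') = 0" if "p' = p"
    using assms that by (intro R'.minimal) (auto simp: xy in_basis_tensor_iff Suc_diff_le)
  ultimately show ?thesis
    by (auto simp: xy tensor_complex_def const_coeff_mult const_coeff.zero)
qed

theorem cyclic_minimal_resolution_tensor:
  "cyclic_minimal_resolution T {a + b |a b. a \<in> I \<and> b \<in> I'} (0, z, z')"
proof
  show "cycles T {a + b |a b. a \<in> I \<and> b \<in> I'} n = boundaries T n" for n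
    by (cases n) (simp_all add: cycles_tensor_0 cycles_tensor_eq_boundaries)
  show "\<exists>u. p - augment T u \<in> {a + b |a b. a \<in> I \<and> b \<in> I'}" for p
    unfolding augment_tensor using R.ideal_zero R'.ideal_zero by (intro exI[of _ "\<lambda>_. p"]) force
  show "homog 0 (bdeg T 0 x) (aug T x)" if "x \<in> basis T 0" for x
    using that
    by (simp add: basis_tensor_0 aug_tensor) (simp add: tensor_complex_def R.bdeg_base R'.bdeg_base)
qed (simp_all add: homog_ideal_sums R.homog_ideal R'.homog_ideal
    finite_basis_tensor homog_mat_bdry_tensor minimal_tensor basis_tensor_0 aug_tensor)

lemma card_basis_tensor:
  "card {x \<in> basis T n. bdeg T n x = j} =
    (\<Sum>p\<le>n. \<Sum>a\<le>j. card {k \<in> basis F p. bdeg F p k = a} *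
      card {l \<in> basis F' (n - p). bdeg F' (n - p) l = j - a})"
proof -
  define X where "X p a = {k \<in> basis F p. bdeg F p k = a}" for p a
  define Y where "Y p b = {l \<in> basis F' p. bdeg F' p l = b}" for p b
  have fin: "finite (X p a \<times> Y q b)" for p a q b
    by (simp add: X_def Y_def R.finite_basis R'.finite_basis)
  have disj: "(X p a \<times> Y q b) \<inter> (X p a' \<times> Y q b') = {}" if "a \<noteq> a'" for p a q b a' b'
    using that by (auto simp: X_def)
  have "{x \<in> basis T n. bdeg T n x = j} = (SIGMA p:{..n}. \<Union>a\<in>{..j}. X p a \<times> Y (n - p) (j - a))"
    by (auto simp: tensor_complex_def X_def Y_def)
  then have "card {x \<in> basis T n. bdeg T n x = j} =
      (\<Sum>p\<le>n. card (\<Union>a\<in>{..j}. X p a \<times> Y (n - p) (j - a)))"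
    using fin by (simp only:) (rule card_SigmaI, auto)
  moreover have "card (\<Union>a\<in>{..j}. X p a \<times> Y (n - p) (j - a)) =
      (\<Sum>a\<le>j. card (X p a \<times> Y (n - p) (j - a)))" for p
    by (rule card_UN_disjoint) (use fin disj in auto)
  ultimately show ?thesis by (simp add: card_cartesian_product X_def Y_def)
qed

end

section \<open>Powers of an ideal generated by two variables\<close>

lemma Var_dvd_if_keys:
  fixes p :: "('w, 'k::comm_ring_1) mpoly"
  assumes "\<And>m. m \<in> keys p \<Longrightarrow> lookup m b > 0"
  shows "Var b dvd p"
proof -
  have "single b 1 + (m - single b 1) = m" if "m \<in> keys p" for m
    by (rule poly_mapping_eqI)
      (use assms[OF that] in \<open>auto simp: lookup_add lookup_minus lookup_single when_def\<close>)
  then have "p = (\<Sum>m\<in>keys p. single (single b 1 + (m - single b 1)) (lookup p m))"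
    by (simp add: sum_single_keys)
  also have "\<dots> = Var b * (\<Sum>m\<in>keys p. single (m - single b 1) (lookup p m))"
    by (simp add: Var_def sum_distrib_left mult_single)
  finally show ?thesis by (rule dvdI)
qed

lemma Var_dvd_cancel_Var_power:
  fixes p :: "('w, 'k::comm_ring_1) mpoly"
  assumes "a \<noteq> b" and "Var b dvd Var a ^ n * p"
  shows "Var b dvd p"
proof (rule Var_dvd_if_keys)
  obtain q where q: "Var a ^ n * p = Var b * q" using assms(2) by (rule dvdE)
  fix m assume "m \<in> keys p"
  then have "single a n + m \<in> keys (Var b * q)"
    unfolding q[symmetric] by (simp add: Var_power lookup_single_mult_add in_keys_iff)
  then obtain y where "single a n + m = single b 1 + y"
    using keys_mult[of "Var b" q] by (auto simp: Var_def split: if_splits)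
  then have "lookup (single a n + m) b = lookup (single b 1 + y) b" by simp
  then show "lookup m b > 0" using \<open>a \<noteq> b\<close> by (simp add: lookup_add lookup_single when_def)
qed

definition binary_form ::
  "'w \<Rightarrow> 'w \<Rightarrow> nat \<Rightarrow> (nat \<Rightarrow> ('w, 'k::comm_ring_1) mpoly) \<Rightarrow> ('w, 'k) mpoly" where
  "binary_form a b c f = (\<Sum>t\<le>c. Var a ^ t * Var b ^ (c - t) * f t)"

lemma binary_form_0 [simp]: "binary_form a b 0 f = f 0"
  by (simp add: binary_form_def)

lemma binary_form_Suc:
  "binary_form a b (Suc c) f = Var b * binary_form a b c f + Var a ^ Suc c * f (Suc c)"
proof -
  have "(\<Sum>t\<le>c. Var a ^ t * Var b ^ (Suc c - t) * f t) = Var b * binary_form a b c f"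
    unfolding binary_form_def sum_distrib_left by (rule sum.cong) (auto simp: Suc_diff_le mult_ac)
  then show ?thesis by (simp add: binary_form_def)
qed

lemma binary_form_cong: "(\<And>t. t \<le> c \<Longrightarrow> f t = g t) \<Longrightarrow> binary_form a b c f = binary_form a b c g"
  by (simp add: binary_form_def)

lemma binary_form_add:
  "binary_form a b c (\<lambda>t. f t + g t) = binary_form a b c f + binary_form a b c g"
  by (simp add: binary_form_def distrib_left sum.distrib)

lemma binary_form_delta:
  "j \<le> c \<Longrightarrow> binary_form a b c (\<lambda>t. if t = j then e else 0) = Var a ^ j * Var b ^ (c - j) * e"
  by (simp add: binary_form_def if_distrib cong: if_cong)

lemma mat_vec_binary_form:
  "mat_vec X A (\<lambda>k. binary_form a b c (\<lambda>t. f t k)) l = binary_form a b c (\<lambda>t. mat_vec X A (f t) l)"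
  unfolding mat_vec_def binary_form_def sum_distrib_left by (subst sum.swap) (simp add: mult_ac)

context resolution
begin

lemma cycles_saturated:
  assumes "\<And>p. Var b * p \<in> I \<Longrightarrow> p \<in> I" and "fscale (Var b) u \<in> cycles F I i"
  shows "u \<in> cycles F I i"
proof (cases i)
  case 0
  then show ?thesis using assms by (simp add: cycles_0 augment_def mat_vec.scale fscale_apply)
next
  case (Suc j)
  have "bd F j u l = 0" if "l \<in> basis F j" for l
    by (rule Var_mult_cancel[of b])
      (use assms(2) that in \<open>simp add: Suc cycles_Suc mat_vec.scale fscale_apply\<close>)
  then show ?thesis by (simp add: Suc cycles_Suc)
qed

lemma lift_modulo_Var:
  assumes nzd: "\<And>p. Var b * p \<in> I \<Longrightarrow> p \<in> I" and "a \<noteq> b"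
    and eq: "\<And>l. l \<in> basis F i \<Longrightarrow> Var b * bd F i v l + Var a ^ n * bd F i f l = 0"
  shows "\<exists>e h. \<forall>k\<in>basis F (Suc i). f k = Var b * e k + bd F (Suc i) h k"
proof -
  have "Var b dvd bd F i f l" if "l \<in> basis F i" for l
  proof (rule Var_dvd_cancel_Var_power[OF \<open>a \<noteq> b\<close>])
    have "Var a ^ n * bd F i f l = Var b * (- bd F i v l)"
      using eq[OF that] by (simp add: eq_neg_iff_add_eq_0 add.commute)
    then show "Var b dvd Var a ^ n * bd F i f l" by simp
  qed
  then obtain g where g: "\<And>l. l \<in> basis F i \<Longrightarrow> bd F i f l = Var b * g l"
    unfolding dvd_def by metis
  have "fscale (Var b) g \<in> boundaries F i"
    by (rule boundariesI[of _ _ _ f]) (simp add: fscale_apply g)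
  then have "g \<in> boundaries F i"
    using cycles_saturated[OF nzd] by (simp add: cycles_eq_boundaries)
  then obtain e where e: "\<And>l. l \<in> basis F i \<Longrightarrow> g l = bd F i e l"
    unfolding boundaries_def by blast
  have "f - fscale (Var b) e \<in> cycles F I (Suc i)"
    using g e by (simp add: cycles_Suc mat_vec.diff mat_vec.scale fscale_apply)
  then obtain h where "\<And>k. k \<in> basis F (Suc i) \<Longrightarrow> (f - fscale (Var b) e) k = bd F (Suc i) h k"
    unfolding cycles_eq_boundaries boundaries_def by blast
  then have "\<forall>k\<in>basis F (Suc i). f k = Var b * e k + bd F (Suc i) h k"
    by (simp add: fscale_apply diff_eq_eq add.commute)
  then show ?thesis by blast
qed

lemma binary_cycle_reduction:
  assumes nzd: "\<And>p. Var b * p \<in> I \<Longrightarrow> p \<in> I" and "a \<noteq> b"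
    and cycle: "u \<in> cycles F I (Suc i)"
    and u: "\<And>k. k \<in> basis F (Suc i) \<Longrightarrow> u k = Var b * v k + Var a ^ n * f k"
  shows "\<exists>e h. v + fscale (Var a ^ n) e \<in> cycles F I (Suc i) \<and> (\<forall>k\<in>basis F (Suc i).
    u k = Var b * (v + fscale (Var a ^ n) e) k + Var a ^ n * bd F (Suc i) h k)"
proof -
  have bd_u: "Var b * bd F i v l + Var a ^ n * bd F i f l = 0" if "l \<in> basis F i" for l
  proof -
    have "bd F i u l = bd F i (fscale (Var b) v + fscale (Var a ^ n) f) l"
      using u by (intro mat_vec_cong) (simp_all add: fscale_apply)
    then show ?thesis
      using cycle that by (simp add: cycles_Suc mat_vec.add mat_vec.scale fscale_apply)
  qed
  from lift_modulo_Var[OF nzd \<open>a \<noteq> b\<close> this] obtain e h where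
    f: "\<And>k. k \<in> basis F (Suc i) \<Longrightarrow> f k = Var b * e k + bd F (Suc i) h k" by blast
  let ?v' = "v + fscale (Var a ^ n) e"
  have "bd F i ?v' l = 0" if l: "l \<in> basis F i" for l
  proof (rule Var_mult_cancel)
    have "bd F i f l = bd F i (fscale (Var b) e + bd F (Suc i) h) l"
      using f by (intro mat_vec_cong) (simp_all add: fscale_apply)
    also have "\<dots> = Var b * bd F i e l"
      using bd_bd[OF l] by (simp add: mat_vec.add mat_vec.scale fscale_apply)
    finally have "Var b * bd F i ?v' l = Var b * bd F i v l + Var a ^ n * bd F i f l"
      by (simp add: mat_vec.add mat_vec.scale fscale_apply algebra_simps)
    then show "Var b * bd F i ?v' l = Var b * 0" using bd_u[OF l] by simp
  qed
  then have "?v' \<in> cycles F I (Suc i)" by (simp add: cycles_Suc)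
  moreover have "u k = Var b * ?v' k + Var a ^ n * bd F (Suc i) h k" if "k \<in> basis F (Suc i)" for k
    using u[OF that] f[OF that] by (simp add: fscale_apply algebra_simps)
  ultimately show ?thesis by blast
qed

text \<open>For \<open>\<qq> = (X\<^sub>a, X\<^sub>b)\<close>, the subcomplexes \<open>\<qq>\<^sup>c F\<close> are acyclic in positive degrees.\<close>

theorem cycle_in_power_is_boundary:
  assumes nzd: "\<And>p. Var b * p \<in> I \<Longrightarrow> p \<in> I" and "a \<noteq> b"
    and "u \<in> cycles F I (Suc i)"
    and "\<And>k. k \<in> basis F (Suc i) \<Longrightarrow> u k = binary_form a b c (\<lambda>t. f t k)"
  shows "\<exists>h. \<forall>k\<in>basis F (Suc i). u k = binary_form a b c (\<lambda>t. bd F (Suc i) (h t) k)"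
  using assms(3,4)
proof (induction c arbitrary: u f)
  case 0
  then obtain w where "\<And>k. k \<in> basis F (Suc i) \<Longrightarrow> u k = bd F (Suc i) w k"
    unfolding cycles_eq_boundaries boundaries_def by blast
  then show ?case by (intro exI[of _ "\<lambda>_. w"]) simp
next
  case (Suc c)
  define v where "v k = binary_form a b c (\<lambda>t. f t k)" for k
  have "u k = Var b * v k + Var a ^ Suc c * f (Suc c) k" if "k \<in> basis F (Suc i)" for k
    using Suc.prems(2)[OF that] by (simp only: binary_form_Suc v_def)
  from binary_cycle_reduction[OF nzd \<open>a \<noteq> b\<close> Suc.prems(1) this] obtain e w where
    cycle: "v + fscale (Var a ^ Suc c) e \<in> cycles F I (Suc i)" and
    u: "\<And>k. k \<in> basis F (Suc i) \<Longrightarrow>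
      u k = Var b * (v + fscale (Var a ^ Suc c) e) k + Var a ^ Suc c * bd F (Suc i) w k"
    by blast
  have "(v + fscale (Var a ^ Suc c) e) k =
      binary_form a b c (\<lambda>t. f t k + (if t = c then Var a * e k else 0))" for k
    by (simp add: binary_form_add binary_form_delta v_def fscale_apply)
  from Suc.IH[OF cycle this] obtain h where h: "\<And>k. k \<in> basis F (Suc i) \<Longrightarrow>
      (v + fscale (Var a ^ Suc c) e) k = binary_form a b c (\<lambda>t. bd F (Suc i) (h t) k)" by blast
  have "u k = binary_form a b (Suc c) (\<lambda>t. bd F (Suc i) ((h(Suc c := w)) t) k)"
    if "k \<in> basis F (Suc i)" for k
    unfolding u[OF that] h[OF that] binary_form_Suc by (simp cong: binary_form_cong)
  then show ?case by blast
qed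

end

section \<open>Free vertices\<close>

lemma clique_subset_maximal_clique:
  assumes "finite (verts G)" "clique G D"
  shows "\<exists>C. maximal_clique G C \<and> D \<subseteq> C"
proof -
  have "{C. clique G C} \<subseteq> Pow (verts G)" by (auto simp: clique_def)
  then have "finite {C. clique G C}" using assms(1) by (meson finite_Pow_iff finite_subset)
  from finite_has_maximal2[OF this, of D] assms(2) show ?thesis
    by (auto simp: maximal_clique_def)
qed

locale simple_sgraph =
  fixes H :: "'v sgraph"
  assumes simple: "simple_graph H"
begin

lemma edgeD: "{i, j} \<in> edges H \<Longrightarrow> i \<in> verts H \<and> j \<in> verts H \<and> i \<noteq> j"
  using simple unfolding simple_graph_def by (metis doubleton_eq_iff)

lemma free_vertex_neighbours_adjacent:
  assumes v: "free_vertex H v" and edges: "{v, a} \<in> edges H" "{v, b} \<in> edges H" and "a \<noteq> b"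
  shows "{a, b} \<in> edges H"
proof -
  have "\<exists>C. maximal_clique H C \<and> {v, c} \<subseteq> C" if "{v, c} \<in> edges H" for c
  proof (rule clique_subset_maximal_clique)
    show "finite (verts H)" using simple by (simp add: simple_graph_def)
    show "clique H {v, c}" using that edgeD[OF that] by (auto simp: clique_def insert_commute)
  qed
  then obtain C D where CD: "maximal_clique H C" "{v, a} \<subseteq> C" "maximal_clique H D" "{v, b} \<subseteq> D"
    using edges by metis
  have "card {C. maximal_clique H C \<and> v \<in> C} = 1"
    using v by (simp add: free_vertex_def clique_degree_def)
  then obtain E where "{C. maximal_clique H C \<and> v \<in> C} = {E}" by (rule card_1_singletonE)
  then have "C = E" "D = E" using CD by auto
  then show ?thesis using CD \<open>a \<noteq> b\<close> by (auto simp: maximal_clique_def clique_def)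
qed

definition reach :: "'v set \<Rightarrow> ('v \<times> 'v) set" where
  "reach A = {(i, j). i \<in> A \<and> j \<in> A \<and> {i, j} \<in> edges H}\<^sup>*"

lemma reach_refl: "(i, i) \<in> reach A"
  by (simp add: reach_def)

lemma reach_trans: "(i, j) \<in> reach A \<Longrightarrow> (j, k) \<in> reach A \<Longrightarrow> (i, k) \<in> reach A"
  by (simp add: reach_def)

lemma reach_sym: "(i, j) \<in> reach A \<Longrightarrow> (j, i) \<in> reach A"
proof -
  have "sym {(i, j). i \<in> A \<and> j \<in> A \<and> {i, j} \<in> edges H}"
    by (auto simp: sym_def insert_commute)
  then show "(i, j) \<in> reach A \<Longrightarrow> (j, i) \<in> reach A"
    unfolding reach_def by (meson symD sym_rtrancl)
qed

lemma equiv_reach: "equiv UNIV (reach A)"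
proof (rule equivI)
  show "sym (reach A)" by (rule symI) (rule reach_sym)
qed (simp_all add: reach_def refl_rtrancl trans_rtrancl)

lemma reach_edge: "i \<in> A \<Longrightarrow> j \<in> A \<Longrightarrow> {i, j} \<in> edges H \<Longrightarrow> (i, j) \<in> reach A"
  unfolding reach_def by auto

lemma reach_in: "(i, j) \<in> reach A \<Longrightarrow> i = j \<or> i \<in> A \<and> j \<in> A"
  unfolding reach_def by (induction rule: rtrancl_induct) auto

lemma reach_mono: "A \<subseteq> B \<Longrightarrow> reach A \<subseteq> reach B"
  unfolding reach_def by (rule rtrancl_mono) blast

lemma reach_remove_free_vertex:
  assumes v: "free_vertex H v" and ij: "(i, j) \<in> reach (insert v A)" and "i \<noteq> v" "j \<noteq> v"
  shows "(i, j) \<in> reach A"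
proof -
  have "if j = v then \<exists>a\<in>A. {v, a} \<in> edges H \<and> (i, a) \<in> reach A else (i, j) \<in> reach A"
    using ij unfolding reach_def[of "insert v A"]
  proof (induction rule: rtrancl_induct)
    case base
    then show ?case using \<open>i \<noteq> v\<close> by (simp add: reach_refl)
  next
    case (step j k)
    then have e: "{j, k} \<in> edges H" "j \<noteq> v \<Longrightarrow> j \<in> A" "k \<noteq> v \<Longrightarrow> k \<in> A" by auto
    consider "j = v" "k \<noteq> v" | "j \<noteq> v" "k = v" | "j \<noteq> v" "k \<noteq> v"
      using edgeD[OF e(1)] by blast
    then show ?case
    proof cases
      case 1
      then obtain a where a: "a \<in> A" "{v, a} \<in> edges H" "(i, a) \<in> reach A" using step.IH by auto
      have "(a, k) \<in> reach A"
        using free_vertex_neighbours_adjacent[OF v a(2), of k] a(1) e 1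
        by (cases "a = k") (auto intro: reach_refl reach_edge)
      then show ?thesis using a(3) 1 reach_trans by auto
    next
      case 2
      then show ?thesis using step.IH e by (auto simp: insert_commute)
    next
      case 3
      then show ?thesis using step.IH e reach_edge reach_trans by auto
    qed
  qed
  then show ?thesis using \<open>j \<noteq> v\<close> by simp
qed

end

section \<open>Monomials modulo a binomial edge ideal\<close>

definition xm :: "'v \<Rightarrow> 'v + 'v \<Rightarrow>\<^sub>0 nat" where "xm i = single (Inl i) 1"
definition ym :: "'v \<Rightarrow> 'v + 'v \<Rightarrow>\<^sub>0 nat" where "ym i = single (Inr i) 1"

lemma lookup_xm: "lookup (xm i) w = (if w = Inl i then 1 else 0)"
  and lookup_ym: "lookup (ym i) w = (if w = Inr i then 1 else 0)"
  by (auto simp: lookup_single xm_def ym_def)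

lemma eq_add_xm: "lookup q (Inl k) > 0 \<Longrightarrow> \<exists>q'. q = q' + xm k"
  by (rule exI[of _ "q - xm k"], rule poly_mapping_eqI) (auto simp: lookup_add lookup_minus lookup_xm)

lemma eq_add_ym: "lookup q (Inr k) > 0 \<Longrightarrow> \<exists>q'. q = q' + ym k"
  by (rule exI[of _ "q - ym k"], rule poly_mapping_eqI) (auto simp: lookup_add lookup_minus lookup_ym)

definition vdeg :: "('v + 'v \<Rightarrow>\<^sub>0 nat) \<Rightarrow> 'v \<Rightarrow> nat" where
  "vdeg m k = lookup m (Inl k) + lookup m (Inr k)"

abbreviation vsupp :: "('v + 'v \<Rightarrow>\<^sub>0 nat) \<Rightarrow> 'v set" where
  "vsupp m \<equiv> {k. vdeg m k > 0}"

lemma vdeg_swap: "vdeg (q + xm i + ym j) = vdeg (q + xm j + ym i)"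
  by (auto simp: vdeg_def lookup_add lookup_xm lookup_ym fun_eq_iff)

lemma sum_lookup_xm_ym:
  fixes T :: "'v::finite set"
  shows "(\<Sum>k\<in>T. lookup (q + xm i + ym j) (Inl k)) =
      (\<Sum>k\<in>T. lookup q (Inl k)) + (if i \<in> T then 1 else 0)"
    and "(\<Sum>k\<in>T. lookup (q + xm i + ym j) (Inr k)) =
      (\<Sum>k\<in>T. lookup q (Inr k)) + (if j \<in> T then 1 else 0)"
  by (simp_all add: lookup_add lookup_xm lookup_ym sum.distrib)

lemma exists_less_if_sum_eq:
  fixes f g :: "'a \<Rightarrow> nat"
  assumes "finite A" "sum f A = sum g A" "k \<in> A" "g k < f k"
  shows "\<exists>j\<in>A. f j < g j"
proof (rule ccontr)
  assume "\<not> ?thesis"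
  then have "sum g A < sum f A"
    using assms by (intro sum_strict_mono_ex1) (auto simp: not_less)
  then show False using assms(2) by simp
qed

lemma exists_exchange_in_class:
  fixes f g :: "'a::finite \<Rightarrow> nat"
  assumes C: "equiv UNIV C" and sums: "\<And>k. sum f (C `` {k}) = sum g (C `` {k})" and "f \<noteq> g"
  shows "\<exists>i j. (i, j) \<in> C \<and> g i < f i \<and> f j < g j"
proof -
  have self: "k \<in> C `` {k}" for k using C by (rule equiv_class_self) simp
  obtain k where "f k \<noteq> g k" using \<open>f \<noteq> g\<close> by blast
  then consider "g k < f k" | "f k < g k" by linarith
  then show ?thesis
  proof cases
    case 1
    from exists_less_if_sum_eq[OF _ sums self this] obtain j where "(k, j) \<in> C" "f j < g j"
      by auto
    then show ?thesis using 1 by blast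
  next
    case 2
    from exists_less_if_sum_eq[OF _ sums[symmetric] self this] obtain i where "(k, i) \<in> C" "g i < f i"
      by auto
    then show ?thesis using 2 C unfolding equiv_def sym_def by blast
  qed
qed

lemma monomial_eqI_vdeg:
  assumes "vdeg m = vdeg n" and x: "\<And>k. lookup m (Inl k) = lookup n (Inl k)"
  shows "m = n"
proof (rule poly_mapping_eqI)
  have "lookup m (Inr k) = lookup n (Inr k)" for k
    using fun_cong[OF assms(1), of k] x[of k] by (simp add: vdeg_def)
  then show "lookup m w = lookup n w" for w using x by (cases w) simp_all
qed

lemma exists_eq_add_xm_ym:
  assumes "lookup m (Inl i) > 0" "lookup m (Inr j) > 0"
  shows "\<exists>q. m = q + xm i + ym j"
proof -
  from eq_add_ym[OF assms(2)] obtain q' where q': "m = q' + ym j" ..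
  then have "lookup q' (Inl i) > 0" using assms(1) by (simp add: lookup_add lookup_ym)
  from eq_add_xm[OF this] q' show ?thesis by blast
qed

lemma sum_excess_swap_less:
  fixes n q :: "'v::finite + 'v \<Rightarrow>\<^sub>0 nat"
  assumes "lookup n (Inl i) < lookup (q + xm i + ym j) (Inl i)"
    and "lookup (q + xm i + ym j) (Inl j) < lookup n (Inl j)"
  shows "(\<Sum>k\<in>UNIV. lookup (q + xm j + ym i) (Inl k) - lookup n (Inl k)) <
    (\<Sum>k\<in>UNIV. lookup (q + xm i + ym j) (Inl k) - lookup n (Inl k))"
proof (rule sum_strict_mono_ex1)
  show "\<exists>k\<in>UNIV. lookup (q + xm j + ym i) (Inl k) - lookup n (Inl k) <
      lookup (q + xm i + ym j) (Inl k) - lookup n (Inl k)"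
    using assms by (intro bexI[of _ i]) (auto simp: lookup_add lookup_xm lookup_ym)
qed (use assms in \<open>auto simp: lookup_add lookup_xm lookup_ym\<close>)

definition edge_binomials :: "'v::linorder sgraph \<Rightarrow> ('v, 'k::comm_ring_1) xy_poly set" where
  "edge_binomials H =
    {Var (Inl i) * Var (Inr j) - Var (Inl j) * Var (Inr i) | i j. {i, j} \<in> edges H \<and> i < j}"

lemma binomial_edge_ideal_eq: "binomial_edge_ideal H = ideal_gen (edge_binomials H)"
  by (simp add: binomial_edge_ideal_def edge_binomials_def)

lemma single_mult_edge_binomial:
  "single m c * (Var (Inl i) * Var (Inr j) - Var (Inl j) * Var (Inr i)) =
    single (m + xm i + ym j) c - single (m + xm j + ym i) (c::'k::comm_ring_1)"
  by (simp add: Var_def mult_single algebra_simps xm_def ym_def)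

context simple_sgraph
begin

definition swap_equiv :: "('v + 'v \<Rightarrow>\<^sub>0 nat) rel" where
  "swap_equiv = {(q + xm i + ym j, q + xm j + ym i) | q i j. {i, j} \<in> edges H}\<^sup>*"

lemma swap_equiv_trans: "(m, n) \<in> swap_equiv \<Longrightarrow> (n, q) \<in> swap_equiv \<Longrightarrow> (m, q) \<in> swap_equiv"
  by (simp add: swap_equiv_def)

lemma swap_equiv_edge: "{i, j} \<in> edges H \<Longrightarrow> (q + xm i + ym j, q + xm j + ym i) \<in> swap_equiv"
  unfolding swap_equiv_def by blast

lemma swap_equiv_invariant:
  assumes "(m, n) \<in> swap_equiv"
    and "\<And>q i j. {i, j} \<in> edges H \<Longrightarrow> f (q + xm i + ym j) = f (q + xm j + ym i)"
  shows "f m = f n"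
  using assms(1) unfolding swap_equiv_def
  by (induction rule: rtrancl_induct) (use assms(2) in auto)

lemma swap_equiv_path:
  assumes "(i, j) \<in> reach A" "A \<subseteq> vsupp (q + xm i + ym j)"
  shows "(q + xm i + ym j, q + xm j + ym i) \<in> swap_equiv"
  using assms unfolding reach_def
proof (induction arbitrary: q rule: rtrancl_induct)
  case base
  then show ?case by (simp add: swap_equiv_def)
next
  case (step k j)
  have k: "k \<in> A" and e: "{k, j} \<in> edges H" using step.hyps by auto
  have IH: "(q' + xm i + ym k, q' + xm k + ym i) \<in> swap_equiv"
    if "vdeg (q' + xm i + ym k) = vdeg (q + xm i + ym j)" for q'
    using step.IH[of q'] step.prems that by simp
  have "vdeg (q + xm i + ym j) k > 0" using step.prems k by blast
  then have "lookup q (Inr k) > 0 \<or> lookup q (Inl k) > 0 \<or> k = i"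
    using edgeD[OF e] by (auto simp: vdeg_def lookup_add lookup_xm lookup_ym split: if_splits)
  then consider "k = i" | q' where "q = q' + ym k" | q' where "q = q' + xm k"
    using eq_add_xm[of q k] eq_add_ym[of q k] by auto
  then show ?case
  proof cases
    case 1
    then show ?thesis using swap_equiv_edge e by simp
  next
    case 2
    have "((q' + ym j) + xm i + ym k, (q' + ym j) + xm k + ym i) \<in> swap_equiv"
      by (rule IH) (simp add: 2 ac_simps)
    moreover have "((q' + ym i) + xm k + ym j, (q' + ym i) + xm j + ym k) \<in> swap_equiv"
      by (rule swap_equiv_edge[OF e])
    ultimately show ?thesis
      unfolding 2 by (simp add: ac_simps swap_equiv_trans)
  next
    case 3
    have "((q' + xm i) + xm k + ym j, (q' + xm i) + xm j + ym k) \<in> swap_equiv"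
      by (rule swap_equiv_edge[OF e])
    moreover have "((q' + xm j) + xm i + ym k, (q' + xm j) + xm k + ym i) \<in> swap_equiv"
      using vdeg_swap[of "q' + xm i" k j] by (intro IH) (simp add: 3 ac_simps)
    ultimately show ?thesis
      unfolding 3 by (simp add: ac_simps swap_equiv_trans)
  qed
qed

end

locale finite_simple_sgraph = simple_sgraph H for H :: "'v::{finite,linorder} sgraph"
begin

theorem swap_equiv_if_class_sums_eq:
  assumes C: "equiv UNIV C"
    and "\<And>i j. (i, j) \<in> C \<Longrightarrow> i \<in> vsupp m \<Longrightarrow> j \<in> vsupp m \<Longrightarrow> (i, j) \<in> reach (vsupp m)"
    and "vdeg m = vdeg n"
    and "\<And>k. (\<Sum>j\<in>C `` {k}. lookup m (Inl j)) = (\<Sum>j\<in>C `` {k}. lookup n (Inl j))"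
  shows "(m, n) \<in> swap_equiv"
  using assms(2-)
proof (induction "\<Sum>k\<in>UNIV. lookup m (Inl k) - lookup n (Inl k)" arbitrary: m rule: less_induct)
  case less
  note connected = less.prems(1) and deg = less.prems(2) and sums = less.prems(3)
  show ?case
  proof (cases "(\<lambda>k. lookup m (Inl k)) = (\<lambda>k. lookup n (Inl k))")
    case True
    then have "m = n" by (intro monomial_eqI_vdeg deg) metis
    then show ?thesis by (simp add: swap_equiv_def)
  next
    case False
    then obtain i j where ij: "(i, j) \<in> C" "lookup n (Inl i) < lookup m (Inl i)"
        "lookup m (Inl j) < lookup n (Inl j)"
      using exists_exchange_in_class[OF C sums] by blast
    then have pos: "lookup m (Inl i) > 0" "lookup m (Inr j) > 0"
      using fun_cong[OF deg, of j] by (simp_all add: vdeg_def)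
    from exists_eq_add_xm_ym[OF this] obtain q where m: "m = q + xm i + ym j" ..
    define m' where "m' = q + xm j + ym i"
    have deg': "vdeg m' = vdeg m" by (simp add: m m'_def vdeg_swap)
    have "i \<in> vsupp m" "j \<in> vsupp m" using pos by (auto simp: vdeg_def)
    then have "(m, m') \<in> swap_equiv"
      using swap_equiv_path[OF connected[OF ij(1)]] by (simp add: m m'_def)
    also have "(m', n) \<in> swap_equiv"
    proof (rule less.hyps)
      show "(\<Sum>k\<in>UNIV. lookup m' (Inl k) - lookup n (Inl k)) <
          (\<Sum>k\<in>UNIV. lookup m (Inl k) - lookup n (Inl k))"
        using ij unfolding m m'_def by (intro sum_excess_swap_less)
      show "vdeg m' = vdeg n" using deg' deg by simp
      show "(a, b) \<in> reach (vsupp m')" if "(a, b) \<in> C" "a \<in> vsupp m'" "b \<in> vsupp m'" for a b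
        using connected that by (simp add: deg')
      show "(\<Sum>l\<in>C `` {k}. lookup m' (Inl l)) = (\<Sum>l\<in>C `` {k}. lookup n (Inl l))" for k
      proof -
        have "i \<in> C `` {k} \<longleftrightarrow> j \<in> C `` {k}"
          using ij(1) C unfolding equiv_def sym_def trans_def by blast
        then show ?thesis using sums[of k] unfolding m m'_def sum_lookup_xm_ym by simp
      qed
    qed
    finally (swap_equiv_trans) show ?thesis .
  qed
qed

lemma single_diff_in_binomial_edge_ideal:
  assumes "(m, n) \<in> swap_equiv"
  shows "single m 1 - single n 1 \<in> (binomial_edge_ideal H :: ('v, 'k::field) xy_poly set)"
  using assms unfolding swap_equiv_def
proof (induction rule: rtrancl_induct)
  case base
  then show ?case by (simp add: binomial_edge_ideal_eq ideal_gen_zero)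
next
  case (step n n')
  then obtain q i j where ij: "{i, j} \<in> edges H" "n = q + xm i + ym j" "n' = q + xm j + ym i" by blast
  have gen: "single (q + xm i + ym j) 1 - single (q + xm j + ym i) 1 \<in>
      (binomial_edge_ideal H :: ('v, 'k) xy_poly set)"
    if "{i, j} \<in> edges H" "i < j" for i j
    unfolding single_mult_edge_binomial[symmetric] binomial_edge_ideal_eq
    using that by (intro ideal_gen_mult ideal_gen_base) (auto simp: edge_binomials_def)
  consider "i < j" | "j < i" using edgeD[OF ij(1)] by (meson linorder_neqE)
  then have "single n 1 - single n' 1 \<in> (binomial_edge_ideal H :: ('v, 'k) xy_poly set)"
  proof cases
    case 1
    then show ?thesis using gen ij by blast
  next
    case 2
    then have "single n' 1 - single n 1 \<in> (binomial_edge_ideal H :: ('v, 'k) xy_poly set)"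
      using gen[of j i] ij by (simp add: insert_commute)
    then show ?thesis
      using ideal_gen_diff[OF ideal_gen_zero] unfolding binomial_edge_ideal_eq by fastforce
  qed
  then show ?case
    using step.IH ideal_gen_add unfolding binomial_edge_ideal_eq by fastforce
qed

lemma pushforward_binomial_edge_ideal:
  fixes p :: "('v, 'k::field) xy_poly"
  assumes cls: "\<And>m n. (m, n) \<in> swap_equiv \<Longrightarrow> cls m = cls n" and "p \<in> binomial_edge_ideal H"
  shows "pushforward (\<lambda>_. True) cls p = 0"
  using assms(2) unfolding binomial_edge_ideal_eq
proof (induction rule: ideal_gen_induct)
  case base
  then show ?case by (rule pushforward.zero)
next
  case (step c x y)
  then obtain i j where e: "{i, j} \<in> edges H"
    and x: "x = Var (Inl i) * Var (Inr j) - Var (Inl j) * Var (Inr i)"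
    by (auto simp: edge_binomials_def)
  have "pushforward (\<lambda>_. True) cls (c * x) = 0"
  proof (induction c rule: poly_mapping_add_induct)
    case (single m c)
    have "cls (m + xm i + ym j) = cls (m + xm j + ym i)" by (rule cls[OF swap_equiv_edge[OF e]])
    then show ?case
      unfolding x single_mult_edge_binomial by (simp add: pushforward.diff pushforward_single)
  qed (simp add: pushforward.add distrib_right)
  then show ?case using step by (simp add: pushforward.add)
qed

lemma diff_pushforward_in_binomial_edge_ideal:
  fixes p :: "('v, 'k::field) xy_poly"
  assumes rep: "\<And>m. (m, rep (cls m)) \<in> swap_equiv"
  shows "p - pushforward (\<lambda>_. True) rep (pushforward (\<lambda>_. True) cls p) \<in> binomial_edge_ideal H"
proof (induction p rule: poly_mapping_add_induct)
  case (single m c)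
  have "single 0 c * (single m 1 - single (rep (cls m)) 1) \<in>
      (binomial_edge_ideal H :: ('v, 'k) xy_poly set)"
    using single_diff_in_binomial_edge_ideal[OF rep]
    unfolding binomial_edge_ideal_eq by (rule ideal_gen_mult)
  then show ?case by (simp add: pushforward_single right_diff_distrib mult_single)
next
  case (add p q)
  from ideal_gen_add[OF this[unfolded binomial_edge_ideal_eq]] show ?case
    unfolding binomial_edge_ideal_eq by (simp add: pushforward.add algebra_simps)
qed

theorem binomial_edge_ideal_iff_pushforward_eq_0:
  fixes p :: "('v, 'k::field) xy_poly"
  assumes cls: "\<And>m n. cls m = cls n \<longleftrightarrow> (m, n) \<in> swap_equiv"
  shows "p \<in> binomial_edge_ideal H \<longleftrightarrow> pushforward (\<lambda>_. True) cls p = 0"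
proof
  assume "p \<in> binomial_edge_ideal H"
  then show "pushforward (\<lambda>_. True) cls p = 0"
    using pushforward_binomial_edge_ideal cls by blast
next
  assume "pushforward (\<lambda>_. True) cls p = 0"
  moreover have "(m, inv cls (cls m)) \<in> swap_equiv" for m
    unfolding cls[symmetric] by (simp add: f_inv_into_f)
  then have "p - pushforward (\<lambda>_. True) (inv cls) (pushforward (\<lambda>_. True) cls p) \<in>
      binomial_edge_ideal H"
    by (rule diff_pushforward_in_binomial_edge_ideal)
  ultimately show "p \<in> binomial_edge_ideal H" by (simp add: pushforward.zero)
qed

end

lemma exists_monomial:
  fixes f g :: "'v::finite \<Rightarrow> nat"
  shows "\<exists>m. \<forall>i. lookup m (Inl i) = f i \<and> lookup m (Inr i) = g i"
  by (rule exI[of _ "Abs_poly_mapping (case_sum f g)"]) simp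

lemma exists_sum_eq:
  fixes a :: "'a \<Rightarrow> nat"
  assumes "finite T" "t \<le> sum a T"
  shows "\<exists>b. (\<forall>j. b j \<le> a j) \<and> sum b T = t"
  using assms
proof (induction T arbitrary: t)
  case empty
  then show ?case by (intro exI[of _ "\<lambda>_. 0"]) simp
next
  case (insert x T)
  define t' where "t' = t - min t (a x)"
  have "t' \<le> sum a T" using insert by (simp add: t'_def)
  then obtain b where b: "\<forall>j. b j \<le> a j" "sum b T = t'" using insert.IH by blast
  have "sum (b(x := min t (a x))) T = sum b T"
    by (rule sum.cong) (use insert.hyps in auto)
  then show ?case using b insert.hyps
    by (intro exI[of _ "b(x := min t (a x))"]) (auto simp: t'_def)
qed

section \<open>The module structure over the variables outside \<open>H - v\<close>\<close>

locale graph_with_free_vertex = finite_simple_sgraph H for H :: "'v::{finite,linorder} sgraph" +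
  fixes v :: 'v
  assumes free: "free_vertex H v"
begin

definition inner_verts :: "'v set" where "inner_verts = verts H - {v}"

definition outer_vars :: "('v + 'v) set"
  where "outer_vars = - (Inl ` inner_verts \<union> Inr ` inner_verts)"

definition inner_deg :: "('v + 'v \<Rightarrow>\<^sub>0 nat) \<Rightarrow> 'v \<Rightarrow> nat" where
  "inner_deg m i = (if i \<in> inner_verts then vdeg m i else 0)"

definition link :: "('v \<Rightarrow> nat) \<Rightarrow> ('v \<times> 'v) set" where
  "link a = reach (insert v {i. a i > 0})"

definition near :: "('v \<Rightarrow> nat) \<Rightarrow> 'v set" where
  "near a = link a `` {v} - {v}"

text \<open>The \<open>x\<close>-degree of a monomial on each connected component of the subgraph induced by its
  support is an invariant modulo the ideal. The components adjacent to \<open>v\<close> merge with \<open>v\<close>, so their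
  variables are sent to \<open>x\<^sub>v\<close> and \<open>y\<^sub>v\<close>; the label records what is lost.\<close>

definition merge :: "('v + 'v \<Rightarrow>\<^sub>0 nat) \<Rightarrow> 'v + 'v \<Rightarrow>\<^sub>0 nat" where
  "merge m = restr outer_vars m + single (Inl v) (\<Sum>j\<in>near (inner_deg m). lookup m (Inl j)) +
     single (Inr v) (\<Sum>j\<in>near (inner_deg m). lookup m (Inr j))"

definition label :: "('v + 'v \<Rightarrow>\<^sub>0 nat) \<Rightarrow> ('v \<Rightarrow> nat) \<times> ('v \<Rightarrow> nat)" where
  "label m = (inner_deg m, \<lambda>i. if i \<in> inner_verts - near (inner_deg m)
     then \<Sum>j\<in>link (inner_deg m) `` {i}. lookup m (Inl j) else 0)"

definition capacity :: "('v \<Rightarrow> nat) \<times> ('v \<Rightarrow> nat) \<Rightarrow> nat" where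
  "capacity \<kappa> = (\<Sum>j\<in>near (fst \<kappa>). fst \<kappa> j)"

lemma v_notin_inner_verts: "v \<notin> inner_verts"
  and v_in_outer_vars: "Inl v \<in> outer_vars" "Inr v \<in> outer_vars"
  by (auto simp: inner_verts_def outer_vars_def)

lemma inner_deg_pos_imp_inner: "inner_deg m i > 0 \<Longrightarrow> i \<in> inner_verts"
  by (simp add: inner_deg_def split: if_splits)

lemma equiv_link: "equiv UNIV (link a)"
  unfolding link_def by (rule equiv_reach)

lemma link_outside: "a i = 0 \<Longrightarrow> i \<noteq> v \<Longrightarrow> link a `` {i} = {i}"
  using reach_in reach_refl by (fastforce simp: link_def)

lemma near_subset_inner_verts: "near (inner_deg m) \<subseteq> inner_verts"
  using reach_in inner_deg_pos_imp_inner by (fastforce simp: near_def link_def)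

lemma v_notin_near [simp]: "v \<notin> near a"
  by (simp add: near_def)

lemma link_v: "link a `` {v} = insert v (near a)"
  using reach_refl by (auto simp: near_def link_def)

lemma link_far_subset_far:
  assumes "i \<in> inner_verts - near (inner_deg m)"
  shows "link (inner_deg m) `` {i} \<subseteq> inner_verts - near (inner_deg m)"
proof
  fix j assume j: "j \<in> link (inner_deg m) `` {i}"
  have "(v, j) \<notin> link (inner_deg m)"
  proof
    assume "(v, j) \<in> link (inner_deg m)"
    then have "(v, i) \<in> link (inner_deg m)" using j reach_trans reach_sym unfolding link_def by blast
    then show False using assms v_notin_inner_verts by (auto simp: near_def)
  qed
  moreover have "(v, v) \<in> link (inner_deg m)" by (simp add: link_def reach_refl)
  ultimately have "j \<noteq> v" "j \<notin> near (inner_deg m)" by (auto simp: near_def)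
  then show "j \<in> inner_verts - near (inner_deg m)"
    using j reach_in assms inner_deg_pos_imp_inner by (fastforce simp: link_def)
qed

lemma lookup_merge:
  "lookup (merge m) (Inl v) = (\<Sum>j\<in>link (inner_deg m) `` {v}. lookup m (Inl j))"
  "lookup (merge m) (Inr v) = (\<Sum>j\<in>link (inner_deg m) `` {v}. lookup m (Inr j))"
  "i \<noteq> v \<Longrightarrow> lookup (merge m) (Inl i) = (lookup m (Inl i) when i \<notin> inner_verts)"
  "i \<noteq> v \<Longrightarrow> lookup (merge m) (Inr i) = (lookup m (Inr i) when i \<notin> inner_verts)"
  using v_notin_inner_verts
  by (auto simp: merge_def lookup_add lookup_restr lookup_single link_v outer_vars_def when_def)

lemma merge_eqI:
  assumes "lookup (merge m) (Inl v) = lookup (merge n) (Inl v)"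
    and "lookup (merge m) (Inr v) = lookup (merge n) (Inr v)"
    and "\<And>i. i \<notin> verts H \<Longrightarrow> lookup m (Inl i) = lookup n (Inl i) \<and> lookup m (Inr i) = lookup n (Inr i)"
  shows "merge m = merge n"
proof (rule poly_mapping_eqI)
  have "lookup (merge m) (Inl i) = lookup (merge n) (Inl i) \<and>
      lookup (merge m) (Inr i) = lookup (merge n) (Inr i)" for i
    using assms by (cases "i = v") (auto simp: lookup_merge(3,4) inner_verts_def when_def)
  then show "lookup (merge m) w = lookup (merge n) w" for w by (cases w) auto
qed

lemma label_merge_edge:
  assumes e: "{i, j} \<in> edges H"
  shows "(label (q + xm i + ym j), merge (q + xm i + ym j)) =
      (label (q + xm j + ym i), merge (q + xm j + ym i))"
proof -
  let ?m = "q + xm i + ym j" and ?n = "q + xm j + ym i"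
  have inner_deg: "inner_deg ?n = inner_deg ?m"
    by (simp add: inner_deg_def fun_eq_iff vdeg_swap[of q i j])
  have ij: "i \<in> verts H" "j \<in> verts H" using edgeD[OF e] by auto
  then have "i \<in> insert v {i. inner_deg ?m i > 0}" "j \<in> insert v {i. inner_deg ?m i > 0}"
    by (auto simp: inner_deg_def inner_verts_def vdeg_def lookup_add lookup_xm lookup_ym)
  then have "(i, j) \<in> link (inner_deg ?m)" unfolding link_def using e by (rule reach_edge)
  then have same: "i \<in> link (inner_deg ?m) `` {k} \<longleftrightarrow> j \<in> link (inner_deg ?m) `` {k}" for k
    using reach_trans reach_sym unfolding link_def by blast
  have sums: "(\<Sum>l\<in>link (inner_deg ?m) `` {k}. lookup ?m (Inl l)) =
      (\<Sum>l\<in>link (inner_deg ?m) `` {k}. lookup ?n (Inl l))"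
    "(\<Sum>l\<in>link (inner_deg ?m) `` {k}. lookup ?m (Inr l)) =
      (\<Sum>l\<in>link (inner_deg ?m) `` {k}. lookup ?n (Inr l))" for k
    unfolding sum_lookup_xm_ym using same[of k] by simp_all
  have "label ?m = label ?n"
    unfolding label_def inner_deg sums(1) ..
  moreover have "merge ?m = merge ?n"
  proof (rule merge_eqI)
    show "lookup (merge ?m) (Inl v) = lookup (merge ?n) (Inl v)"
      "lookup (merge ?m) (Inr v) = lookup (merge ?n) (Inr v)"
      unfolding lookup_merge(1,2) inner_deg sums by (rule refl)+
  qed (use ij in \<open>auto simp: lookup_add lookup_xm lookup_ym\<close>)
  ultimately show ?thesis by simp
qed

lemma link_near:
  assumes "k = v \<or> k \<in> near a"
  shows "link a `` {k} = link a `` {v}"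
proof -
  have "(v, k) \<in> link a" using assms reach_refl by (auto simp: near_def link_def)
  then show ?thesis using equiv_class_eq[OF equiv_link] by metis
qed

lemma link_imp_reach_vsupp:
  assumes ij: "(i, j) \<in> link (inner_deg m)" "i \<in> vsupp m" "j \<in> vsupp m"
  shows "(i, j) \<in> reach (vsupp m)"
proof -
  have pos: "{i. inner_deg m i > 0} \<subseteq> vsupp m" by (auto simp: inner_deg_def split: if_splits)
  show ?thesis
  proof (cases "v \<in> vsupp m")
    case True
    then show ?thesis
      using ij(1) pos reach_mono[of "insert v {i. inner_deg m i > 0}" "vsupp m"]
      by (auto simp: link_def)
  next
    case False
    then have "(i, j) \<in> reach {i. inner_deg m i > 0}"
      using ij reach_remove_free_vertex[OF free] unfolding link_def by blast
    then show ?thesis using reach_mono[OF pos] by blast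
  qed
qed

context
  fixes m n
  assumes label: "label m = label n" and merge: "merge m = merge n"
begin

lemma inner_deg_eq: "inner_deg n = inner_deg m"
  using label by (simp add: label_def)

lemma link_v_sums_eq:
  "(\<Sum>j\<in>link (inner_deg m) `` {v}. lookup m (Inl j)) =
      (\<Sum>j\<in>link (inner_deg m) `` {v}. lookup n (Inl j))"
  "(\<Sum>j\<in>link (inner_deg m) `` {v}. lookup m (Inr j)) =
      (\<Sum>j\<in>link (inner_deg m) `` {v}. lookup n (Inr j))"
  using lookup_merge(1,2)[of m] lookup_merge(1,2)[of n] by (simp_all add: inner_deg_eq merge)

lemma lookup_eq_outside:
  assumes "i \<notin> inner_verts" "i \<noteq> v"
  shows "lookup m (Inl i) = lookup n (Inl i)" "lookup m (Inr i) = lookup n (Inr i)"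
  using lookup_merge(3,4)[OF assms(2), of m] lookup_merge(3,4)[OF assms(2), of n] assms
  by (simp_all add: merge)

lemma vdeg_eq: "vdeg m = vdeg n"
proof
  fix i
  have inner_verts: "vdeg m i = vdeg n i" if "i \<in> inner_verts" for i
    using fun_cong[OF inner_deg_eq, of i] that by (simp add: inner_deg_def)
  consider "i \<in> inner_verts" | "i = v" | "i \<notin> inner_verts" "i \<noteq> v" by blast
  then show "vdeg m i = vdeg n i"
  proof cases
    case 1
    then show ?thesis by (rule inner_verts)
  next
    case 2
    have "(\<Sum>j\<in>link (inner_deg m) `` {v}. vdeg m j) = (\<Sum>j\<in>link (inner_deg m) `` {v}. vdeg n j)"
      using link_v_sums_eq by (simp add: vdeg_def sum.distrib)
    moreover have "(\<Sum>j\<in>near (inner_deg m). vdeg m j) = (\<Sum>j\<in>near (inner_deg m). vdeg n j)"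
      using inner_verts subsetD[OF near_subset_inner_verts] by (intro sum.cong) auto
    ultimately show ?thesis using 2 by (simp add: link_v)
  next
    case 3
    then show ?thesis by (simp add: lookup_eq_outside vdeg_def)
  qed
qed

lemma link_sums_eq:
  "(\<Sum>j\<in>link (inner_deg m) `` {k}. lookup m (Inl j)) =
      (\<Sum>j\<in>link (inner_deg m) `` {k}. lookup n (Inl j))"
proof -
  consider "k = v \<or> k \<in> near (inner_deg m)" | "k \<in> inner_verts - near (inner_deg m)"
    | "k \<notin> inner_verts" "k \<noteq> v" by blast
  then show ?thesis
  proof cases
    case 1
    then show ?thesis using link_v_sums_eq(1) by (simp add: link_near[OF 1])
  next
    case 2
    then show ?thesis
      using fun_cong[OF arg_cong[OF label, of snd], of k] by (simp add: label_def inner_deg_eq)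
  next
    case 3
    then show ?thesis
      using link_outside[of "inner_deg m" k] lookup_eq_outside[OF 3] by (simp add: inner_deg_def)
  qed
qed

lemma swap_equiv_if_label_merge_eq: "(m, n) \<in> swap_equiv"
  using equiv_link link_imp_reach_vsupp vdeg_eq link_sums_eq by (rule swap_equiv_if_class_sums_eq)

end

lemma label_merge_eq_iff: "(label m, merge m) = (label n, merge n) \<longleftrightarrow> (m, n) \<in> swap_equiv"
proof
  assume "(m, n) \<in> swap_equiv"
  then show "(label m, merge m) = (label n, merge n)"
    by (rule swap_equiv_invariant) (rule label_merge_edge)
qed (simp add: swap_equiv_if_label_merge_eq)

lemma lookup_inner_eq_0:
  "keys w \<subseteq> outer_vars \<Longrightarrow> i \<in> inner_verts \<Longrightarrow>
    lookup w (Inl i) = 0 \<and> lookup w (Inr i) = 0"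
  by (auto simp: outer_vars_def in_keys_iff)

lemma inner_deg_add_outer: "keys w \<subseteq> outer_vars \<Longrightarrow> inner_deg (w + m) = inner_deg m"
  by (auto simp: inner_deg_def vdeg_def lookup_add lookup_inner_eq_0)

lemma label_add_outer:
  assumes w: "keys w \<subseteq> outer_vars"
  shows "label (w + m) = label m"
proof -
  have "(\<Sum>j\<in>link (inner_deg m) `` {i}. lookup (w + m) (Inl j)) =
      (\<Sum>j\<in>link (inner_deg m) `` {i}. lookup m (Inl j))"
    if "i \<in> inner_verts - near (inner_deg m)" for i
    using link_far_subset_far[OF that] lookup_inner_eq_0[OF w]
    by (intro sum.cong) (auto simp: lookup_add)
  then show ?thesis by (auto simp: label_def inner_deg_add_outer[OF w] fun_eq_iff)
qed

lemma merge_add_outer: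
  assumes w: "keys w \<subseteq> outer_vars"
  shows "merge (w + m) = w + merge m"
proof -
  have "(\<Sum>j\<in>near (inner_deg m). lookup (w + m) (Inl j)) = (\<Sum>j\<in>near (inner_deg m). lookup m (Inl j))"
     "(\<Sum>j\<in>near (inner_deg m). lookup (w + m) (Inr j)) = (\<Sum>j\<in>near (inner_deg m). lookup m (Inr j))"
    using subsetD[OF near_subset_inner_verts] lookup_inner_eq_0[OF w]
    by (auto intro!: sum.cong simp: lookup_add)
  then show ?thesis
    by (simp add: merge_def inner_deg_add_outer[OF w] restr_add restr_id[OF w] add.assoc)
qed

lemma keys_merge: "keys (merge m) \<subseteq> outer_vars"
  using keys_restr[of outer_vars m] v_in_outer_vars
  by (auto simp: merge_def keys_add_monomial split: if_splits)

lemma merge_form: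
  "\<exists>t\<le>capacity (label m). merge m =
      restr outer_vars m + single (Inl v) t + single (Inr v) (capacity (label m) - t)"
proof -
  have "capacity (label m) = (\<Sum>j\<in>near (inner_deg m). lookup m (Inl j) + lookup m (Inr j))"
    using subsetD[OF near_subset_inner_verts]
    by (auto simp: capacity_def label_def inner_deg_def vdeg_def intro!: sum.cong)
  then show ?thesis
    by (intro exI[of _ "\<Sum>j\<in>near (inner_deg m). lookup m (Inl j)"]) (simp add: merge_def sum.distrib)
qed

lemma merge_attained:
  assumes "t \<le> capacity (label m)"
  shows "\<exists>n. label n = label m \<and> merge n = single (Inl v) t + single (Inr v) (capacity (label m) - t)"
proof -
  let ?N = "near (inner_deg m)"
  have cap: "capacity (label m) = (\<Sum>j\<in>?N. inner_deg m j)" by (simp add: capacity_def label_def)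
  obtain b where b: "\<And>j. b j \<le> inner_deg m j" "sum b ?N = t"
    using exists_sum_eq[of ?N t "inner_deg m"] assms cap by auto
  let ?x = "\<lambda>i. if i \<in> ?N then b i else if i \<in> inner_verts then lookup m (Inl i) else 0"
  let ?y = "\<lambda>i. if i \<in> ?N then inner_deg m i - b i
    else if i \<in> inner_verts then lookup m (Inr i) else 0"
  obtain n where n: "\<And>i. lookup n (Inl i) = ?x i" "\<And>i. lookup n (Inr i) = ?y i"
    using exists_monomial[of ?x ?y] by blast
  have inner_deg: "inner_deg n = inner_deg m"
  proof
    show "inner_deg n i = inner_deg m i" for i
      using near_subset_inner_verts[of m] b(1)[of i]
      by (cases "i \<in> ?N")
        (auto simp: inner_deg_def[of n] vdeg_def n, auto simp: inner_deg_def vdeg_def)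
  qed
  have "(\<Sum>j\<in>link (inner_deg m) `` {i}. lookup n (Inl j)) =
      (\<Sum>j\<in>link (inner_deg m) `` {i}. lookup m (Inl j))"
    if "i \<in> inner_verts - ?N" for i
    using link_far_subset_far[OF that] by (intro sum.cong) (auto simp: n)
  then have "label n = label m" by (auto simp: label_def inner_deg fun_eq_iff)
  moreover have "restr outer_vars n = 0"
  proof (rule poly_mapping_eqI)
    show "lookup (restr outer_vars n) w = lookup 0 w" for w
      using near_subset_inner_verts[of m]
      by (cases w) (auto simp: lookup_restr outer_vars_def n when_def)
  qed
  moreover have "(\<Sum>j\<in>?N. lookup n (Inr j)) = capacity (label m) - t"
    using b by (simp add: n cap sum_subtractf_nat)
  ultimately show ?thesis
    using b(2) by (intro exI[of _ n]) (simp add: merge_def inner_deg n)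
qed

text \<open>Over the polynomial ring in the variables \<open>outer_vars\<close>, the module \<open>S/J\<^sub>H\<close> is the direct sum
  of the images of its components, and these are the powers of the ideal \<open>(x\<^sub>v, y\<^sub>v)\<close> given by the
  capacities.\<close>

definition component :: "('v \<Rightarrow> nat) \<times> ('v \<Rightarrow> nat) \<Rightarrow> ('v, 'k::field) xy_poly \<Rightarrow> ('v, 'k) xy_poly" where
  "component \<kappa> = pushforward (\<lambda>m. label m = \<kappa>) merge"

sublocale component: additive "component \<kappa>" for \<kappa>
  by standard (simp add: component_def pushforward.add)

theorem binomial_edge_ideal_iff_component_eq_0:
  "p \<in> binomial_edge_ideal H \<longleftrightarrow> (\<forall>\<kappa>. component \<kappa> p = 0)"
proof -
  have "lookup (pushforward (\<lambda>_. True) (\<lambda>m. (label m, merge m)) p) (\<kappa>, \<mu>) =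
      lookup (component \<kappa> p) \<mu>" for \<kappa> \<mu>
    by (simp add: component_def lookup_pushforward)
  then have "pushforward (\<lambda>_. True) (\<lambda>m. (label m, merge m)) p = 0 \<longleftrightarrow> (\<forall>\<kappa>. component \<kappa> p = 0)"
    unfolding poly_mapping_eq_iff fun_eq_iff by force
  then show ?thesis
    using binomial_edge_ideal_iff_pushforward_eq_0[of "\<lambda>m. (label m, merge m)"] label_merge_eq_iff
    by blast
qed

lemma component_single: "component \<kappa> (single m c) = (single (merge m) c when label m = \<kappa>)"
  by (simp add: component_def pushforward_single)

lemma component_mult: "a \<in> polys_in outer_vars \<Longrightarrow> component \<kappa> (a * p) = a * component \<kappa> p"
  unfolding component_def
  by (rule pushforward_mult) (auto simp: polys_in_def label_add_outer merge_add_outer)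

lemma component_mat_vec:
  "(\<And>k. k \<in> X \<Longrightarrow> A l k \<in> polys_in outer_vars) \<Longrightarrow>
      component \<kappa> (mat_vec X A u l) = mat_vec X A (\<lambda>k. component \<kappa> (u k)) l"
  by (simp add: mat_vec_def component.sum component_mult)

lemma component_in_polys_in: "component \<kappa> p \<in> polys_in outer_vars"
  unfolding component_def polys_in_def using keys_pushforward keys_merge by fastforce

lemma component_eq_binary_form:
  "\<exists>f. component \<kappa> p = binary_form (Inl v) (Inr v) (capacity \<kappa>) f"
proof (induction p rule: poly_mapping_add_induct)
  case (single m c)
  show ?case
  proof (cases "label m = \<kappa>")
    case True
    then obtain t where t: "t \<le> capacity \<kappa>"
        "merge m = restr outer_vars m + single (Inl v) t + single (Inr v) (capacity \<kappa> - t)"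
      using merge_form[of m] by blast
    have "component \<kappa> (single m c) =
        Var (Inl v) ^ t * Var (Inr v) ^ (capacity \<kappa> - t) * single (restr outer_vars m) c"
      by (simp add: component_single True t(2) Var_power mult_single ac_simps)
    then show ?thesis using binary_form_delta[OF t(1)] by metis
  next
    case False
    then show ?thesis by (intro exI[of _ "\<lambda>_. 0"]) (simp add: component_single binary_form_def)
  qed
next
  case (add p q)
  then obtain f g where "component \<kappa> p = binary_form (Inl v) (Inr v) (capacity \<kappa>) f"
      "component \<kappa> q = binary_form (Inl v) (Inr v) (capacity \<kappa>) g" by blast
  then show ?case
    by (intro exI[of _ "\<lambda>t. f t + g t"]) (simp add: component.add binary_form_add)
qed

lemma component_lift:
  fixes f :: "nat \<Rightarrow> 'b \<Rightarrow> ('v, 'k::field) xy_poly"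
  assumes "\<kappa> \<in> range label" and f: "\<And>t j. f t j \<in> polys_in outer_vars"
  shows "\<exists>w. \<forall>j \<kappa>'. component \<kappa>' (w j) =
    (if \<kappa>' = \<kappa> then binary_form (Inl v) (Inr v) (capacity \<kappa>) (\<lambda>t. f t j) else 0)"
proof -
  obtain m where "\<kappa> = label m" using assms(1) by blast
  then have "\<exists>n. label n = \<kappa> \<and> merge n = single (Inl v) t + single (Inr v) (capacity \<kappa> - t)"
    if "t \<le> capacity \<kappa>" for t
    using merge_attained that by simp
  then obtain n where n: "\<And>t. t \<le> capacity \<kappa> \<Longrightarrow>
      label (n t) = \<kappa> \<and> merge (n t) = single (Inl v) t + single (Inr v) (capacity \<kappa> - t)"
    by metis
  define w where "w j = (\<Sum>t\<le>capacity \<kappa>. f t j * single (n t) 1)" for j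
  have "component \<kappa>' (w j) =
      (\<Sum>t\<le>capacity \<kappa>. if \<kappa>' = \<kappa>
        then Var (Inl v) ^ t * Var (Inr v) ^ (capacity \<kappa> - t) * f t j else 0)" for \<kappa>' j
    unfolding w_def component.sum
    by (rule sum.cong)
      (use n in \<open>auto simp: component_mult f component_single Var_power mult_single ac_simps\<close>)
  then show ?thesis by (intro exI[of _ w]) (simp add: binary_form_def)
qed

lemma Var_nonzerodivisor:
  fixes p :: "('v, 'k::field) xy_poly"
  assumes "Var (Inr v) * p \<in> binomial_edge_ideal H"
  shows "p \<in> binomial_edge_ideal H"
  unfolding binomial_edge_ideal_iff_component_eq_0
proof
  fix \<kappa>
  have "component \<kappa> (Var (Inr v) * p) = 0"
    using assms unfolding binomial_edge_ideal_iff_component_eq_0 by (rule spec)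
  then have "Var (Inr v) * component \<kappa> p = Var (Inr v) * 0"
    using component_mult[OF Var_in_polys_in[OF v_in_outer_vars(2)], of \<kappa> p] by simp
  then show "component \<kappa> p = 0" by (rule Var_mult_cancel)
qed

end

section \<open>Vanishing of the higher Tor modules\<close>

locale free_vertex_resolution = graph_with_free_vertex H v + resolution F I
  for H :: "'v::{finite,linorder} sgraph" and v
    and F :: "('b, ('v, 'k::field) xy_poly) based_complex" and I +
  assumes bdry_in_polys_in: "l \<in> basis F i \<Longrightarrow> k \<in> basis F (Suc i) \<Longrightarrow> bdry F i l k \<in> polys_in outer_vars"
    and nonzerodivisor: "Var (Inr v) * p \<in> I \<Longrightarrow> p \<in> I"
begin

lemma component_bd:
  "l \<in> basis F i \<Longrightarrow> component \<kappa> (bd F i u l) = bd F i (\<lambda>k. component \<kappa> (u k)) l"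
  by (rule component_mat_vec) (rule bdry_in_polys_in)

lemma lift_component_boundary:
  assumes \<kappa>: "\<kappa> \<in> range label"
    and cycle: "\<And>l. l \<in> basis F i \<Longrightarrow> bd F i u l \<in> binomial_edge_ideal H"
  shows "\<exists>w. \<forall>k\<in>basis F (Suc i). \<forall>\<kappa>'.
    component \<kappa>' (bd F (Suc i) w k) = (if \<kappa>' = \<kappa> then component \<kappa> (u k) else 0)"
proof -
  let ?form = "binary_form (Inl v) (Inr v) (capacity \<kappa>)"
  have "\<forall>k. \<exists>f. component \<kappa> (u k) = ?form f" using component_eq_binary_form by blast
  then obtain f where f: "\<And>k. component \<kappa> (u k) = ?form (f k)" by metis
  have "(\<lambda>k. component \<kappa> (u k)) \<in> cycles F I (Suc i)"
    using cycle by (simp add: cycles_Suc component_bd[symmetric]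
        binomial_edge_ideal_iff_component_eq_0 del: split_paired_All)
  then obtain h where h: "\<And>k. k \<in> basis F (Suc i) \<Longrightarrow>
      component \<kappa> (u k) = ?form (\<lambda>t. bd F (Suc i) (h t) k)"
    using cycle_in_power_is_boundary[of "Inr v" "Inl v" "\<lambda>k. component \<kappa> (u k)" i
        "capacity \<kappa>" "\<lambda>t k. f k t"]
      nonzerodivisor f by auto
  have retract_h: "component \<kappa> (u k) = ?form (\<lambda>t. bd F (Suc i) (\<lambda>j. retract outer_vars (h t j)) k)"
    if k: "k \<in> basis F (Suc i)" for k
  proof -
    have "component \<kappa> (u k) = retract outer_vars (?form (\<lambda>t. bd F (Suc i) (h t) k))"
      using h[OF k] by (simp add: retract_id component_in_polys_in flip: h[OF k])
    also have "\<dots> = ?form (\<lambda>t. bd F (Suc i) (\<lambda>j. retract outer_vars (h t j)) k)"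
      using bdry_in_polys_in[OF k]
      by (simp add: binary_form_def mat_vec_def retract.sum retract_mult polys_in_mult
          Var_power_in_polys_in v_in_outer_vars)
    finally show ?thesis .
  qed
  obtain w where w: "\<And>j \<kappa>'. component \<kappa>' (w j) =
      (if \<kappa>' = \<kappa> then ?form (\<lambda>t. retract outer_vars (h t j)) else 0)"
    using component_lift[OF \<kappa>, of "\<lambda>t j. retract outer_vars (h t j)"] retract_in_polys_in by blast
  have "component \<kappa>' (bd F (Suc i) w k) = (if \<kappa>' = \<kappa> then component \<kappa> (u k) else 0)"
    if k: "k \<in> basis F (Suc i)" for k \<kappa>'
    unfolding component_bd[OF k] w
    by (cases "\<kappa>' = \<kappa>") (simp_all add: retract_h[OF k] mat_vec_binary_form, simp add: mat_vec_def)
  then show ?thesis by blast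
qed

theorem tor_binomial_edge_ideal_vanishes:
  assumes cycle: "\<And>l. l \<in> basis F i \<Longrightarrow> bd F i u l \<in> binomial_edge_ideal H"
  shows "\<exists>w. \<forall>k\<in>basis F (Suc i). u k - bd F (Suc i) w k \<in> binomial_edge_ideal H"
proof -
  define L where "L = (\<Union>k\<in>basis F (Suc i). label ` keys (u k))"
  have "finite L" using finite_basis by (simp add: L_def)
  have component_outside: "component \<kappa> (u k) = 0" if "\<kappa> \<notin> L" "k \<in> basis F (Suc i)" for \<kappa> k
  proof -
    have "{m. m \<in> keys (u k) \<and> label m = \<kappa>} = {}" using that by (auto simp: L_def)
    then show ?thesis unfolding component_def pushforward_def by (simp only: sum.empty)
  qed
  have "\<forall>\<kappa>\<in>L. \<exists>w. \<forall>k\<in>basis F (Suc i). \<forall>\<kappa>'.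
      component \<kappa>' (bd F (Suc i) w k) = (if \<kappa>' = \<kappa> then component \<kappa> (u k) else 0)"
    using lift_component_boundary[OF _ cycle] by (auto simp: L_def)
  from bchoice[OF this] obtain w where w: "\<And>\<kappa> k \<kappa>'. \<kappa> \<in> L \<Longrightarrow> k \<in> basis F (Suc i) \<Longrightarrow>
      component \<kappa>' (bd F (Suc i) (w \<kappa>) k) = (if \<kappa>' = \<kappa> then component \<kappa> (u k) else 0)"
    by blast
  have "component \<kappa> (u k - bd F (Suc i) (\<Sum>\<kappa>\<in>L. w \<kappa>) k) = 0" if k: "k \<in> basis F (Suc i)" for \<kappa> k
  proof -
    have "component \<kappa> (bd F (Suc i) (\<Sum>\<kappa>\<in>L. w \<kappa>) k) =
        (\<Sum>\<kappa>'\<in>L. if \<kappa> = \<kappa>' then component \<kappa>' (u k) else 0)"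
      unfolding mat_vec.sum sum_fun_apply component.sum by (intro sum.cong refl w k)
    also have "\<dots> = component \<kappa> (u k)"
      using \<open>finite L\<close> component_outside[OF _ k] by (cases "\<kappa> \<in> L") simp_all
    finally show ?thesis by (simp add: component.diff)
  qed
  then show ?thesis unfolding binomial_edge_ideal_iff_component_eq_0 by blast
qed

end

section \<open>Betti polynomials\<close>

lemma coeff_betti_poly:
  assumes "finite {(i, j). betti I i j \<noteq> 0}"
  shows "coeff (coeff (betti_poly I) i) j = int (betti I i j)"
proof -
  have "coeff (coeff (betti_poly I) i) j =
      (\<Sum>x\<in>{(i, j). betti I i j \<noteq> 0}. if x = (i, j) then int (betti I i j) else 0)"
    unfolding betti_poly_def coeff_sum by (rule sum.cong) (auto simp: coeff_monom split: if_splits)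
  also have "\<dots> = int (betti I i j)" using assms by simp
  finally show ?thesis .
qed

lemma betti_poly_infinite: "infinite {(i, j). betti I i j \<noteq> 0} \<Longrightarrow> betti_poly I = 0"
  by (simp add: betti_poly_def)

context
  fixes I I1 I2 :: "('w::finite, 'k::field) mpoly set"
  assumes conv: "\<And>n j. betti I n j = (\<Sum>p\<le>n. \<Sum>a\<le>j. betti I1 p a * betti I2 (n - p) (j - a))"
begin

lemma betti_mult_le_betti_add: "betti I1 p a * betti I2 q b \<le> betti I (p + q) (a + b)"
proof -
  have "betti I1 p a * betti I2 (p + q - p) (a + b - a) \<le>
      (\<Sum>a'\<le>a + b. betti I1 p a' * betti I2 (p + q - p) (a + b - a'))"
    by (rule member_le_sum) auto
  also have "\<dots> \<le> betti I (p + q) (a + b)"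
    unfolding conv by (rule member_le_sum) auto
  finally show ?thesis by simp
qed

lemma betti_support_subset:
  "{(i, j). betti I i j \<noteq> 0} \<subseteq>
    (\<lambda>((p, a), (q, b)). (p + q, a + b)) ` ({(i, j). betti I1 i j \<noteq> 0} \<times> {(i, j). betti I2 i j \<noteq> 0})"
proof
  fix x assume "x \<in> {(i, j). betti I i j \<noteq> 0}"
  then obtain n j where x: "x = (n, j)" "betti I n j \<noteq> 0" by auto
  then obtain p a where "p \<le> n" "a \<le> j" "betti I1 p a * betti I2 (n - p) (j - a) \<noteq> 0"
    unfolding conv by (meson atMost_iff sum.neutral)
  then show "x \<in> (\<lambda>((p, a), (q, b)). (p + q, a + b)) `
      ({(i, j). betti I1 i j \<noteq> 0} \<times> {(i, j). betti I2 i j \<noteq> 0})"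
    by (intro image_eqI[of _ _ "((p, a), (n - p, j - a))"]) (auto simp: x(1))
qed

theorem betti_poly_mult:
  assumes pos: "betti I1 0 0 > 0" "betti I2 0 0 > 0"
  shows "betti_poly I = betti_poly I1 * betti_poly I2"
proof (cases "finite {(i, j). betti I1 i j \<noteq> 0} \<and> finite {(i, j). betti I2 i j \<noteq> 0}")
  case False
  have "betti I i j \<noteq> 0" if "betti I1 i j \<noteq> 0 \<or> betti I2 i j \<noteq> 0" for i j
    using that betti_mult_le_betti_add[of i j 0 0] betti_mult_le_betti_add[of 0 0 i j] pos
    by (cases "betti I i j = 0") auto
  then have "{(i, j). betti I1 i j \<noteq> 0} \<subseteq> {(i, j). betti I i j \<noteq> 0}"
      "{(i, j). betti I2 i j \<noteq> 0} \<subseteq> {(i, j). betti I i j \<noteq> 0}" by auto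
  then have "infinite {(i, j). betti I i j \<noteq> 0}" using False finite_subset by blast
  moreover have "betti_poly I1 = 0 \<or> betti_poly I2 = 0" using False betti_poly_infinite by blast
  ultimately show ?thesis using betti_poly_infinite[of I] by auto
next
  case True
  then have "finite {(i, j). betti I i j \<noteq> 0}"
    using betti_support_subset by (meson finite_SigmaI finite_imageI finite_subset)
  then show ?thesis
    using True by (intro poly_eqI) (simp add: coeff_mult coeff_sum coeff_betti_poly conv)
qed

end

section \<open>Decompositions\<close>

lemma homog_edge_binomial:
  fixes p :: "('v::linorder, 'k::comm_ring_1) xy_poly"
  assumes "p \<in> edge_binomials H"
  shows "homog 0 2 p"
proof -
  have "homog 0 1 (Var w :: ('v, 'k) xy_poly)" "homog 1 2 (Var w :: ('v, 'k) xy_poly)" for w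
    by (simp_all add: homog_def Var_def)
  then show ?thesis using assms by (auto simp: edge_binomials_def intro!: homog_diff homog_mult)
qed

lemma edge_binomial_in_polys_in:
  assumes "simple_graph H" "p \<in> edge_binomials H" and "\<And>i. i \<in> verts H \<Longrightarrow> Inl i \<in> W \<and> Inr i \<in> W"
  shows "p \<in> polys_in W"
proof -
  interpret simple_sgraph H by unfold_locales (rule assms(1))
  show ?thesis
    using assms(2,3) edgeD
    by (fastforce simp: edge_binomials_def intro!: polys_in_diff polys_in_mult Var_in_polys_in)
qed

lemma binomial_edge_ideal_minimal_resolution:
  fixes H :: "'v::{finite,linorder} sgraph"
  assumes "simple_graph H" and W: "\<And>i. i \<in> verts H \<Longrightarrow> Inl i \<in> W \<and> Inr i \<in> W"
  shows "\<exists>E. cyclic_minimal_resolution (seq_complex E (\<lambda>_. 1))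
      (binomial_edge_ideal H :: ('v, 'k::field) xy_poly set) 0 \<and>
    (\<forall>i. \<forall>l<rnk E i. \<forall>k<rnk E (Suc i). diff E i l k \<in> polys_in W)"
proof -
  have "p \<in> polys_in W" "\<exists>e>0. homog 0 e p" if "p \<in> (edge_binomials H :: ('v, 'k) xy_poly set)" for p
    using edge_binomial_in_polys_in[OF assms(1) that W] homog_edge_binomial[OF that]
      zero_less_numeral by blast+
  from exists_minimal_resolution[OF this] show ?thesis
    unfolding binomial_edge_ideal_eq by metis
qed

lemma betti_binomial_edge_ideal_eq_card:
  fixes F :: "('b, ('v::{finite,linorder}, 'k::field) xy_poly) based_complex"
  assumes H: "simple_graph H" and F: "minimal_resolution F (binomial_edge_ideal H)"
  shows "betti (binomial_edge_ideal H :: ('v, 'k) xy_poly set) i j =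
      card {b \<in> basis F i. bdeg F i b = j}"
proof -
  obtain E where "cyclic_minimal_resolution (seq_complex E (\<lambda>_. 1))
      (binomial_edge_ideal H :: ('v, 'k) xy_poly set) 0"
    using binomial_edge_ideal_minimal_resolution[OF H, of UNIV] by auto
  then interpret E: cyclic_minimal_resolution "seq_complex E (\<lambda>_. 1)"
    "binomial_edge_ideal H :: ('v, 'k) xy_poly set" 0 .
  have "graded_free_resolution E (binomial_edge_ideal H)"
    using graded_free_resolution_iff[OF E.homog_ideal] E.resolution_axioms by blast
  with F show ?thesis by (rule betti_eq_card)
qed

lemma decomposition_tensor_resolution:
  fixes G1 G2 :: "'v::{finite,linorder} sgraph"
  assumes dec: "decomposition G G1 G2 v"
  defines "J H \<equiv> (binomial_edge_ideal H :: ('v, 'k::field) xy_poly set)"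
  shows "\<exists>E1 E2. tensor_resolution (seq_complex E1 (\<lambda>_. 1)) (J G1) 0 (seq_complex E2 (\<lambda>_. 1)) (J G2) 0"
proof -
  have simple: "simple_graph G1" "simple_graph G2" and free: "free_vertex G1 v" "free_vertex G2 v"
    and inter: "verts G1 \<inter> verts G2 = {v}"
    using dec by (auto simp: decomposition_def subgraph_def)
  interpret G1: graph_with_free_vertex G1 v by unfold_locales (rule simple free)+
  interpret G2: graph_with_free_vertex G2 v by unfold_locales (rule simple free)+
  have "Inl i \<in> G2.outer_vars \<and> Inr i \<in> G2.outer_vars" if "i \<in> verts G1" for i
    using inter that by (auto simp: G2.outer_vars_def G2.inner_verts_def)
  then obtain E1 where E1: "cyclic_minimal_resolution (seq_complex E1 (\<lambda>_. 1)) (J G1) 0"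
    and E1_outer: "\<forall>i. \<forall>l<rnk E1 i. \<forall>k<rnk E1 (Suc i). diff E1 i l k \<in> polys_in G2.outer_vars"
    using binomial_edge_ideal_minimal_resolution[OF simple(1)] unfolding J_def by metis
  obtain E2 where E2: "cyclic_minimal_resolution (seq_complex E2 (\<lambda>_. 1)) (J G2) 0"
    using binomial_edge_ideal_minimal_resolution[OF simple(2), of UNIV] unfolding J_def by auto
  interpret E1: cyclic_minimal_resolution "seq_complex E1 (\<lambda>_. 1)" "J G1" 0 by (rule E1)
  interpret free_vertex_resolution G2 v "seq_complex E1 (\<lambda>_. 1)" "J G1"
    by unfold_locales (use E1_outer G1.Var_nonzerodivisor in \<open>auto simp: J_def\<close>)
  have "tensor_resolution (seq_complex E1 (\<lambda>_. 1)) (J G1) 0 (seq_complex E2 (\<lambda>_. 1)) (J G2) 0"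
    unfolding J_def
    by (intro tensor_resolution.intro tensor_resolution_axioms.intro
        E1[unfolded J_def] E2[unfolded J_def] tor_binomial_edge_ideal_vanishes) blast
  then show ?thesis by blast
qed

lemma binomial_edge_ideal_decomposition:
  fixes G :: "'v::linorder sgraph"
  assumes "decomposition G G1 G2 v"
  shows "(binomial_edge_ideal G :: ('v, 'k::comm_ring_1) xy_poly set) =
    {a + b |a b. a \<in> binomial_edge_ideal G1 \<and> b \<in> binomial_edge_ideal G2}"
proof -
  have "edges G = edges G1 \<union> edges G2"
    using assms by (simp add: decomposition_def graph_union_def)
  then have "(edge_binomials G :: ('v, 'k) xy_poly set) = edge_binomials G1 \<union> edge_binomials G2"
    by (auto simp: edge_binomials_def)
  then show ?thesis by (simp add: binomial_edge_ideal_eq ideal_gen_Un)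
qed

theorem betti_decomposition:
  fixes G G1 G2 :: "'v::{finite,linorder} sgraph"
  assumes G: "simple_graph G" and dec: "decomposition G G1 G2 v"
  defines "J H \<equiv> (binomial_edge_ideal H :: ('v, 'k::field) xy_poly set)"
  shows "betti (J G) n j = (\<Sum>p\<le>n. \<Sum>a\<le>j. betti (J G1) p a * betti (J G2) (n - p) (j - a))"
    and "betti (J G1) 0 0 > 0" and "betti (J G2) 0 0 > 0"
proof -
  obtain E1 E2 where
    "tensor_resolution (seq_complex E1 (\<lambda>_. 1)) (J G1) 0 (seq_complex E2 (\<lambda>_. 1)) (J G2) 0"
    using decomposition_tensor_resolution[OF dec] unfolding J_def by blast
  then interpret tensor_resolution "seq_complex E1 (\<lambda>_. 1)" "J G1" 0
    "seq_complex E2 (\<lambda>_. 1)" "J G2" 0 .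
  have G12: "simple_graph G1" "simple_graph G2"
    using dec by (auto simp: decomposition_def subgraph_def)
  have "minimal_resolution T (J G)"
    using cyclic_minimal_resolution_tensor
    by (simp add: J_def binomial_edge_ideal_decomposition[OF dec] cyclic_minimal_resolution_def)
  note betti = betti_binomial_edge_ideal_eq_card[OF G this[unfolded J_def], folded J_def]
    betti_binomial_edge_ideal_eq_card[OF G12(1) R.minimal_resolution_axioms[unfolded J_def],
      folded J_def]
    betti_binomial_edge_ideal_eq_card[OF G12(2) R'.minimal_resolution_axioms[unfolded J_def],
      folded J_def]
  show "betti (J G) n j = (\<Sum>p\<le>n. \<Sum>a\<le>j. betti (J G1) p a * betti (J G2) (n - p) (j - a))"
    unfolding betti by (rule card_basis_tensor)
  show "betti (J G1) 0 0 > 0" "betti (J G2) 0 0 > 0"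
    unfolding betti R.basis_0 R'.basis_0
    using R.bdeg_base R'.bdeg_base by (auto simp: card_gt_0_iff)
qed

theorem proposition1p3:
  fixes G G1 G2 :: "'v::{finite,linorder} sgraph" and v :: 'v
  assumes "simple_graph G" and "verts G = UNIV"
    and "connected_graph G" and "decomposable G"
    and "decomposition G G1 G2 v"
  shows "betti_poly (binomial_edge_ideal G :: ('v, 'k::field) xy_poly set) =
    betti_poly (binomial_edge_ideal G1 :: ('v, 'k) xy_poly set) *
    betti_poly (binomial_edge_ideal G2 :: ('v, 'k) xy_poly set)"
  using betti_decomposition[OF assms(1,5)] by (rule betti_poly_mult)

end
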